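(* Let $\theta>0$ be a given constant. Let $\mu_\cdot,\bar\mu_\cdot\in L^2_{\mathscr F}(t_0-\theta,T+\theta)$, $l_\cdot\in L^2_{\mathscr F}(t_0,T)$ and $\sigma_\cdot,\bar\sigma_\cdot\in L^2_{\mathscr F}(t_0-\theta,T+\theta;\mathbb R^{d\times 1})$, and suppose that $\mu_\cdot,\bar\mu_\cdot,\sigma_\cdot,\bar\sigma_\cdot$ are uniformly bounded. Then for all $Q_\cdot\in S^2_{\mathscr F}(T,T+\theta)$ and $P_\cdot\in L^2_{\mathscr F}(T,T+\theta;\mathbb R^d)$, the solution $Y_\cdot$ of the anticipated backward stochastic differential equation $$\begin{cases}-dY_t=\big(\mu_tY_t+\bar\mu_tE^{\mathscr F_t}[Y_{t+\theta}]+Z_t\sigma_t+E^{\mathscr F_t}[Z_{t+\theta}]\bar\sigma_t+l_t\big)\,dt-Z_t\,dW_t,& t\in[t_0,T];\\ Y_t=Q_t,& t\in[T,T+\theta];\\ Z_t=P_t,& t\in[T,T+\theta],\end{cases}$$ is given by the closed formula, for $t\in[t_0,T]$, $$Y_t=E^{\mathscr F_t}\Big[X_TQ_T+\int_t^TX_sl_s\,ds+\int_T^{T+\theta}(Q_s\bar\mu_{s-\theta}+P_s\bar\sigma_{s-\theta})X_{s-\theta}\,ds\Big]\quad\text{a.e., a.s.},$$ where, for the given $t$, $X_\cdot$ is the solution of the stochastic differential delay equation $$\begin{cases}dX_s=(\mu_sX_s+\bar\mu_{s-\theta}X_{s-\theta})\,ds+(X_s\sigma_s^T+X_{s-\theta}\bar\sigma_{s-\theta}^T)\,dW_s,&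 s\in[t,T+\theta];\\ X_t=1;\\ X_s=0,& s\in[t-\theta,t).\end{cases}$$
   Context: $(\Omega,\mathscr F,P,(\mathscr F_t)_{t\ge0})$ is a complete stochastic basis such that $\mathscr F_0$ contains all $P$-null elements of $\mathscr F$, and the filtration is generated by a $d$-dimensional standard Brownian motion $W=(W_t)_{t\ge0}$; for negative times read $\mathscr F_s=\mathscr F_0$. $T>0$ is fixed and $0\le t_0\le T$. $E^{\mathscr F_t}[\cdot]$ denotes conditional expectation given $\mathscr F_t$. Superscript $T$ on $\sigma,\bar\sigma$ denotes transpose. For $a<b$: $L^2_{\mathscr F}(a,b;\mathbb R^m)$ is the set of $\mathbb R^m$-valued $\mathscr F_t$-adapted processes $\varphi$ on $[a,b]$ with $E[\int_a^b|\varphi_t|^2dt]<\infty$ (and similarly with matrix values); $S^2_{\mathscr F}(a,b;\mathbb R^m)$ is the set of continuous processes in $L^2_{\mathscr F}(a,b;\mathbb R^m)$ with $E[\sup_{a\le t\le b}|\varphi_t|^2]<\infty$. When $m=1$ the target space is omitted from the notation. $Y$ is real-valued; $Z_t$ and $P_t$ are $\mathbb R^d$-valued, written as row vectors ($1\times d$), so $Z_t\sigma_t$ and $P_s\bar\sigma_{s-\theta}$ are scalars. A solution of the anticipated equation is a pair of $\mathscr F_t$-adapted processes $(Y_\cdot,Z_\cdot)\in S^2_{\mathscr F}(t_0,T+\theta)\times L^2_{\mathscr F}(t_0,T+\theta;\mathbb R^d)$ satisfying it. *)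

theory Defs
  imports "HOL-Probability.Probability"
begin

section \<open>The Brownian stochastic basis\<close>

definition path_events :: "'w measure \<Rightarrow> (real \<Rightarrow> 'w \<Rightarrow> real ^ 'd) \<Rightarrow> real \<Rightarrow> 'w set set" where
  "path_events M W t = (\<Union>s\<in>{0..t}. sets (vimage_algebra (space M) (W s) borel))"

text \<open>Only the values \<open>W t\<close> with \<open>t \<ge> 0\<close> are meaningful.\<close>

locale standard_brownian_motion = prob_space M
  for M :: "'w measure" +
  fixes W :: "real \<Rightarrow> 'w \<Rightarrow> real ^ 'd"
  assumes W_measurable: "0 \<le> t \<Longrightarrow> W t \<in> borel_measurable M"
    and W_start: "AE \<omega> in M. W 0 \<omega> = 0"
    and W_continuous: "AE \<omega> in M. continuous_on {0..} (\<lambda>t. W t \<omega>)"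
    and W_normal: "0 \<le> s \<Longrightarrow> s < t \<Longrightarrow> distributed M lborel (\<lambda>\<omega>. W t \<omega> - W s \<omega>)
        (\<lambda>x. ennreal (\<Prod>i\<in>UNIV. normal_density 0 (sqrt (t - s)) (x $ i)))"
    and W_indep: "0 \<le> s \<Longrightarrow> s < t \<Longrightarrow> indep_set (sigma_sets (space M) (path_events M W s))
        (sets (vimage_algebra (space M) (\<lambda>\<omega>. W t \<omega> - W s \<omega>) borel))"

text \<open>The filtration is the one generated by \<open>W\<close>, augmented by the null sets; only the
  \<open>\<sigma>\<close>-algebra of \<open>F t\<close> matters, not the measure it carries.\<close>

locale brownian_basis = standard_brownian_motion M W + complete_measure M
  for M :: "'w measure" and W :: "real \<Rightarrow> 'w \<Rightarrow> real ^ 'd" +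
  fixes F :: "real \<Rightarrow> 'w measure"
  assumes sets_F: "0 \<le> t \<Longrightarrow> sets (F t) = sigma_sets (space M) (null_sets M \<union> path_events M W t)"
    and F_negative: "t < 0 \<Longrightarrow> F t = F 0"


section \<open>Spaces of processes\<close>

text \<open>Processes are taken jointly measurable, which is what gives the iterated integrals below
  a meaning; adaptedness is required pointwise in time.\<close>

definition adapted_on ::
  "'w measure \<Rightarrow> (real \<Rightarrow> 'w measure) \<Rightarrow> real \<Rightarrow> real \<Rightarrow> (real \<Rightarrow> 'w \<Rightarrow> 'b::euclidean_space) \<Rightarrow> bool" where
  "adapted_on M F a b \<phi> \<longleftrightarrow>
     (\<lambda>(t, \<omega>). \<phi> t \<omega>) \<in> borel_measurable (restrict_space borel {a..b} \<Otimes>\<^sub>M M) \<and>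
     (\<forall>t\<in>{a..b}. \<phi> t \<in> borel_measurable (F t))"

definition L2_process ::
  "'w measure \<Rightarrow> (real \<Rightarrow> 'w measure) \<Rightarrow> real \<Rightarrow> real \<Rightarrow> (real \<Rightarrow> 'w \<Rightarrow> 'b::euclidean_space) set" where
  "L2_process M F a b = {\<phi>. adapted_on M F a b \<phi> \<and>
     (\<integral>\<^sup>+\<omega>. (\<integral>\<^sup>+t\<in>{a..b}. ennreal ((norm (\<phi> t \<omega>))\<^sup>2) \<partial>lborel) \<partial>M) < \<infinity>}"

definition S2_process ::
  "'w measure \<Rightarrow> (real \<Rightarrow> 'w measure) \<Rightarrow> real \<Rightarrow> real \<Rightarrow> (real \<Rightarrow> 'w \<Rightarrow> 'b::euclidean_space) set" where
  "S2_process M F a b = {\<phi> \<in> L2_process M F a b.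
     (AE \<omega> in M. continuous_on {a..b} (\<lambda>t. \<phi> t \<omega>)) \<and>
     (\<integral>\<^sup>+\<omega>. (SUP t\<in>{a..b}. ennreal ((norm (\<phi> t \<omega>))\<^sup>2)) \<partial>M) < \<infinity>}"

definition uniformly_bounded ::
  "'w measure \<Rightarrow> real \<Rightarrow> real \<Rightarrow> (real \<Rightarrow> 'w \<Rightarrow> 'b::euclidean_space) \<Rightarrow> bool" where
  "uniformly_bounded M a b \<phi> \<longleftrightarrow> (\<exists>C. \<forall>t\<in>{a..b}. \<forall>\<omega>\<in>space M. norm (\<phi> t \<omega>) \<le> C)"

text \<open>\<open>U\<close> is a version of the process \<open>t \<mapsto> E[\<phi>\<^sub>t | F\<^sub>t]\<close>. The library's \<open>real_cond_exp\<close> picks a version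
  for each \<open>t\<close> separately, so its dependence on \<open>t\<close> need not be measurable; in time integrals one
  has to use a jointly measurable adapted version. It is unique up to \<open>dt \<otimes> P\<close>-null sets.
  Vector-valued conditional expectations are taken coordinatewise.\<close>

definition cond_exp_process ::
  "'w measure \<Rightarrow> (real \<Rightarrow> 'w measure) \<Rightarrow> real \<Rightarrow> real \<Rightarrow>
   (real \<Rightarrow> 'w \<Rightarrow> 'b::euclidean_space) \<Rightarrow> (real \<Rightarrow> 'w \<Rightarrow> 'b) \<Rightarrow> bool" where
  "cond_exp_process M F a b \<phi> U \<longleftrightarrow> adapted_on M F a b U \<and>
     (AE t in lborel. t \<in> {a..b} \<longrightarrow>
       (AE \<omega> in M. \<forall>e\<in>Basis. U t \<omega> \<bullet> e = real_cond_exp M (F t) (\<lambda>\<omega>'. \<phi> t \<omega>' \<bullet> e) \<omega>))"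


section \<open>The Ito integral\<close>

text \<open>A simple process on \<open>[a,b]\<close> is \<open>\<Sum>i<n. \<xi>\<^sub>i 1\<^bsub>(\<tau>\<^sub>i, \<tau>\<^sub>i\<^sub>+\<^sub>1]\<^esub>\<close> with \<open>\<xi>\<^sub>i\<close> bounded and measurable
  at time \<open>\<tau>\<^sub>i\<close>; the values of \<open>\<tau>\<close> beyond \<open>n\<close> and of \<open>\<xi>\<close> from \<open>n\<close> on are irrelevant.\<close>

definition simple_data ::
  "'w measure \<Rightarrow> (real \<Rightarrow> 'w measure) \<Rightarrow> real \<Rightarrow> real \<Rightarrow>
   nat \<Rightarrow> (nat \<Rightarrow> real) \<Rightarrow> (nat \<Rightarrow> 'w \<Rightarrow> real ^ 'd) \<Rightarrow> bool" where
  "simple_data M F a b n \<tau> \<xi> \<longleftrightarrow>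
     a \<le> \<tau> 0 \<and> \<tau> n \<le> b \<and> (\<forall>i<n. \<tau> i \<le> \<tau> (Suc i)) \<and>
     (\<forall>i<n. \<xi> i \<in> borel_measurable (F (\<tau> i)) \<and> (\<exists>C. \<forall>\<omega>\<in>space M. norm (\<xi> i \<omega>) \<le> C))"

definition simple_process ::
  "nat \<Rightarrow> (nat \<Rightarrow> real) \<Rightarrow> (nat \<Rightarrow> 'w \<Rightarrow> real ^ 'd) \<Rightarrow> real \<Rightarrow> 'w \<Rightarrow> real ^ 'd" where
  "simple_process n \<tau> \<xi> t \<omega> = (\<Sum>i<n. indicator {\<tau> i<..\<tau> (Suc i)} t *\<^sub>R \<xi> i \<omega>)"

definition simple_integral ::
  "(real \<Rightarrow> 'w \<Rightarrow> real ^ 'd) \<Rightarrow> nat \<Rightarrow> (nat \<Rightarrow> real) \<Rightarrow> (nat \<Rightarrow> 'w \<Rightarrow> real ^ 'd) \<Rightarrow> 'w \<Rightarrow> real" where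
  "simple_integral W n \<tau> \<xi> \<omega> = (\<Sum>i<n. \<xi> i \<omega> \<bullet> (W (\<tau> (Suc i)) \<omega> - W (\<tau> i) \<omega>))"

text \<open>\<open>I\<close> is (a version of) \<open>\<integral>\<^sub>a\<^sup>b \<phi>\<^sub>t dW\<^sub>t\<close>, with \<open>\<phi>\<^sub>t\<close> read as a row vector: the \<open>L\<^sup>2(P)\<close>-limit of the
  integrals of simple processes that approximate \<open>\<phi>\<close> in \<open>L\<^sup>2(dt \<otimes> P)\<close>.\<close>

definition has_ito_integral ::
  "'w measure \<Rightarrow> (real \<Rightarrow> 'w measure) \<Rightarrow> (real \<Rightarrow> 'w \<Rightarrow> real ^ 'd) \<Rightarrow> real \<Rightarrow> real \<Rightarrow>
   (real \<Rightarrow> 'w \<Rightarrow> real ^ 'd) \<Rightarrow> ('w \<Rightarrow> real) \<Rightarrow> bool" where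
  "has_ito_integral M F W a b \<phi> I \<longleftrightarrow> I \<in> borel_measurable M \<and>
     (\<exists>n \<tau> \<xi>. (\<forall>k::nat. simple_data M F a b (n k) (\<tau> k) (\<xi> k)) \<and>
       ((\<lambda>k. \<integral>\<^sup>+\<omega>. (\<integral>\<^sup>+t\<in>{a..b}.
            ennreal ((norm (\<phi> t \<omega> - simple_process (n k) (\<tau> k) (\<xi> k) t \<omega>))\<^sup>2) \<partial>lborel) \<partial>M)
          \<longlonglongrightarrow> 0) \<and>
       ((\<lambda>k. \<integral>\<^sup>+\<omega>. ennreal ((I \<omega> - simple_integral W (n k) (\<tau> k) (\<xi> k) \<omega>)\<^sup>2) \<partial>M)
          \<longlonglongrightarrow> 0))"


section \<open>The two equations\<close>

text \<open>Both equations are read in integrated form. Products of a row with a column vector, such as \<open>Z\<^sub>t \<sigma>\<^sub>t\<close>,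
  become inner products in \<open>real ^ 'd\<close>, and transposition is invisible there.
  \<open>\<mu>'\<close> and \<open>\<sigma>'\<close> are the coefficients of the anticipated (respectively delayed) terms.
  The processes \<open>U\<close>, \<open>V\<close> stand for \<open>E[Y\<^sub>t\<^sub>+\<^sub>\<theta> | F\<^sub>t]\<close> and \<open>E[Z\<^sub>t\<^sub>+\<^sub>\<theta> | F\<^sub>t]\<close>.
  The terminal condition on \<open>Z\<close>, an element of \<open>L\<^sup>2\<close>, is an equality almost everywhere.\<close>

definition solves_anticipated_bsde where
  "solves_anticipated_bsde M F (W :: real \<Rightarrow> 'w \<Rightarrow> real ^ 'd) t0 T \<theta> \<mu> \<mu>' \<sigma> \<sigma>' l Q P Y Z \<longleftrightarrow>
     Y \<in> S2_process M F t0 (T + \<theta>) \<and> Z \<in> L2_process M F t0 (T + \<theta>) \<and>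
     (\<exists>U V.
        cond_exp_process M F t0 T (\<lambda>t. Y (t + \<theta>)) U \<and>
        cond_exp_process M F t0 T (\<lambda>t. Z (t + \<theta>)) V \<and>
        (\<forall>t\<in>{t0..T}. \<exists>I. has_ito_integral M F W t T Z I \<and>
          (AE \<omega> in M. Y t \<omega> = Y T \<omega>
             + (LINT s:{t..T}|lborel. \<mu> s \<omega> * Y s \<omega> + \<mu>' s \<omega> * U s \<omega>
                  + Z s \<omega> \<bullet> \<sigma> s \<omega> + V s \<omega> \<bullet> \<sigma>' s \<omega> + l s \<omega>)
             - I \<omega>))) \<and>
     (\<forall>t\<in>{T..T + \<theta>}. AE \<omega> in M. Y t \<omega> = Q t \<omega>) \<and>
     (AE t in lborel. t \<in> {T..T + \<theta>} \<longrightarrow> (AE \<omega> in M. Z t \<omega> = P t \<omega>))"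

text \<open>The solution is continuous on \<open>[t, T + \<theta>]\<close> only: it jumps from 0 to 1 at the initial time \<open>t\<close>.\<close>

definition solves_delay_sde where
  "solves_delay_sde M F (W :: real \<Rightarrow> 'w \<Rightarrow> real ^ 'd) T \<theta> \<mu> \<mu>' \<sigma> \<sigma>' t X \<longleftrightarrow>
     X \<in> L2_process M F (t - \<theta>) (T + \<theta>) \<and> X \<in> S2_process M F t (T + \<theta>) \<and>
     (\<forall>s\<in>{t..T + \<theta>}. \<exists>I.
        has_ito_integral M F W t s
          (\<lambda>r \<omega>. X r \<omega> *\<^sub>R \<sigma> r \<omega> + X (r - \<theta>) \<omega> *\<^sub>R \<sigma>' (r - \<theta>) \<omega>) I \<and>
        (AE \<omega> in M. X s \<omega> = X t \<omega>
           + (LINT r:{t..s}|lborel. \<mu> r \<omega> * X r \<omega> + \<mu>' (r - \<theta>) \<omega> * X (r - \<theta>) \<omega>)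
           + I \<omega>)) \<and>
     (AE \<omega> in M. X t \<omega> = 1) \<and>
     (\<forall>s\<in>{t - \<theta>..<t}. AE \<omega> in M. X s \<omega> = 0)"

end

theory Submission
  imports Defs
begin

text \<open>
  The Ito formula for \<open>X Y\<close> is only needed in expectation over an event \<open>G\<close> of \<open>F t\<close>, and
  in that form it follows from three \<open>L\<^sup>2\<close> facts on the Ito integral: it is orthogonal to the past,
  it is a martingale, and it is an isometry. Writing \<open>X = A + J\<close> and \<open>Y = B + I\<close> with drift parts \<open>A\<close>, \<open>B\<close>
  and martingale parts \<open>J\<close>, \<open>I\<close>, Fubini's theorem turns \<open>A\<^sub>T B\<^sub>T\<close> into iterated integrals and
  orthogonality disposes of the mixed terms, while \<open>E[1\<^sub>G J\<^sub>T I\<^sub>T]\<close> is given by the isometry.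
  In the resulting drift of \<open>X Y\<close> the coefficients \<open>\<mu>\<close>, \<open>\<sigma>\<close> cancel, the conditional expectations can be
  dropped, and after a time shift by \<open>\<theta>\<close> the anticipated terms cancel the delayed ones except on
  \<open>[T, T + \<theta>]\<close>.
\<close>

section \<open>Square-integrable functions\<close>

text \<open>The equations supply Ito integrals as separate random variables, one for each interval:
  nothing ties the versions at different times together, neither measurability in time nor
  additivity over adjacent intervals. This obstacle shapes the proof. Both equations are rewritten
  so that the terminal value equals the value at \<open>r\<close> plus the drift over
  \<open>[r, T]\<close> plus a remainder orthogonal to \<open>F r\<close>. The remainder is tested
  at one fixed \<open>r\<close> at a time and has disappeared before time is integrated. For the
  forward equation of \<open>X\<close> the remainder is a difference of two unrelated integrals; its
  orthogonality is the martingale property, obtained by comparing two approximating sequences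
  through the isometry.

  Working over events \<open>G\<close> of \<open>F t\<close> loses nothing, since such integrals
  characterize the conditional expectation. As \<open>G\<close> is known at time \<open>t\<close>,
  its indicator can be carried along by \<open>X\<close> without harming adaptedness. The uniform
  bounds on the coefficients keep every drift and diffusion term square integrable, so that all
  products of two such terms are integrable.\<close>

definition L2_fun :: "'a measure \<Rightarrow> ('a \<Rightarrow> 'b::euclidean_space) \<Rightarrow> bool" where
  "L2_fun N f \<longleftrightarrow> f \<in> borel_measurable N \<and> integrable N (\<lambda>x. (norm (f x))\<^sup>2)"

lemma L2_fun_measurable: "L2_fun N f \<Longrightarrow> f \<in> borel_measurable N"
  by (simp add: L2_fun_def)

lemma L2_fun_inner:
  assumes "L2_fun N f" "L2_fun N g"
  shows "integrable N (\<lambda>x. f x \<bullet> g x)"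
proof (rule Bochner_Integration.integrable_bound)
  have [measurable]: "f \<in> borel_measurable N" "g \<in> borel_measurable N"
    using assms by (auto simp: L2_fun_def)
  show "integrable N (\<lambda>x. (norm (f x))\<^sup>2 + (norm (g x))\<^sup>2)"
    using assms by (auto simp: L2_fun_def)
  show "(\<lambda>x. f x \<bullet> g x) \<in> borel_measurable N" by measurable
  have "\<bar>u \<bullet> v\<bar> \<le> (norm u)\<^sup>2 + (norm v)\<^sup>2" for u v :: 'b
  proof -
    have "\<bar>u \<bullet> v\<bar> \<le> norm u * norm v" by (rule Cauchy_Schwarz_ineq2)
    also have "\<dots> \<le> (norm u)\<^sup>2 + (norm v)\<^sup>2"
      using sum_squares_bound[of "norm u" "norm v"] mult_nonneg_nonneg[OF norm_ge_zero norm_ge_zero, of u v]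
      by linarith
    finally show ?thesis .
  qed
  then show "AE x in N. norm (f x \<bullet> g x) \<le> norm ((norm (f x))\<^sup>2 + (norm (g x))\<^sup>2)"
    by (simp add: real_norm_def)
qed

lemma L2_fun_mult:
  fixes f g :: "'a \<Rightarrow> real"
  assumes "L2_fun N f" "L2_fun N g"
  shows "integrable N (\<lambda>x. f x * g x)"
  using L2_fun_inner[OF assms] by simp

lemma L2_fun_bound:
  fixes f :: "'a \<Rightarrow> 'b::euclidean_space" and g :: "'a \<Rightarrow> 'c::euclidean_space"
  assumes "L2_fun N f" "g \<in> borel_measurable N"
    and "AE x in N. norm (g x) \<le> C * norm (f x)"
  shows "L2_fun N g"
  unfolding L2_fun_def
proof (intro conjI assms)
  show "integrable N (\<lambda>x. (norm (g x))\<^sup>2)"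
  proof (rule Bochner_Integration.integrable_bound)
    show "integrable N (\<lambda>x. C\<^sup>2 * (norm (f x))\<^sup>2)"
      using assms by (auto simp: L2_fun_def)
    show "(\<lambda>x. (norm (g x))\<^sup>2) \<in> borel_measurable N" using assms(2) by measurable
    show "AE x in N. norm ((norm (g x))\<^sup>2) \<le> norm (C\<^sup>2 * (norm (f x))\<^sup>2)"
      using assms(3)
    proof eventually_elim
      case (elim x)
      have "(norm (g x))\<^sup>2 \<le> (C * norm (f x))\<^sup>2" by (intro power_mono elim) simp
      then show ?case by (simp add: power_mult_distrib)
    qed
  qed
qed

lemma L2_fun_scaleR:
  assumes "L2_fun N f" "h \<in> borel_measurable N" "AE x in N. \<bar>h x\<bar> \<le> C"
  shows "L2_fun N (\<lambda>x. h x *\<^sub>R f x)"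
proof (rule L2_fun_bound[OF assms(1), of _ C])
  show "(\<lambda>x. h x *\<^sub>R f x) \<in> borel_measurable N"
    using assms(2) L2_fun_measurable[OF assms(1)] by measurable
  show "AE x in N. norm (h x *\<^sub>R f x) \<le> C * norm (f x)"
    using assms(3) by eventually_elim (auto intro: mult_right_mono)
qed

lemma L2_fun_add:
  assumes "L2_fun N f" "L2_fun N g"
  shows "L2_fun N (\<lambda>x. f x + g x)"
  unfolding L2_fun_def
proof
  have [measurable]: "f \<in> borel_measurable N" "g \<in> borel_measurable N"
    using assms by (auto simp: L2_fun_def)
  show "(\<lambda>x. f x + g x) \<in> borel_measurable N" by measurable
  show "integrable N (\<lambda>x. (norm (f x + g x))\<^sup>2)"
  proof (rule Bochner_Integration.integrable_bound)
    show "integrable N (\<lambda>x. 2 * (norm (f x))\<^sup>2 + 2 * (norm (g x))\<^sup>2)"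
      using assms by (auto simp: L2_fun_def)
    show "(\<lambda>x. (norm (f x + g x))\<^sup>2) \<in> borel_measurable N" by measurable
    have "(norm (u + v))\<^sup>2 \<le> 2 * (norm u)\<^sup>2 + 2 * (norm v)\<^sup>2" for u v :: 'b
      using inner_ge_zero[of "u - v"]
      by (simp add: power2_norm_eq_inner inner_diff_left inner_diff_right inner_add_left inner_add_right
          inner_commute)
    then show "AE x in N. norm ((norm (f x + g x))\<^sup>2) \<le> norm (2 * (norm (f x))\<^sup>2 + 2 * (norm (g x))\<^sup>2)"
      by simp
  qed
qed

lemma L2_fun_cmult:
  "L2_fun N f \<Longrightarrow> L2_fun N (\<lambda>x. c *\<^sub>R f x)"
  by (rule L2_fun_scaleR[of _ _ _ "\<bar>c\<bar>"]) auto

lemma L2_fun_diff: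
  assumes "L2_fun N f" "L2_fun N g"
  shows "L2_fun N (\<lambda>x. f x - g x)"
  using L2_fun_add[OF assms(1) L2_fun_cmult[OF assms(2), of "-1"]] by simp

lemma L2_fun_zero: "L2_fun N (\<lambda>x. 0)"
  by (simp add: L2_fun_def)

lemma L2_fun_sum:
  assumes "\<And>i. i \<in> I \<Longrightarrow> L2_fun N (f i)"
  shows "L2_fun N (\<lambda>x. \<Sum>i\<in>I. f i x)"
  using assms
  by (induction I rule: infinite_finite_induct)
     (auto intro: L2_fun_zero L2_fun_add)

lemma L2_fun_indicator:
  assumes "L2_fun N f" "A \<in> sets N"
  shows "L2_fun N (\<lambda>x. indicator A x *\<^sub>R f x)"
  by (rule L2_fun_scaleR[of _ _ _ 1]) (use assms in \<open>auto simp: indicator_def\<close>)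

lemma (in finite_measure) L2_fun_bounded:
  assumes "f \<in> borel_measurable M" "\<And>x. x \<in> space M \<Longrightarrow> norm (f x) \<le> C"
  shows "L2_fun M f"
proof (rule L2_fun_bound[of _ "\<lambda>_. 1::real" _ C])
  show "L2_fun M (\<lambda>_. 1::real)" by (simp add: L2_fun_def)
qed (use assms in \<open>auto intro!: AE_I2\<close>)

lemma (in finite_measure) L2_fun_imp_integrable:
  fixes f :: "'a \<Rightarrow> 'b::euclidean_space"
  assumes "L2_fun M f"
  shows "integrable M f"
proof (rule Bochner_Integration.integrable_bound)
  show "integrable M (\<lambda>x. 1 + (norm (f x))\<^sup>2)" using assms by (simp add: L2_fun_def)
  have "norm u \<le> 1 + (norm u)\<^sup>2" for u :: 'b
    using sum_squares_bound[of 1 "norm u"] by (simp, smt (verit) norm_ge_zero)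
  then show "AE x in M. norm (f x) \<le> norm (1 + (norm (f x))\<^sup>2)"
    by simp
qed (rule L2_fun_measurable[OF assms])

lemma L2_fun_iff_nn_integral:
  "L2_fun N f \<longleftrightarrow>
     f \<in> borel_measurable N \<and> (\<integral>\<^sup>+x. ennreal ((norm (f x))\<^sup>2) \<partial>N) < \<infinity>"
  by (auto simp: L2_fun_def integrable_iff_bounded)

text \<open>The integral of the squared norm of \<open>f - s g\<close> is a nonnegative quadratic
  polynomial in \<open>s\<close>, so its discriminant is not positive. The arbitrary measure allows
  uses on \<open>M\<close>, on Lebesgue measure and on their product.\<close>

lemma L2_fun_Cauchy_Schwarz:
  assumes f: "L2_fun N f" and g: "L2_fun N g"
  shows "\<bar>\<integral>x. f x \<bullet> g x \<partial>N\<bar> \<le>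
    sqrt (\<integral>x. (norm (f x))\<^sup>2 \<partial>N) * sqrt (\<integral>x. (norm (g x))\<^sup>2 \<partial>N)"
proof -
  define A where "A = (\<integral>x. (norm (f x))\<^sup>2 \<partial>N)"
  define B where "B = (\<integral>x. f x \<bullet> g x \<partial>N)"
  define C where "C = (\<integral>x. (norm (g x))\<^sup>2 \<partial>N)"
  have int: "integrable N (\<lambda>x. (norm (f x))\<^sup>2)" "integrable N (\<lambda>x. (norm (g x))\<^sup>2)"
    "integrable N (\<lambda>x. f x \<bullet> g x)"
    using f g L2_fun_inner[OF f g] by (auto simp: L2_fun_def)
  have quad: "0 \<le> A - 2 * s * B + s\<^sup>2 * C" for s
  proof -
    have "0 \<le> (\<integral>x. (norm (f x - s *\<^sub>R g x))\<^sup>2 \<partial>N)" by (rule integral_nonneg_AE) simp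
    also have "\<dots> = (\<integral>x. (norm (f x))\<^sup>2 - 2 * s * (f x \<bullet> g x) + s\<^sup>2 * (norm (g x))\<^sup>2 \<partial>N)"
      by (rule Bochner_Integration.integral_cong[OF refl], unfold power2_norm_eq_inner)
         (simp add: inner_diff_left inner_diff_right inner_commute algebra_simps power2_eq_square)
    also have "\<dots> = A - 2 * s * B + s\<^sup>2 * C"
      unfolding A_def B_def C_def using int by simp
    finally show ?thesis .
  qed
  have C0: "0 \<le> C" unfolding C_def by (rule integral_nonneg_AE) simp
  have A0: "0 \<le> A" unfolding A_def by (rule integral_nonneg_AE) simp
  have "B\<^sup>2 \<le> A * C"
  proof (cases "C = 0")
    case True
    \<comment> \<open>The polynomial is now affine in \<open>s\<close>; at
      \<open>(A + 1) / (2 * B)\<close> its value would be -1.\<close>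
    have "B = 0"
    proof (rule ccontr)
      assume "B \<noteq> 0"
      then show False using quad[of "(A + 1) / (2 * B)"] True by (simp add: field_simps)
    qed
    then show ?thesis using True by simp
  next
    case False
    with C0 have "0 < C" by simp
    \<comment> \<open>\<open>B / C\<close> is the minimizer of the quadratic.\<close>
    then show ?thesis using quad[of "B / C"] by (simp add: field_simps power2_eq_square)
  qed
  then have "sqrt (B\<^sup>2) \<le> sqrt (A * C)" by (rule real_sqrt_le_mono)
  then show ?thesis unfolding A_def B_def C_def by (simp add: real_sqrt_mult)
qed

text \<open>Square integrability is included because the Bochner integral of a non-integrable
  function is 0, so the bare limit condition could hold for the wrong reason.\<close>

definition L2_tendsto ::
  "'a measure \<Rightarrow> (nat \<Rightarrow> 'a \<Rightarrow> 'b::euclidean_space) \<Rightarrow> ('a \<Rightarrow> 'b) \<Rightarrow> bool" where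
  "L2_tendsto N f g \<longleftrightarrow> (\<forall>k. L2_fun N (f k)) \<and> L2_fun N g \<and>
     (\<lambda>k. \<integral>x. (norm (f k x - g x))\<^sup>2 \<partial>N) \<longlonglongrightarrow> 0"

text \<open>Passage from the nonnegative integrals in \<open>has_ito_integral\<close> to Bochner
  integrals, where subtraction is available.\<close>

lemma L2_tendsto_iff_nn_integral:
  assumes "\<And>k. L2_fun N (f k)" "L2_fun N g"
  shows "L2_tendsto N f g \<longleftrightarrow> (\<lambda>k. \<integral>\<^sup>+x. ennreal ((norm (g x - f k x))\<^sup>2) \<partial>N) \<longlonglongrightarrow> 0"
proof -
  have "(\<integral>\<^sup>+x. ennreal ((norm (g x - f k x))\<^sup>2) \<partial>N) = ennreal (\<integral>x. (norm (f k x - g x))\<^sup>2 \<partial>N)" for k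
    using L2_fun_diff[OF assms(1)[of k] assms(2)]
    by (subst norm_minus_commute) (auto intro!: nn_integral_eq_integral simp: L2_fun_def)
  moreover have "(\<lambda>k. ennreal (\<integral>x. (norm (f k x - g x))\<^sup>2 \<partial>N)) \<longlonglongrightarrow> 0 \<longleftrightarrow>
    (\<lambda>k. \<integral>x. (norm (f k x - g x))\<^sup>2 \<partial>N) \<longlonglongrightarrow> 0"
    by (rule tendsto_ennreal_iff[where x = 0, simplified]) (auto intro!: always_eventually)
  ultimately show ?thesis using assms by (simp add: L2_tendsto_def)
qed

lemma L2_tendsto_const: "L2_fun N f \<Longrightarrow> L2_tendsto N (\<lambda>_. f) f"
  by (simp add: L2_tendsto_def)

text \<open>The comparison behind modified approximations: cutting them in time or multiplying them
  by a bounded variable enlarges the error at most by a factor \<open>C\<close>.\<close>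

lemma L2_tendsto_dominated:
  fixes f :: "nat \<Rightarrow> 'a \<Rightarrow> 'b::euclidean_space" and u :: "nat \<Rightarrow> 'a \<Rightarrow> 'c::euclidean_space"
  assumes u: "L2_tendsto N u v"
    and f: "\<And>k. L2_fun N (f k)" "L2_fun N g"
    and le: "\<And>k x. x \<in> space N \<Longrightarrow> norm (f k x - g x) \<le> C * norm (u k x - v x)"
  shows "L2_tendsto N f g"
  unfolding L2_tendsto_def
proof (intro conjI allI f)
  have lim: "(\<lambda>k. C\<^sup>2 * (\<integral>x. (norm (u k x - v x))\<^sup>2 \<partial>N)) \<longlonglongrightarrow> 0"
    using tendsto_mult_left[of _ 0 sequentially "C\<^sup>2"] u by (simp add: L2_tendsto_def)
  show "(\<lambda>k. \<integral>x. (norm (f k x - g x))\<^sup>2 \<partial>N) \<longlonglongrightarrow> 0"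
  proof (rule Lim_null_comparison[OF always_eventually lim], rule allI)
    fix k
    have "(\<integral>x. (norm (f k x - g x))\<^sup>2 \<partial>N) \<le> (\<integral>x. C\<^sup>2 * (norm (u k x - v x))\<^sup>2 \<partial>N)"
    proof (rule integral_mono)
      show "integrable N (\<lambda>x. (norm (f k x - g x))\<^sup>2)"
        using L2_fun_diff[OF f(1)[of k] f(2)] by (simp add: L2_fun_def)
      show "integrable N (\<lambda>x. C\<^sup>2 * (norm (u k x - v x))\<^sup>2)"
        using L2_fun_diff[of N "u k" v] u by (simp add: L2_fun_def L2_tendsto_def)
      show "(norm (f k x - g x))\<^sup>2 \<le> C\<^sup>2 * (norm (u k x - v x))\<^sup>2" if "x \<in> space N" for x
        using power_mono[OF le[OF that, of k] norm_ge_zero, of 2] by (simp add: power_mult_distrib)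
    qed
    then show "norm (\<integral>x. (norm (f k x - g x))\<^sup>2 \<partial>N) \<le> C\<^sup>2 * (\<integral>x. (norm (u k x - v x))\<^sup>2 \<partial>N)"
      by (simp add: integral_nonneg_AE)
  qed
qed

text \<open>With errors \<open>u\<close> and \<open>v\<close>, the difference of the inner products
  is \<open>u \<bullet> v + u \<bullet> g' + f' \<bullet> v\<close>, and Cauchy-Schwarz makes each
  term small. This continuity carries identities for simple integrals over to Ito integrals.\<close>

lemma L2_tendsto_inner:
  assumes f: "L2_tendsto N f f'" and g: "L2_tendsto N g g'"
  shows "(\<lambda>k. \<integral>x. f k x \<bullet> g k x \<partial>N) \<longlonglongrightarrow> (\<integral>x. f' x \<bullet> g' x \<partial>N)"
proof -
  have sq: "L2_fun N (f k)" "L2_fun N f'"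
    "L2_fun N (g k)" "L2_fun N g'" for k
    using f g by (auto simp: L2_tendsto_def)
  let ?n = "\<lambda>h. sqrt (\<integral>x. (norm (h x))\<^sup>2 \<partial>N)"
  have f0: "(\<lambda>k. ?n (\<lambda>x. f k x - f' x)) \<longlonglongrightarrow> 0" and g0: "(\<lambda>k. ?n (\<lambda>x. g k x - g' x)) \<longlonglongrightarrow> 0"
    using f g tendsto_real_sqrt[of _ 0] by (auto simp: L2_tendsto_def)
  have lim: "(\<lambda>k. ?n (\<lambda>x. f k x - f' x) * ?n (\<lambda>x. g k x - g' x) + ?n (\<lambda>x. f k x - f' x) * ?n g'
      + ?n f' * ?n (\<lambda>x. g k x - g' x)) \<longlonglongrightarrow> 0"
    using tendsto_add[OF tendsto_add[OF tendsto_mult[OF f0 g0] tendsto_mult[OF f0 tendsto_const[of "?n g'"]]]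
      tendsto_mult[OF tendsto_const[of "?n f'"] g0]] by simp
  have "(\<lambda>k. (\<integral>x. f k x \<bullet> g k x \<partial>N) - (\<integral>x. f' x \<bullet> g' x \<partial>N)) \<longlonglongrightarrow> 0"
  proof (rule Lim_null_comparison[OF always_eventually lim], rule allI)
    fix k
    let ?u = "\<lambda>x. f k x - f' x" and ?v = "\<lambda>x. g k x - g' x"
    have su: "L2_fun N ?u" and sv: "L2_fun N ?v"
      by (intro L2_fun_diff sq)+
    have "(\<integral>x. f k x \<bullet> g k x \<partial>N) - (\<integral>x. f' x \<bullet> g' x \<partial>N) = (\<integral>x. f k x \<bullet> g k x - f' x \<bullet> g' x \<partial>N)"
      by (intro Bochner_Integration.integral_diff[symmetric] L2_fun_inner sq)
    also have "\<dots> = (\<integral>x. ?u x \<bullet> ?v x + ?u x \<bullet> g' x + f' x \<bullet> ?v x \<partial>N)"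
      by (intro Bochner_Integration.integral_cong) (auto simp: algebra_simps inner_diff_left inner_diff_right)
    also have "\<dots> = (\<integral>x. ?u x \<bullet> ?v x \<partial>N) + (\<integral>x. ?u x \<bullet> g' x \<partial>N) + (\<integral>x. f' x \<bullet> ?v x \<partial>N)"
      using L2_fun_inner[OF su sv] L2_fun_inner[OF su sq(4)]
        L2_fun_inner[OF sq(2) sv] by simp
    finally show "norm ((\<integral>x. f k x \<bullet> g k x \<partial>N) - (\<integral>x. f' x \<bullet> g' x \<partial>N)) \<le>
        ?n ?u * ?n ?v + ?n ?u * ?n g' + ?n f' * ?n ?v"
      using L2_fun_Cauchy_Schwarz[OF su sv] L2_fun_Cauchy_Schwarz[OF su sq(4)]
        L2_fun_Cauchy_Schwarz[OF sq(2) sv] by simp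
  qed
  then show ?thesis by (simp add: LIM_zero_iff)
qed

lemma L2_tendsto_diff:
  assumes f: "L2_tendsto N f f'" and g: "L2_tendsto N g g'"
  shows "L2_tendsto N (\<lambda>k x. f k x - g k x) (\<lambda>x. f' x - g' x)"
proof -
  have sq: "L2_fun N (f k)" "L2_fun N f'"
    "L2_fun N (g k)" "L2_fun N g'" for k
    using f g by (auto simp: L2_tendsto_def)
  let ?a = "\<lambda>k. \<integral>x. (norm (f k x - f' x))\<^sup>2 \<partial>N" and ?b = "\<lambda>k. \<integral>x. (norm (g k x - g' x))\<^sup>2 \<partial>N"
  have lim: "(\<lambda>k. 2 * ?a k + 2 * ?b k) \<longlonglongrightarrow> 0"
    using tendsto_add[OF tendsto_mult_left[of ?a 0 _ 2] tendsto_mult_left[of ?b 0 _ 2]] f g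
    by (simp add: L2_tendsto_def)
  have "(\<lambda>k. \<integral>x. (norm (f k x - g k x - (f' x - g' x)))\<^sup>2 \<partial>N) \<longlonglongrightarrow> 0"
  proof (rule Lim_null_comparison[OF always_eventually lim], rule allI)
    fix k
    have i: "integrable N (\<lambda>x. (norm (f k x - f' x))\<^sup>2)" "integrable N (\<lambda>x. (norm (g k x - g' x))\<^sup>2)"
      using L2_fun_diff[OF sq(1,2)] L2_fun_diff[OF sq(3,4)]
      by (auto simp: L2_fun_def)
    have "(\<integral>x. (norm (f k x - g k x - (f' x - g' x)))\<^sup>2 \<partial>N) \<le>
        (\<integral>x. 2 * (norm (f k x - f' x))\<^sup>2 + 2 * (norm (g k x - g' x))\<^sup>2 \<partial>N)"
    proof (rule integral_mono)
      show "integrable N (\<lambda>x. (norm (f k x - g k x - (f' x - g' x)))\<^sup>2)"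
        using L2_fun_diff[OF L2_fun_diff[OF sq(1,3)] L2_fun_diff[OF sq(2,4)]]
        by (simp add: L2_fun_def)
      have "(norm (u - v))\<^sup>2 \<le> 2 * (norm u)\<^sup>2 + 2 * (norm v)\<^sup>2" for u v :: 'b
        using inner_ge_zero[of "u + v"]
        by (simp add: power2_norm_eq_inner inner_diff_left inner_diff_right inner_add_left
            inner_add_right inner_commute)
      from this[of "f k x - f' x" "g k x - g' x" for x]
      show "(norm (f k x - g k x - (f' x - g' x)))\<^sup>2 \<le>
          2 * (norm (f k x - f' x))\<^sup>2 + 2 * (norm (g k x - g' x))\<^sup>2" for x
        by (simp add: algebra_simps)
    qed (use i in simp)
    also have "\<dots> = 2 * ?a k + 2 * ?b k" using i by simp
    finally show "norm (\<integral>x. (norm (f k x - g k x - (f' x - g' x)))\<^sup>2 \<partial>N) \<le> 2 * ?a k + 2 * ?b k"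
      by (simp add: integral_nonneg_AE)
  qed
  then show ?thesis
    unfolding L2_tendsto_def by (auto intro: L2_fun_diff sq)
qed

section \<open>Iterated integrals\<close>

lemma integral_split_at:
  fixes v :: "real \<Rightarrow> real"
  assumes v: "integrable lborel v"
  shows "(\<integral>s. indicator {r..} s * v s \<partial>lborel) + (\<integral>s. indicator {..r} s * v s \<partial>lborel) =
    (\<integral>s. v s \<partial>lborel)"
proof -
  have [measurable]: "v \<in> borel_measurable borel"
    using borel_measurable_integrable[OF v] by simp
  have i: "integrable lborel (\<lambda>s. indicator {r..} s * v s)" "integrable lborel (\<lambda>s. indicator {..r} s * v s)"
    using integrable_mult_indicator[OF _ v, of "{r..}"] integrable_mult_indicator[OF _ v, of "{..r}"] by auto
  have "(\<integral>s. indicator {r..} s * v s \<partial>lborel) + (\<integral>s. indicator {..r} s * v s \<partial>lborel) =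
      (\<integral>s. indicator {r..} s * v s + indicator {..r} s * v s \<partial>lborel)"
    by (rule Bochner_Integration.integral_add[symmetric, OF i])
  also have "\<dots> = (\<integral>s. v s \<partial>lborel)"
    by (rule integral_cong_AE, measurable)
       (use AE_lborel_singleton[of r] in \<open>eventually_elim, auto simp: indicator_def\<close>)
  finally show ?thesis .
qed

text \<open>Integration by parts for two absolutely continuous functions that vanish at infinity,
  read as Fubini's theorem: the half planes \<open>r \<le> s\<close> and \<open>s \<le> r\<close>
  cover the plane and overlap only in the diagonal, a null set.\<close>

lemma integral_triangle:
  fixes u v :: "real \<Rightarrow> real"
  assumes u: "integrable lborel u" and v: "integrable lborel v"
  shows "(\<integral>r. u r * (\<integral>s. indicator {r..} s * v s \<partial>lborel) \<partial>lborel) +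
    (\<integral>r. v r * (\<integral>s. indicator {r..} s * u s \<partial>lborel) \<partial>lborel) =
    (\<integral>r. u r \<partial>lborel) * (\<integral>r. v r \<partial>lborel)"
proof -
  have [measurable]: "u \<in> borel_measurable borel" "v \<in> borel_measurable borel"
    using borel_measurable_integrable[OF u] borel_measurable_integrable[OF v] by simp_all
  have int: "integrable (lborel \<Otimes>\<^sub>M lborel) (\<lambda>(r, s). u r * v s)"
  proof (rule lborel_pair.Fubini_integrable)
    have "(\<lambda>x. \<integral>y. norm (case (x, y) of (r, s) \<Rightarrow> u r * v s) \<partial>lborel) =
        (\<lambda>x. \<bar>u x\<bar> * (\<integral>y. \<bar>v y\<bar> \<partial>lborel))"
      by (simp add: abs_mult)
    then show "integrable lborel (\<lambda>x. \<integral>y. norm (case (x, y) of (r, s) \<Rightarrow> u r * v s) \<partial>lborel)"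
      using u by simp
  qed (use v in auto)
  have intA: "integrable (lborel \<Otimes>\<^sub>M lborel) (\<lambda>(r, s). indicator {r..} s * (u r * v s))"
  proof (rule Bochner_Integration.integrable_bound[OF int])
    \<comment> \<open>As the set \<open>{r..}\<close> varies with \<open>r\<close>, joint
      measurability is read off from the condition \<open>r \<le> s\<close> instead of the
      indicator.\<close>
    have "(\<lambda>(r, s). (if r \<le> s then 1 else 0) * (u r * v s)) \<in> borel_measurable (lborel \<Otimes>\<^sub>M lborel)"
      by measurable
    then show "(\<lambda>(r, s). indicator {r..} s * (u r * v s)) \<in> borel_measurable (lborel \<Otimes>\<^sub>M lborel)"
      by (simp add: indicator_def of_bool_def cong: if_cong)
  qed (auto simp: indicator_def abs_mult)
  have intB: "integrable (lborel \<Otimes>\<^sub>M lborel) (\<lambda>(r, s). indicator {..r} s * (u r * v s))"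
  proof (rule Bochner_Integration.integrable_bound[OF int])
    have "(\<lambda>(r, s). (if s \<le> r then 1 else 0) * (u r * v s)) \<in> borel_measurable (lborel \<Otimes>\<^sub>M lborel)"
      by measurable
    then show "(\<lambda>(r, s). indicator {..r} s * (u r * v s)) \<in> borel_measurable (lborel \<Otimes>\<^sub>M lborel)"
      by (simp add: indicator_def of_bool_def cong: if_cong)
  qed (auto simp: indicator_def abs_mult)
  have A: "(\<integral>s. indicator {r..} s * (u r * v s) \<partial>lborel) = u r * (\<integral>s. indicator {r..} s * v s \<partial>lborel)" for r
    by (subst integral_mult_right_zero[symmetric]) (simp add: mult_ac)
  have B: "(\<integral>s. indicator {..r} s * (u r * v s) \<partial>lborel) = u r * (\<integral>s. indicator {..r} s * v s \<partial>lborel)" for r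
    by (subst integral_mult_right_zero[symmetric]) (simp add: mult_ac)
  have "(\<integral>r. v r * (\<integral>s. indicator {r..} s * u s \<partial>lborel) \<partial>lborel) =
      (\<integral>s. (\<integral>r. indicator {..r} s * (u r * v s) \<partial>lborel) \<partial>lborel)"
    by (subst integral_mult_right_zero[symmetric]) (simp add: mult_ac indicator_def)
  also have "\<dots> = (\<integral>r. (\<integral>s. indicator {..r} s * (u r * v s) \<partial>lborel) \<partial>lborel)"
    by (rule lborel_pair.Fubini_integral[OF intB])
  finally have 2: "(\<integral>r. v r * (\<integral>s. indicator {r..} s * u s \<partial>lborel) \<partial>lborel) =
      (\<integral>r. u r * (\<integral>s. indicator {..r} s * v s \<partial>lborel) \<partial>lborel)"
    unfolding B .
  have iA: "integrable lborel (\<lambda>r. u r * (\<integral>s. indicator {r..} s * v s \<partial>lborel))"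
    using lborel_pair.integrable_fst'[OF intA] by (simp add: A)
  have iB: "integrable lborel (\<lambda>r. u r * (\<integral>s. indicator {..r} s * v s \<partial>lborel))"
    using lborel_pair.integrable_fst'[OF intB] by (simp add: B)
  show ?thesis
    unfolding 2 Bochner_Integration.integral_add[OF iA iB, symmetric] distrib_left[symmetric]
      integral_split_at[OF v]
    by simp
qed

section \<open>Integrals of products over the coordinates of Euclidean space\<close>

lemma integral_lborel_prod:
  fixes f :: "'b::euclidean_space \<Rightarrow> real \<Rightarrow> real"
  assumes f: "\<And>b. b \<in> Basis \<Longrightarrow> integrable lborel (f b)"
  shows "integrable lborel (\<lambda>x::'b. \<Prod>b\<in>Basis. f b (x \<bullet> b))"
    and "(\<integral>x. (\<Prod>b\<in>Basis. f b (x \<bullet> b)) \<partial>lborel) = (\<Prod>b\<in>Basis. \<integral>x. f b x \<partial>lborel)"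
proof -
  interpret product_sigma_finite "\<lambda>_::'b. lborel :: real measure" ..
  have meas: "(\<lambda>x::'b. \<Prod>b\<in>Basis. f b (x \<bullet> b)) \<in> borel_measurable borel"
  proof (rule borel_measurable_prod)
    fix b :: 'b assume "b \<in> Basis"
    from borel_measurable_integrable[OF f[OF this]]
    have [measurable]: "f b \<in> borel_measurable borel" by simp
    show "(\<lambda>x. f b (x \<bullet> b)) \<in> borel_measurable borel" by measurable
  qed
  have T: "(\<lambda>g. \<Sum>b\<in>Basis. g b *\<^sub>R b) \<in> measurable (\<Pi>\<^sub>M b\<in>(Basis::'b set). lborel) borel"
    by measurable
  have "integrable (\<Pi>\<^sub>M b\<in>(Basis::'b set). lborel) (\<lambda>g. \<Prod>b\<in>Basis. f b (g b))"
    by (intro product_integrable_prod f) auto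
  then show "integrable lborel (\<lambda>x::'b. \<Prod>b\<in>Basis. f b (x \<bullet> b))"
    by (subst lborel_eq, subst integrable_distr_eq[OF T meas]) simp
  show "(\<integral>x. (\<Prod>b\<in>Basis. f b (x \<bullet> b)) \<partial>lborel) = (\<Prod>b\<in>Basis. \<integral>x. f b x \<partial>lborel)"
    by (subst lborel_eq, subst integral_distr[OF T meas])
       (use product_integral_prod[of "Basis :: 'b set" f] f in simp)
qed

lemma integral_lborel_vec_prod:
  fixes f :: "'d::finite \<Rightarrow> real \<Rightarrow> real"
  assumes f: "\<And>i. integrable lborel (f i)"
  shows "integrable lborel (\<lambda>x::real^'d. \<Prod>i\<in>UNIV. f i (x $ i))"
    and "(\<integral>x. (\<Prod>i\<in>UNIV. f i (x $ i)) \<partial>(lborel :: (real^'d) measure)) = (\<Prod>i\<in>UNIV. \<integral>x. f i x \<partial>lborel)"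
proof -
  \<comment> \<open>The densities are products over the index type, while the preceding fact ranges
    over basis vectors. \<open>THE\<close> inverts \<open>axis\<close>; it is evaluated on basis
    vectors only, where the preimage is unique.\<close>
  define g where "g b = f (THE i. b = axis i (1::real))" for b :: "real^'d"
  have g: "g (axis i 1) = f i" for i
    unfolding g_def by (rule arg_cong[where f = f], rule the_equality) (auto simp: axis_eq_axis)
  have B: "(Basis :: (real^'d) set) = (\<lambda>i. axis i 1) ` UNIV"
    by (auto simp: Basis_vec_def)
  have inj: "inj (\<lambda>i::'d. axis i (1::real))"
    by (auto simp: inj_on_def axis_eq_axis)
  have R: "(\<Prod>b\<in>Basis. h b) = (\<Prod>i\<in>UNIV. h (axis i 1))" for h :: "real^'d \<Rightarrow> real"
    unfolding B by (subst prod.reindex[OF inj]) simp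
  have int: "integrable lborel (g b)" if "b \<in> Basis" for b
    using that f by (auto simp: B g)
  show "integrable lborel (\<lambda>x::real^'d. \<Prod>i\<in>UNIV. f i (x $ i))"
    using integral_lborel_prod(1)[of g, OF int] by (simp add: R g inner_axis)
  show "(\<integral>x. (\<Prod>i\<in>UNIV. f i (x $ i)) \<partial>(lborel :: (real^'d) measure)) = (\<Prod>i\<in>UNIV. \<integral>x. f i x \<partial>lborel)"
    using integral_lborel_prod(2)[of g, OF int] by (simp add: R g inner_axis)
qed

section \<open>Moments of Brownian increments\<close>

context standard_brownian_motion
begin

lemma increment_measurable:
  assumes "0 \<le> s" "0 \<le> t"
  shows "(\<lambda>\<omega>. W t \<omega> - W s \<omega>) \<in> borel_measurable M"
  using W_measurable[OF assms(1)] W_measurable[OF assms(2)] by measurable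

text \<open>One exponent vector \<open>e\<close> covers all first and second moments: the density is
  a product over coordinates, so the expectation of a monomial factors into one-dimensional normal
  moments.\<close>

lemma increment_monomial:
  fixes e :: "'d \<Rightarrow> nat"
  assumes st: "0 \<le> s" "s < t"
  shows "integrable M (\<lambda>\<omega>. \<Prod>i\<in>UNIV. ((W t \<omega> - W s \<omega>) $ i) ^ e i)"
    and "(\<integral>\<omega>. (\<Prod>i\<in>UNIV. ((W t \<omega> - W s \<omega>) $ i) ^ e i) \<partial>M) =
      (\<Prod>i\<in>UNIV. \<integral>x. normal_density 0 (sqrt (t - s)) x * x ^ e i \<partial>lborel)"
proof -
  let ?p = "normal_density 0 (sqrt (t - s))"
  have int: "integrable lborel (\<lambda>x. ?p x * x ^ e i)" for i
    using integrable_normal_moment[of "sqrt (t - s)" 0 "e i"] st by simp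
  have D: "distributed M lborel (\<lambda>\<omega>. W t \<omega> - W s \<omega>) (\<lambda>x. ennreal (\<Prod>i\<in>UNIV. ?p (x $ i)))"
    using W_normal[OF st] .
  have meas: "(\<lambda>x::real^'d. \<Prod>i\<in>UNIV. (x $ i) ^ e i) \<in> borel_measurable lborel"
    by measurable
  show "integrable M (\<lambda>\<omega>. \<Prod>i\<in>UNIV. ((W t \<omega> - W s \<omega>) $ i) ^ e i)"
    using integral_lborel_vec_prod(1)[of "\<lambda>i x. ?p x * x ^ e i", OF int]
      distributed_integrable[OF D meas]
    by (simp add: prod_nonneg prod.distrib)
  show "(\<integral>\<omega>. (\<Prod>i\<in>UNIV. ((W t \<omega> - W s \<omega>) $ i) ^ e i) \<partial>M) =
      (\<Prod>i\<in>UNIV. \<integral>x. ?p x * x ^ e i \<partial>lborel)"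
    using integral_lborel_vec_prod(2)[of "\<lambda>i x. ?p x * x ^ e i", OF int]
      distributed_integral[OF D meas]
    by (simp add: prod_nonneg prod.distrib)
qed

lemma increment_first_moment:
  assumes st: "0 \<le> s" "s \<le> t"
  shows "integrable M (\<lambda>\<omega>. (W t \<omega> - W s \<omega>) $ i)" and "(\<integral>\<omega>. (W t \<omega> - W s \<omega>) $ i \<partial>M) = 0"
proof -
  define e where "e k = (if k = i then 1 else 0 :: nat)" for k
  have P: "(\<Prod>k\<in>UNIV. (x $ k) ^ e k) = x $ i" for x :: "real^'d"
    unfolding e_def if_distrib[of "power _"] by (simp cong: if_cong)
  have "integrable M (\<lambda>\<omega>. (W t \<omega> - W s \<omega>) $ i) \<and> (\<integral>\<omega>. (W t \<omega> - W s \<omega>) $ i \<partial>M) = 0"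
  \<comment> \<open>The density is available for \<open>s < t\<close> only; for \<open>s = t\<close>
    the increment is 0.\<close>
  proof (cases "s = t")
    case False
    then have st': "s < t" using st by simp
    have "(\<integral>x. normal_density 0 (sqrt (t - s)) x * x ^ e i \<partial>lborel) = 0"
      using integral_normal_moment_nz_1[of "sqrt (t - s)" 0] st' by (simp add: e_def)
    then have "(\<Prod>i\<in>UNIV. \<integral>x. normal_density 0 (sqrt (t - s)) x * x ^ e i \<partial>lborel) = 0"
      by (auto simp: prod_zero_iff)
    then show ?thesis
      using increment_monomial[OF st(1) st', of e] unfolding P by auto
  qed simp
  then show "integrable M (\<lambda>\<omega>. (W t \<omega> - W s \<omega>) $ i)" "(\<integral>\<omega>. (W t \<omega> - W s \<omega>) $ i \<partial>M) = 0"
    by auto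
qed

lemma increment_second_moment:
  assumes st: "0 \<le> s" "s \<le> t"
  shows "integrable M (\<lambda>\<omega>. (W t \<omega> - W s \<omega>) $ i * (W t \<omega> - W s \<omega>) $ j)"
    and "(\<integral>\<omega>. (W t \<omega> - W s \<omega>) $ i * (W t \<omega> - W s \<omega>) $ j \<partial>M) = (if i = j then t - s else 0)"
proof -
  \<comment> \<open>The two unit exponents add up, so \<open>i = j\<close> yields the exponent 2 and
    with it the variance.\<close>
  define e where "e k = (if k = i then 1 else 0 :: nat) + (if k = j then 1 else 0 :: nat)" for k
  have P: "(\<Prod>k\<in>UNIV. (x $ k) ^ e k) = x $ i * x $ j" for x :: "real^'d"
    unfolding e_def power_add prod.distrib if_distrib[of "power _"] by (simp cong: if_cong)
  have "integrable M (\<lambda>\<omega>. (W t \<omega> - W s \<omega>) $ i * (W t \<omega> - W s \<omega>) $ j) \<and>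
    (\<integral>\<omega>. (W t \<omega> - W s \<omega>) $ i * (W t \<omega> - W s \<omega>) $ j \<partial>M) = (if i = j then t - s else 0)"
  proof (cases "s = t")
    case False
    then have st': "s < t" using st by simp
    let ?m = "\<lambda>k. \<integral>x. normal_density 0 (sqrt (t - s)) x * x ^ k \<partial>lborel"
    have m: "?m 0 = 1" "?m 1 = 0" "?m 2 = t - s"
      using integral_normal_density[of "sqrt (t - s)" 0] integral_normal_moment_nz_1[of "sqrt (t - s)" 0]
        integral_normal_moment_even[of "sqrt (t - s)" 0 1] st' by simp_all
    have "(\<Prod>k\<in>UNIV. ?m (e k)) = (if i = j then t - s else 0)"
    proof (cases "i = j")
      case True
      then have "(\<Prod>k\<in>UNIV. ?m (e k)) = (\<Prod>k\<in>UNIV. if k = i then t - s else 1)"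
        by (intro prod.cong refl) (use m in \<open>auto simp: e_def numeral_2_eq_2\<close>)
      then show ?thesis using True by simp
    next
      case False
      \<comment> \<open>Off the diagonal coordinate \<open>i\<close> has exponent 1, and its
        vanishing moment annihilates the whole product.\<close>
      then have "?m (e i) = 0" using m by (simp add: e_def)
      then show ?thesis using False by (auto simp: prod_zero_iff)
    qed
    then show ?thesis
      using increment_monomial[OF st(1) st', of e] unfolding P by auto
  qed simp
  then show "integrable M (\<lambda>\<omega>. (W t \<omega> - W s \<omega>) $ i * (W t \<omega> - W s \<omega>) $ j)"
    "(\<integral>\<omega>. (W t \<omega> - W s \<omega>) $ i * (W t \<omega> - W s \<omega>) $ j \<partial>M) = (if i = j then t - s else 0)"
    by auto
qed

end

section \<open>The augmented filtration and its independence of later increments\<close>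

context brownian_basis
begin

lemma path_events_subset: "path_events M W t \<subseteq> sets M"
proof -
  have "sets (vimage_algebra (space M) (W s) borel) \<subseteq> sets M" if "s \<in> {0..t}" for s
    using W_measurable[of s] that
    by (auto simp: sets_vimage_algebra2 dest: measurable_sets)
  then show ?thesis unfolding path_events_def by blast
qed

lemma path_events_mono: "s \<le> t \<Longrightarrow> path_events M W s \<subseteq> path_events M W t"
  by (force simp: path_events_def)

text \<open>Folding negative times onto 0 makes the facts on inclusion and monotonicity hold at
  every real time, which matters for delayed arguments \<open>r - \<theta>\<close> below 0.\<close>

lemma F_max_0: "F t = F (max 0 t)"
  using F_negative[of t] by (cases "t < 0") (auto simp: max_def)

lemma subalgebra_F: "subalgebra M (F t)"
proof -
  have s: "sets (F t) = sigma_sets (space M) (null_sets M \<union> path_events M W (max 0 t))"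
    using sets_F[of "max 0 t"] F_max_0[of t] by simp
  have sub: "null_sets M \<union> path_events M W (max 0 t) \<subseteq> sets M"
    using path_events_subset by (auto simp: null_sets_def)
  have "sets (F t) = sets (sigma (space M) (null_sets M \<union> path_events M W (max 0 t)))"
    using s sub sets.space_closed[of M] by (subst sets_measure_of) auto
  then have "space (F t) = space M"
    by (drule_tac sets_eq_imp_space_eq) (simp add: space_measure_of_conv)
  moreover have "sets (F t) \<subseteq> sets M"
    unfolding s by (rule sets.sigma_sets_subset[OF sub])
  ultimately show ?thesis by (simp add: subalgebra_def)
qed

lemma F_mono: "s \<le> t \<Longrightarrow> sets (F s) \<subseteq> sets (F t)"
  using path_events_mono[of "max 0 s" "max 0 t"] F_max_0[of t] F_max_0[of s] sets_F[of "max 0 t"] sets_F[of "max 0 s"]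
  by (auto intro!: sigma_sets_mono' simp: max_def split: if_splits)

lemma subalgebra_F_mono: "s \<le> t \<Longrightarrow> subalgebra (F t) (F s)"
  using F_mono[of s t] subalgebra_F[of s] subalgebra_F[of t] by (simp add: subalgebra_def)

lemma measurable_F_M: "f \<in> borel_measurable (F t) \<Longrightarrow> f \<in> borel_measurable M"
  using measurable_from_subalg[OF subalgebra_F] .

lemma measurable_F_mono: "f \<in> borel_measurable (F s) \<Longrightarrow> s \<le> t \<Longrightarrow> f \<in> borel_measurable (F t)"
  using measurable_from_subalg[OF subalgebra_F_mono] .

lemma sigma_finite_subalgebra_F: "sigma_finite_subalgebra M (F t)"
  by (rule finite_measure_subalgebra_is_sigma_finite)
     (simp add: finite_measure_subalgebra_def finite_measure_subalgebra_axioms_def subalgebra_F finite_measure_axioms)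

lemma W_measurable_F:
  assumes "0 \<le> s" "s \<le> t"
  shows "W s \<in> borel_measurable (F t)"
proof (rule measurableI)
  fix A :: "(real^'d) set" assume A: "A \<in> sets borel"
  have "W s -` A \<inter> space M \<in> path_events M W t"
    unfolding path_events_def using assms A by (intro UN_I[of s]) (auto simp: sets_vimage_algebra2)
  then have "W s -` A \<inter> space M \<in> sets (F t)"
    using sets_F[of t] assms by auto
  then show "W s -` A \<inter> space (F t) \<in> sets (F t)"
    using subalgebra_F[of t] by (simp add: subalgebra_def)
qed simp

text \<open>Independence of increments is assumed for path events, whereas \<open>F t\<close> also
  contains the null sets. A null set agrees almost surely with the empty set, and agreement up to a
  null set survives complements and countable unions.\<close>

lemma F_approx_path_event:
  assumes "0 \<le> t" "A \<in> sets (F t)"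
  shows "\<exists>B\<in>sigma_sets (space M) (path_events M W t). AE \<omega> in M. \<omega> \<in> A \<longleftrightarrow> \<omega> \<in> B"
proof -
  have "A \<in> sigma_sets (space M) (null_sets M \<union> path_events M W t)"
    using assms sets_F by simp
  then show ?thesis
  proof induction
    case (Basic a)
    then show ?case
    proof
      assume "a \<in> null_sets M"
      then show ?thesis
        by (intro bexI[of _ "{}"]) (auto simp: AE_iff_null_sets sigma_sets.Empty dest: AE_not_in)
    qed (auto intro: sigma_sets.Basic)
  next
    case Empty
    then show ?case by (auto intro: sigma_sets.Empty)
  next
    case (Compl a)
    then obtain B where B: "B \<in> sigma_sets (space M) (path_events M W t)" "AE \<omega> in M. \<omega> \<in> a \<longleftrightarrow> \<omega> \<in> B"
      by blast
    show ?case
      by (rule bexI[OF _ sigma_sets.Compl[OF B(1)]]) (use B(2) in auto)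
  next
    case (Union a)
    then obtain B where B: "\<And>i. B i \<in> sigma_sets (space M) (path_events M W t)"
      "\<And>i. AE \<omega> in M. \<omega> \<in> a i \<longleftrightarrow> \<omega> \<in> B i" by metis
    have "AE \<omega> in M. \<forall>i::nat. \<omega> \<in> a i \<longleftrightarrow> \<omega> \<in> B i" using B(2) by (simp add: AE_all_countable)
    then show ?case
      by (intro bexI[OF _ sigma_sets.Union[of B, OF B(1)]]) auto
  qed
qed

lemma F_indep_increment:
  assumes "0 \<le> s" "s < t"
    and A: "A \<in> sets (F s)" and B: "B \<in> sets (vimage_algebra (space M) (\<lambda>\<omega>. W t \<omega> - W s \<omega>) borel)"
  shows "prob (A \<inter> B) = prob A * prob B"
proof -
  obtain A' where A': "A' \<in> sigma_sets (space M) (path_events M W s)" "AE \<omega> in M. \<omega> \<in> A \<longleftrightarrow> \<omega> \<in> A'"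
    using F_approx_path_event[OF assms(1) A] by blast
  have A'M: "A' \<in> events"
    using A'(1) sets.sigma_sets_subset[OF path_events_subset] by auto
  have AM: "A \<in> events" using A subalgebra_F[of s] by (auto simp: subalgebra_def)
  have BM: "B \<in> events"
    using B increment_measurable[of s t] assms
    by (auto simp: sets_vimage_algebra2 dest: measurable_sets)
  have "prob (A \<inter> B) = prob (A' \<inter> B)"
    by (rule finite_measure_eq_AE) (use A'(2) AM A'M BM in auto)
  also have "\<dots> = prob A' * prob B"
    by (rule indep_setD[OF W_indep[OF assms(1,2)] A'(1) B])
  also have "prob A' = prob A"
    by (rule finite_measure_eq_AE) (use A'(2) AM A'M in auto)
  finally show ?thesis .
qed

text \<open>Independence of variables concerns the generated sigma-algebras; the preimages of Borel
  sets are intersection-stable generators, and on these \<open>F_indep_increment\<close>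
  applies.\<close>

lemma indep_var_F_increment:
  fixes h :: "'w \<Rightarrow> real"
  assumes st: "0 \<le> s" "s < t" and h: "h \<in> borel_measurable (F s)" and g: "g \<in> borel_measurable borel"
  shows "indep_var borel h borel (\<lambda>\<omega>. g (W t \<omega> - W s \<omega>) :: real)"
proof -
  have D: "(\<lambda>\<omega>. W t \<omega> - W s \<omega>) \<in> borel_measurable M"
    using increment_measurable[of s t] st by simp
  have hM: "h \<in> borel_measurable M" using h by (rule measurable_F_M)
  have gM: "(\<lambda>\<omega>. g (W t \<omega> - W s \<omega>)) \<in> borel_measurable M"
    using measurable_compose[OF D g] .
  show ?thesis
    unfolding indep_var_eq
  proof (intro conjI hM gM indep_set_sigma_sets)
    show "indep_set {h -` A \<inter> space M |A. A \<in> sets borel}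
      {(\<lambda>\<omega>. g (W t \<omega> - W s \<omega>)) -` A \<inter> space M |A. A \<in> sets borel}"
    proof (rule indep_setI)
      fix a b assume "a \<in> {h -` A \<inter> space M |A. A \<in> sets borel}"
        and "b \<in> {(\<lambda>\<omega>. g (W t \<omega> - W s \<omega>)) -` A \<inter> space M |A. A \<in> sets borel}"
      then obtain A where "a \<in> sets (F s)"
        and A: "A \<in> sets borel" "b = (\<lambda>\<omega>. g (W t \<omega> - W s \<omega>)) -` A \<inter> space M"
        using measurable_sets[OF h] subalgebra_F[of s] by (auto simp: subalgebra_def)
      moreover have "b = (\<lambda>\<omega>. W t \<omega> - W s \<omega>) -` (g -` A) \<inter> space M"
        using A(2) by auto
      moreover have "g -` A \<in> sets borel" using measurable_sets[OF g A(1)] by simp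
      ultimately show "prob (a \<inter> b) = prob a * prob b"
        by (intro F_indep_increment[OF st]) (auto simp: sets_vimage_algebra2)
    qed (use measurable_sets[OF hM] measurable_sets[OF gM] in auto)
    have stable: "Int_stable {f -` A \<inter> space M |A. A \<in> sets borel}" for f :: "'w \<Rightarrow> real"
    proof (rule Int_stableI, clarify)
      fix A B :: "real set" assume "A \<in> sets borel" "B \<in> sets borel"
      then show "\<exists>C. f -` A \<inter> space M \<inter> (f -` B \<inter> space M) = f -` C \<inter> space M \<and> C \<in> sets borel"
        by (intro exI[of _ "A \<inter> B"]) auto
    qed
    show "Int_stable {h -` A \<inter> space M |A. A \<in> sets borel}"
      "Int_stable {(\<lambda>\<omega>. g (W t \<omega> - W s \<omega>)) -` A \<inter> space M |A. A \<in> sets borel}"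
      by (rule stable)+
  qed
qed

lemma indep_increment_integral:
  fixes h :: "'w \<Rightarrow> real"
  assumes st: "0 \<le> s" "s < t" and h: "h \<in> borel_measurable (F s)" "integrable M h"
    and g: "g \<in> borel_measurable borel" "integrable M (\<lambda>\<omega>. g (W t \<omega> - W s \<omega>) :: real)"
  shows "integrable M (\<lambda>\<omega>. h \<omega> * g (W t \<omega> - W s \<omega>))"
    and "(\<integral>\<omega>. h \<omega> * g (W t \<omega> - W s \<omega>) \<partial>M) = (\<integral>\<omega>. h \<omega> \<partial>M) * (\<integral>\<omega>. g (W t \<omega> - W s \<omega>) \<partial>M)"
  using indep_var_integrable[OF indep_var_F_increment[OF st h(1) g(1)] h(2) g(2)]
    indep_var_lebesgue_integral[OF indep_var_F_increment[OF st h(1) g(1)] h(2) g(2)] by auto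

text \<open>The increment is independent of \<open>F s\<close>, so the expectations factor. What
  remains of the increment is its mean 0 and its covariance, \<open>t - s\<close> times the identity
  matrix.\<close>

lemma F_times_increment:
  fixes h :: "'w \<Rightarrow> real"
  assumes st: "0 \<le> s" "s \<le> t" and h: "h \<in> borel_measurable (F s)" "integrable M h"
  shows "integrable M (\<lambda>\<omega>. h \<omega> * (W t \<omega> - W s \<omega>) $ i)"
    and "(\<integral>\<omega>. h \<omega> * (W t \<omega> - W s \<omega>) $ i \<partial>M) = 0"
    and "integrable M (\<lambda>\<omega>. h \<omega> * ((W t \<omega> - W s \<omega>) $ i * (W t \<omega> - W s \<omega>) $ j))"
    and "(\<integral>\<omega>. h \<omega> * ((W t \<omega> - W s \<omega>) $ i * (W t \<omega> - W s \<omega>) $ j) \<partial>M) =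
      (if i = j then t - s else 0) * (\<integral>\<omega>. h \<omega> \<partial>M)"
proof -
  have "integrable M (\<lambda>\<omega>. h \<omega> * (W t \<omega> - W s \<omega>) $ i) \<and>
    (\<integral>\<omega>. h \<omega> * (W t \<omega> - W s \<omega>) $ i \<partial>M) = 0 \<and>
    integrable M (\<lambda>\<omega>. h \<omega> * ((W t \<omega> - W s \<omega>) $ i * (W t \<omega> - W s \<omega>) $ j)) \<and>
    (\<integral>\<omega>. h \<omega> * ((W t \<omega> - W s \<omega>) $ i * (W t \<omega> - W s \<omega>) $ j) \<partial>M) =
      (if i = j then t - s else 0) * (\<integral>\<omega>. h \<omega> \<partial>M)"
  proof (cases "s = t")
    case False
    with st have st': "s < t" by simp
    note 1 = indep_increment_integral[OF st(1) st' h, of "\<lambda>x. x $ i"]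
      and 2 = indep_increment_integral[OF st(1) st' h, of "\<lambda>x. x $ i * x $ j"]
    show ?thesis
      using 1 2 increment_first_moment[OF st, of i] increment_second_moment[OF st, of i j] by simp
  qed simp
  then show "integrable M (\<lambda>\<omega>. h \<omega> * (W t \<omega> - W s \<omega>) $ i)"
    and "(\<integral>\<omega>. h \<omega> * (W t \<omega> - W s \<omega>) $ i \<partial>M) = 0"
    and "integrable M (\<lambda>\<omega>. h \<omega> * ((W t \<omega> - W s \<omega>) $ i * (W t \<omega> - W s \<omega>) $ j))"
    and "(\<integral>\<omega>. h \<omega> * ((W t \<omega> - W s \<omega>) $ i * (W t \<omega> - W s \<omega>) $ j) \<partial>M) =
      (if i = j then t - s else 0) * (\<integral>\<omega>. h \<omega> \<partial>M)"
    by auto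
qed

section \<open>Ito integrals of simple processes\<close>

abbreviation (input) TM :: "(real \<times> 'w) measure" where "TM \<equiv> lborel \<Otimes>\<^sub>M M"

interpretation L: pair_sigma_finite "lborel :: real measure" M
proof -
  interpret T: sigma_finite_measure "lborel :: real measure" by (rule sigma_finite_lborel)
  show "pair_sigma_finite (lborel :: real measure) M" ..
qed

lemma borel_measurable_vec_nth:
  fixes f :: "'z \<Rightarrow> real^'d"
  assumes "f \<in> borel_measurable N"
  shows "(\<lambda>\<omega>. f \<omega> $ i) \<in> borel_measurable N"
  by (rule measurable_compose[OF assms]) (intro borel_measurable_continuous_onI continuous_intros)

lemma integral_lborel_rectangle:
  fixes f :: "'w \<Rightarrow> real"
  assumes A: "A \<in> sets lborel" "emeasure lborel A < \<infinity>" and f: "integrable M f"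
  shows "integrable TM (\<lambda>(t::real, \<omega>). indicator A t * f \<omega>)"
    and "(\<integral>(t, \<omega>). indicator A t * f \<omega> \<partial>TM) = measure lborel A * (\<integral>\<omega>. f \<omega> \<partial>M)"
proof -
  have [measurable]: "A \<in> sets borel" "f \<in> borel_measurable M" using A f by auto
  have ind: "integrable lborel (\<lambda>t. indicator A t * c :: real)" for c
    using A by (intro integrable_mult_left) simp
  show int: "integrable TM (\<lambda>(t::real, \<omega>). indicator A t * f \<omega>)"
  proof (rule L.Fubini_integrable)
    show "integrable lborel (\<lambda>x. \<integral>y. norm (case (x, y) of (t, \<omega>) \<Rightarrow> indicator A t * f \<omega>) \<partial>M)"
      using ind[of "\<integral>y. \<bar>f y\<bar> \<partial>M"] by (simp add: abs_mult)
  qed (use f in auto)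
  have "(\<integral>(t, \<omega>). indicator A t * f \<omega> \<partial>TM) = (\<integral>t. \<integral>\<omega>. indicator A t * f \<omega> \<partial>M \<partial>lborel)"
    using L.integral_fst'[OF int] by simp
  then show "(\<integral>(t, \<omega>). indicator A t * f \<omega> \<partial>TM) = measure lborel A * (\<integral>\<omega>. f \<omega> \<partial>M)"
    by simp
qed

lemma L2_fun_lborel_rectangle:
  fixes f :: "'w \<Rightarrow> 'b::euclidean_space"
  assumes A: "A \<in> sets lborel" "emeasure lborel A < \<infinity>" and f: "L2_fun M f"
  shows "L2_fun TM (\<lambda>(t::real, \<omega>). indicator A t *\<^sub>R f \<omega>)"
  unfolding L2_fun_def
proof
  have [measurable]: "A \<in> sets borel" "f \<in> borel_measurable M"
    using A L2_fun_measurable[OF f] by auto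
  show "(\<lambda>(t::real, \<omega>). indicator A t *\<^sub>R f \<omega>) \<in> borel_measurable TM" by measurable
  have "integrable TM (\<lambda>(t::real, \<omega>). indicator A t * (norm (f \<omega>))\<^sup>2)"
    using f by (intro integral_lborel_rectangle A) (simp add: L2_fun_def)
  then show "integrable TM (\<lambda>x. (norm (case x of (t, \<omega>) \<Rightarrow> indicator A t *\<^sub>R f \<omega>))\<^sup>2)"
    by (simp add: case_prod_unfold power_mult_distrib indicator_def of_bool_def power2_eq_square
        if_distrib[of "\<lambda>x. x * _"] cong: if_cong)
qed

lemma F_inner_increment:
  fixes \<xi> :: "'w \<Rightarrow> real^'d"
  assumes st: "0 \<le> s" "s \<le> t" and \<xi>: "\<xi> \<in> borel_measurable (F s)" "integrable M \<xi>"
  shows "integrable M (\<lambda>\<omega>. \<xi> \<omega> \<bullet> (W t \<omega> - W s \<omega>))" and "(\<integral>\<omega>. \<xi> \<omega> \<bullet> (W t \<omega> - W s \<omega>) \<partial>M) = 0"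
proof -
  have "integrable M (\<lambda>\<omega>. \<xi> \<omega> $ i * (W t \<omega> - W s \<omega>) $ i)" and
    "(\<integral>\<omega>. \<xi> \<omega> $ i * (W t \<omega> - W s \<omega>) $ i \<partial>M) = 0" for i
  proof -
    have m: "(\<lambda>\<omega>. \<xi> \<omega> $ i) \<in> borel_measurable (F s)" by (rule borel_measurable_vec_nth[OF \<xi>(1)])
    have i: "integrable M (\<lambda>\<omega>. \<xi> \<omega> $ i)"
      using integrable_inner_left[of "axis i 1", OF \<xi>(2)] by (simp add: inner_axis)
    show "integrable M (\<lambda>\<omega>. \<xi> \<omega> $ i * (W t \<omega> - W s \<omega>) $ i)"
      "(\<integral>\<omega>. \<xi> \<omega> $ i * (W t \<omega> - W s \<omega>) $ i \<partial>M) = 0"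
      using F_times_increment(1,2)[OF st m i] by auto
  qed
  then show "integrable M (\<lambda>\<omega>. \<xi> \<omega> \<bullet> (W t \<omega> - W s \<omega>))" "(\<integral>\<omega>. \<xi> \<omega> \<bullet> (W t \<omega> - W s \<omega>) \<partial>M) = 0"
    by (simp_all add: inner_vec_def Bochner_Integration.integral_sum)
qed

text \<open>Expanding both inner products gives a double sum over coordinates, from which the
  covariance of the increment removes the off-diagonal terms. This is the isometry on a single
  interval.\<close>

lemma integral_inner_increments_same:
  fixes \<xi> \<eta> :: "'w \<Rightarrow> real^'d"
  assumes st: "0 \<le> s" "s \<le> t"
    and \<xi>: "\<xi> \<in> borel_measurable (F s)" "L2_fun M \<xi>"
    and \<eta>: "\<eta> \<in> borel_measurable (F s)" "L2_fun M \<eta>"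
  shows "integrable M (\<lambda>\<omega>. (\<xi> \<omega> \<bullet> (W t \<omega> - W s \<omega>)) * (\<eta> \<omega> \<bullet> (W t \<omega> - W s \<omega>)))"
    and "(\<integral>\<omega>. (\<xi> \<omega> \<bullet> (W t \<omega> - W s \<omega>)) * (\<eta> \<omega> \<bullet> (W t \<omega> - W s \<omega>)) \<partial>M) =
      (t - s) * (\<integral>\<omega>. \<xi> \<omega> \<bullet> \<eta> \<omega> \<partial>M)"
proof -
  let ?D = "\<lambda>\<omega>. W t \<omega> - W s \<omega>"
  have int: "integrable M (\<lambda>\<omega>. \<xi> \<omega> $ i * \<eta> \<omega> $ j)" for i j
  proof (rule Bochner_Integration.integrable_bound)
    show "integrable M (\<lambda>\<omega>. (norm (\<xi> \<omega>))\<^sup>2 + (norm (\<eta> \<omega>))\<^sup>2)"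
      using \<xi>(2) \<eta>(2) by (auto simp: L2_fun_def)
    show "(\<lambda>\<omega>. \<xi> \<omega> $ i * \<eta> \<omega> $ j) \<in> borel_measurable M"
      using \<xi>(2) \<eta>(2) by (intro borel_measurable_times borel_measurable_vec_nth L2_fun_measurable)
    have "\<bar>x $ i * y $ j\<bar> \<le> (norm x)\<^sup>2 + (norm y)\<^sup>2" for x y :: "real^'d"
    proof -
      have "\<bar>x $ i * y $ j\<bar> \<le> norm x * norm y"
        unfolding abs_mult by (intro mult_mono component_le_norm_cart) auto
      also have "\<dots> \<le> (norm x)\<^sup>2 + (norm y)\<^sup>2"
        using sum_squares_bound[of "norm x" "norm y"] mult_nonneg_nonneg[OF norm_ge_zero norm_ge_zero, of x y]
        by linarith
      finally show ?thesis .
    qed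
    then show "AE \<omega> in M. norm (\<xi> \<omega> $ i * \<eta> \<omega> $ j) \<le> norm ((norm (\<xi> \<omega>))\<^sup>2 + (norm (\<eta> \<omega>))\<^sup>2)"
      by simp
  qed
  have m: "(\<lambda>\<omega>. \<xi> \<omega> $ i * \<eta> \<omega> $ j) \<in> borel_measurable (F s)" for i j
    using \<xi>(1) \<eta>(1) by (intro borel_measurable_times borel_measurable_vec_nth)
  have eq: "(\<xi> \<omega> \<bullet> ?D \<omega>) * (\<eta> \<omega> \<bullet> ?D \<omega>) =
      (\<Sum>i\<in>UNIV. \<Sum>j\<in>UNIV. (\<xi> \<omega> $ i * \<eta> \<omega> $ j) * (?D \<omega> $ i * ?D \<omega> $ j))" for \<omega>
    by (simp only: inner_vec_def sum_product inner_real_def) (simp only: mult_ac)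
  note 1 = F_times_increment(3,4)[OF st m int]
  show "integrable M (\<lambda>\<omega>. (\<xi> \<omega> \<bullet> ?D \<omega>) * (\<eta> \<omega> \<bullet> ?D \<omega>))"
    unfolding eq by (intro Bochner_Integration.integrable_sum 1)
  have "(\<integral>\<omega>. (\<xi> \<omega> \<bullet> ?D \<omega>) * (\<eta> \<omega> \<bullet> ?D \<omega>) \<partial>M) =
      (\<Sum>i\<in>UNIV. \<Sum>j\<in>UNIV. (if i = j then t - s else 0) * (\<integral>\<omega>. \<xi> \<omega> $ i * \<eta> \<omega> $ j \<partial>M))"
    unfolding eq
    by (subst Bochner_Integration.integral_sum,
        intro Bochner_Integration.integrable_sum 1, intro sum.cong refl,
        subst Bochner_Integration.integral_sum, intro 1, intro sum.cong refl 1)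
  also have "\<dots> = (\<Sum>i\<in>UNIV. (t - s) * (\<integral>\<omega>. \<xi> \<omega> $ i * \<eta> \<omega> $ i \<partial>M))"
    by (simp add: if_distrib[of "\<lambda>x. x * _"] cong: if_cong)
  also have "\<dots> = (t - s) * (\<integral>\<omega>. \<xi> \<omega> \<bullet> \<eta> \<omega> \<partial>M)"
    using int by (simp add: inner_vec_def sum_distrib_left Bochner_Integration.integral_sum)
  finally show "(\<integral>\<omega>. (\<xi> \<omega> \<bullet> ?D \<omega>) * (\<eta> \<omega> \<bullet> ?D \<omega>) \<partial>M) = (t - s) * (\<integral>\<omega>. \<xi> \<omega> \<bullet> \<eta> \<omega> \<partial>M)" .
qed

lemma L2_fun_inner_increment:
  fixes \<xi> :: "'w \<Rightarrow> real^'d"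
  assumes st: "0 \<le> s" "s \<le> t" and \<xi>: "\<xi> \<in> borel_measurable (F s)" "L2_fun M \<xi>"
  shows "L2_fun M (\<lambda>\<omega>. \<xi> \<omega> \<bullet> (W t \<omega> - W s \<omega>))"
  unfolding L2_fun_def
proof
  have [measurable]: "\<xi> \<in> borel_measurable M" "(\<lambda>\<omega>. W t \<omega> - W s \<omega>) \<in> borel_measurable M"
    using L2_fun_measurable[OF \<xi>(2)] increment_measurable[of s t] st by auto
  show "(\<lambda>\<omega>. \<xi> \<omega> \<bullet> (W t \<omega> - W s \<omega>)) \<in> borel_measurable M" by measurable
  show "integrable M (\<lambda>\<omega>. (norm (\<xi> \<omega> \<bullet> (W t \<omega> - W s \<omega>)))\<^sup>2)"
    using integral_inner_increments_same(1)[OF st \<xi> \<xi>] by (simp add: power2_eq_square)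
qed

text \<open>The earlier increment is known at time \<open>u\<close>, so its product with
  \<open>\<eta>\<close> is again an admissible coefficient of the later one. The bound on
  \<open>\<eta>\<close> keeps that coefficient square integrable.\<close>

lemma integral_inner_increments_disjoint:
  fixes \<xi> \<eta> :: "'w \<Rightarrow> real^'d"
  assumes t: "0 \<le> s" "s \<le> t" "t \<le> u" "u \<le> v"
    and \<xi>: "\<xi> \<in> borel_measurable (F u)" "\<xi> \<in> borel_measurable (F s)" "L2_fun M \<xi>"
    and \<eta>: "\<eta> \<in> borel_measurable (F u)" "\<And>\<omega>. \<omega> \<in> space M \<Longrightarrow> norm (\<eta> \<omega>) \<le> C"
  shows "(\<integral>\<omega>. (\<xi> \<omega> \<bullet> (W t \<omega> - W s \<omega>)) * (\<eta> \<omega> \<bullet> (W v \<omega> - W u \<omega>)) \<partial>M) = 0"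
proof -
  have [measurable]: "W t \<in> borel_measurable (F u)" "W s \<in> borel_measurable (F u)"
    by (rule W_measurable_F; use t in simp)+
  note [measurable] = \<xi>(1) \<eta>(1)
  let ?\<zeta> = "\<lambda>\<omega>. (\<xi> \<omega> \<bullet> (W t \<omega> - W s \<omega>)) *\<^sub>R \<eta> \<omega>"
  have m: "?\<zeta> \<in> borel_measurable (F u)" by measurable
  have "L2_fun M ?\<zeta>"
  proof (rule L2_fun_bound)
    show "L2_fun M (\<lambda>\<omega>. \<xi> \<omega> \<bullet> (W t \<omega> - W s \<omega>))"
      by (rule L2_fun_inner_increment) (use t \<xi> in auto)
    show "?\<zeta> \<in> borel_measurable M" by (rule measurable_F_M[OF m])
    show "AE \<omega> in M. norm (?\<zeta> \<omega>) \<le> C * norm (\<xi> \<omega> \<bullet> (W t \<omega> - W s \<omega>))"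
      by (intro AE_I2, subst norm_scaleR, subst mult.commute) (simp add: mult_right_mono \<eta>(2))
  qed
  then have i: "integrable M ?\<zeta>" by (rule L2_fun_imp_integrable)
  have "0 \<le> u" using t by simp
  from F_inner_increment(2)[OF this t(4) m i] show ?thesis by simp
qed

text \<open>Cutting at \<open>u'\<close> and at the right end of the overlap splits the product into
  six. All but the one over the overlap pair increments over disjoint intervals or contain an empty
  increment. With \<open>u \<le> u'\<close> both coefficients are measurable at the left ends of all
  their pieces.\<close>

lemma integral_inner_increments_aux:
  fixes \<xi> \<eta> :: "'w \<Rightarrow> real^'d"
  assumes t: "0 \<le> u" "u \<le> v" "u \<le> u'" "u' \<le> v'"
    and \<xi>: "\<xi> \<in> borel_measurable (F u)" "\<And>\<omega>. \<omega> \<in> space M \<Longrightarrow> norm (\<xi> \<omega>) \<le> C"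
    and \<eta>: "\<eta> \<in> borel_measurable (F u')" "\<And>\<omega>. \<omega> \<in> space M \<Longrightarrow> norm (\<eta> \<omega>) \<le> C'"
  shows "(\<integral>\<omega>. (\<xi> \<omega> \<bullet> (W v \<omega> - W u \<omega>)) * (\<eta> \<omega> \<bullet> (W v' \<omega> - W u' \<omega>)) \<partial>M) =
    measure lborel ({u<..v} \<inter> {u'<..v'}) * (\<integral>\<omega>. \<xi> \<omega> \<bullet> \<eta> \<omega> \<partial>M)"
proof -
  have \<xi>m: "\<xi> \<in> borel_measurable (F s)" if "u \<le> s" for s
    using measurable_F_mono[OF \<xi>(1) that] .
  have \<eta>m: "\<eta> \<in> borel_measurable (F s)" if "u' \<le> s" for s
    using measurable_F_mono[OF \<eta>(1) that] .
  have \<xi>2: "L2_fun M \<xi>" and \<eta>2: "L2_fun M \<eta>"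
    using L2_fun_bounded[OF measurable_F_M[OF \<xi>(1)] \<xi>(2)]
      L2_fun_bounded[OF measurable_F_M[OF \<eta>(1)] \<eta>(2)] by auto
  show ?thesis
  proof (cases "v \<le> u'")
    case True
    then have "{u<..v} \<inter> {u'<..v'} = {}" by auto
    then show ?thesis
      using integral_inner_increments_disjoint[OF t(1,2) True t(4) \<xi>m[OF t(3)] \<xi>(1) \<xi>2 \<eta>]
      by (simp only: measure_empty mult_zero_left)
  next
    case False
    \<comment> \<open>The right end of the overlap. One of the two intervals ends here, so at most
      one of them continues beyond \<open>m\<close>.\<close>
    define m where "m = min v v'"
    have m: "u' \<le> m" "m \<le> v" "m \<le> v'" "m = v \<or> m = v'" using False t by (auto simp: m_def)
    have u': "0 \<le> u'" using t by simp
    let ?X = "\<lambda>s t \<omega>. \<xi> \<omega> \<bullet> (W t \<omega> - W s \<omega>)" and ?E = "\<lambda>s t \<omega>. \<eta> \<omega> \<bullet> (W t \<omega> - W s \<omega>)"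
    have X: "L2_fun M (?X s t)" if "u \<le> s" "s \<le> t" for s t
      by (rule L2_fun_inner_increment) (use that \<open>0 \<le> u\<close> \<xi>m \<xi>2 in auto)
    have E: "L2_fun M (?E s t)" if "u' \<le> s" "s \<le> t" for s t
      by (rule L2_fun_inner_increment) (use that u' \<eta>m \<eta>2 in auto)
    have i: "integrable M (\<lambda>\<omega>. ?X s t \<omega> * ?E p q \<omega>)" if "u \<le> s" "s \<le> t" "u' \<le> p" "p \<le> q" for s t p q
      by (rule L2_fun_mult[OF X E]) (use that in auto)
    have z: "(\<integral>\<omega>. ?X u u' \<omega> * ?E u' m \<omega> \<partial>M) = 0" "(\<integral>\<omega>. ?X u u' \<omega> * ?E m v' \<omega> \<partial>M) = 0"
      "(\<integral>\<omega>. ?X u' m \<omega> * ?E m v' \<omega> \<partial>M) = 0"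
      by (rule integral_inner_increments_disjoint; use t m \<xi>m \<eta>m \<xi>2 \<eta>(2) in auto)+
    \<comment> \<open>Here the second coefficient supplies the earlier increment, so the roles are
      exchanged.\<close>
    have z4: "(\<integral>\<omega>. ?E u' m \<omega> * ?X m v \<omega> \<partial>M) = 0"
      by (rule integral_inner_increments_disjoint; use t u' m \<xi>m \<eta>m \<eta>2 \<xi>(2) in auto)
    have z5: "(\<integral>\<omega>. ?X m v \<omega> * ?E m v' \<omega> \<partial>M) = 0" using m(4) by auto
    have s: "(\<integral>\<omega>. ?X u' m \<omega> * ?E u' m \<omega> \<partial>M) = (m - u') * (\<integral>\<omega>. \<xi> \<omega> \<bullet> \<eta> \<omega> \<partial>M)"
      by (rule integral_inner_increments_same(2)) (use t u' m \<xi>m \<eta>m \<xi>2 \<eta>2 in auto)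
    have "(\<integral>\<omega>. ?X u v \<omega> * ?E u' v' \<omega> \<partial>M) =
      (\<integral>\<omega>. ?X u u' \<omega> * ?E u' m \<omega> + ?X u u' \<omega> * ?E m v' \<omega> + ?X u' m \<omega> * ?E u' m \<omega> +
        ?X u' m \<omega> * ?E m v' \<omega> + ?E u' m \<omega> * ?X m v \<omega> + ?X m v \<omega> * ?E m v' \<omega> \<partial>M)"
      by (rule Bochner_Integration.integral_cong[OF refl]) (simp add: inner_diff_right algebra_simps)
    also have "\<dots> = (\<integral>\<omega>. ?X u u' \<omega> * ?E u' m \<omega> \<partial>M) + (\<integral>\<omega>. ?X u u' \<omega> * ?E m v' \<omega> \<partial>M)
        + (\<integral>\<omega>. ?X u' m \<omega> * ?E u' m \<omega> \<partial>M) + (\<integral>\<omega>. ?X u' m \<omega> * ?E m v' \<omega> \<partial>M)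
        + (\<integral>\<omega>. ?E u' m \<omega> * ?X m v \<omega> \<partial>M) + (\<integral>\<omega>. ?X m v \<omega> * ?E m v' \<omega> \<partial>M)"
    proof -
      have "integrable M (\<lambda>\<omega>. ?X u u' \<omega> * ?E u' m \<omega>)" "integrable M (\<lambda>\<omega>. ?X u u' \<omega> * ?E m v' \<omega>)"
        "integrable M (\<lambda>\<omega>. ?X u' m \<omega> * ?E u' m \<omega>)" "integrable M (\<lambda>\<omega>. ?X u' m \<omega> * ?E m v' \<omega>)"
        "integrable M (\<lambda>\<omega>. ?X m v \<omega> * ?E m v' \<omega>)"
        by (rule i; use t m in auto)+
      moreover have "integrable M (\<lambda>\<omega>. ?E u' m \<omega> * ?X m v \<omega>)"
        by (rule L2_fun_mult[OF E X]) (use t m in auto)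
      ultimately show ?thesis by (simp only: Bochner_Integration.integral_add Bochner_Integration.integrable_add)
    qed
    also have "\<dots> = (m - u') * (\<integral>\<omega>. \<xi> \<omega> \<bullet> \<eta> \<omega> \<partial>M)" using z z4 z5 s by simp
    also have "m - u' = measure lborel ({u<..v} \<inter> {u'<..v'})"
    proof -
      have "{u<..v} \<inter> {u'<..v'} = {u'<..m}" using t by (auto simp: m_def)
      then show ?thesis using m by simp
    qed
    finally show ?thesis .
  qed
qed

lemma integral_inner_increments:
  fixes \<xi> \<eta> :: "'w \<Rightarrow> real^'d"
  assumes t: "0 \<le> u" "u \<le> v" "0 \<le> u'" "u' \<le> v'"
    and \<xi>: "\<xi> \<in> borel_measurable (F u)" "\<And>\<omega>. \<omega> \<in> space M \<Longrightarrow> norm (\<xi> \<omega>) \<le> C"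
    and \<eta>: "\<eta> \<in> borel_measurable (F u')" "\<And>\<omega>. \<omega> \<in> space M \<Longrightarrow> norm (\<eta> \<omega>) \<le> C'"
  shows "(\<integral>\<omega>. (\<xi> \<omega> \<bullet> (W v \<omega> - W u \<omega>)) * (\<eta> \<omega> \<bullet> (W v' \<omega> - W u' \<omega>)) \<partial>M) =
    measure lborel ({u<..v} \<inter> {u'<..v'}) * (\<integral>\<omega>. \<xi> \<omega> \<bullet> \<eta> \<omega> \<partial>M)"
proof (cases "u \<le> u'")
  case True
  then show ?thesis using integral_inner_increments_aux[OF t(1,2) True t(4) \<xi> \<eta>] by simp
next
  case False
  then have "u' \<le> u" by simp
  from integral_inner_increments_aux[OF t(3,4) this t(2) \<eta> \<xi>]
  show ?thesis by (simp add: mult.commute inner_commute Int_commute)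
qed

section \<open>Simple integrands and their integrals\<close>

lemma simple_dataD:
  assumes "simple_data M F a b n \<tau> \<xi>" "i < n"
  shows "a \<le> \<tau> i" "\<tau> i \<le> \<tau> (Suc i)" "\<tau> (Suc i) \<le> b" "\<xi> i \<in> borel_measurable (F (\<tau> i))"
    "\<exists>C. \<forall>\<omega>\<in>space M. norm (\<xi> i \<omega>) \<le> C"
proof -
  have step: "\<And>j. j < n \<Longrightarrow> \<tau> j \<le> \<tau> (Suc j)" using assms by (simp add: simple_data_def)
  have "\<tau> 0 \<le> \<tau> i" if "i \<le> n" for i
    using that
  proof (induction i)
    case (Suc i) then show ?case using step[of i] by simp
  qed simp
  from this[of i] show "a \<le> \<tau> i" using assms by (simp add: simple_data_def)
  have "\<tau> i \<le> \<tau> n" if "i \<le> n" for i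
    using that
  proof (induction "n - i" arbitrary: i)
    case (Suc k)
    then have "i < n" "k = n - Suc i" by auto
    with step[of i] Suc.hyps(1)[of "Suc i"] show ?case by simp
  qed simp
  from this[of "Suc i"] show "\<tau> (Suc i) \<le> b" using assms by (simp add: simple_data_def)
qed (use assms in \<open>auto simp: simple_data_def\<close>)

lemma simple_data_L2_fun:
  assumes "simple_data M F a b n \<tau> \<xi>" "i < n"
  shows "L2_fun M (\<xi> i)"
  using simple_dataD(5)[OF assms] L2_fun_bounded[OF measurable_F_M[OF simple_dataD(4)[OF assms]]]
  by blast

lemma L2_fun_simple_integral:
  assumes "simple_data M F a b n \<tau> \<xi>" "0 \<le> a"
  shows "L2_fun M (simple_integral W n \<tau> \<xi>)"
  unfolding simple_integral_def[abs_def]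
  by (rule L2_fun_sum, rule L2_fun_inner_increment)
     (use simple_dataD[OF assms(1)] assms(2) simple_data_L2_fun[OF assms(1)] in \<open>auto intro: order_trans\<close>)

lemma L2_fun_simple_process:
  assumes "simple_data M F a b n \<tau> \<xi>"
  shows "L2_fun TM (\<lambda>(t, \<omega>). simple_process n \<tau> \<xi> t \<omega>)"
proof -
  have "L2_fun TM
      (\<lambda>x. \<Sum>i<n. (case x of (t, \<omega>) \<Rightarrow> indicator {\<tau> i<..\<tau> (Suc i)} t *\<^sub>R \<xi> i \<omega>))"
    by (intro L2_fun_sum L2_fun_lborel_rectangle emeasure_bounded_finite)
       (use simple_data_L2_fun[OF assms] in
         \<open>auto intro: bounded_subset[OF bounded_closed_interval]\<close>)
  then show ?thesis by (simp add: simple_process_def case_prod_unfold)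
qed

text \<open>\<open>H\<close> is absorbed into each coefficient: as \<open>a \<le> \<tau> i\<close>,
  the product with \<open>\<xi> i\<close> is known at the left end of its interval. The product may
  be unbounded and thus leave the class of simple data, so the increments are treated
  directly.\<close>

lemma simple_integral_mean_zero:
  assumes sd: "simple_data M F a b n \<tau> \<xi>" "0 \<le> a"
    and H: "H \<in> borel_measurable (F a)" "L2_fun M H"
  shows "(\<integral>\<omega>. H \<omega> * simple_integral W n \<tau> \<xi> \<omega> \<partial>M) = 0"
proof -
  note D = simple_dataD[OF sd(1)]
  have *: "integrable M (\<lambda>\<omega>. (H \<omega> *\<^sub>R \<xi> i \<omega>) \<bullet> (W (\<tau> (Suc i)) \<omega> - W (\<tau> i) \<omega>)) \<and>
    (\<integral>\<omega>. (H \<omega> *\<^sub>R \<xi> i \<omega>) \<bullet> (W (\<tau> (Suc i)) \<omega> - W (\<tau> i) \<omega>) \<partial>M) = 0" if less: "i < n" for i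
  proof -
    have [measurable]: "H \<in> borel_measurable (F (\<tau> i))" "\<xi> i \<in> borel_measurable (F (\<tau> i))"
      using D[OF less] measurable_F_mono[OF H(1)] by auto
    obtain C where C: "\<And>\<omega>. \<omega> \<in> space M \<Longrightarrow> norm (\<xi> i \<omega>) \<le> C" using D(5)[OF less] by blast
    have m: "(\<lambda>\<omega>. H \<omega> *\<^sub>R \<xi> i \<omega>) \<in> borel_measurable (F (\<tau> i))" by measurable
    have "L2_fun M (\<lambda>\<omega>. H \<omega> *\<^sub>R \<xi> i \<omega>)"
    proof (rule L2_fun_bound[OF H(2) measurable_F_M[OF m], of C])
      show "AE \<omega> in M. norm (H \<omega> *\<^sub>R \<xi> i \<omega>) \<le> C * norm (H \<omega>)"
        by (intro AE_I2, subst norm_scaleR, subst mult.commute) (simp add: mult_right_mono C)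
    qed
    then have i: "integrable M (\<lambda>\<omega>. H \<omega> *\<^sub>R \<xi> i \<omega>)" by (rule L2_fun_imp_integrable)
    have "0 \<le> \<tau> i" using D(1)[OF that] sd(2) by simp
    from F_inner_increment[OF this D(2)[OF that] m i] show ?thesis by simp
  qed
  have "(\<integral>\<omega>. H \<omega> * simple_integral W n \<tau> \<xi> \<omega> \<partial>M) =
    (\<integral>\<omega>. (\<Sum>i<n. (H \<omega> *\<^sub>R \<xi> i \<omega>) \<bullet> (W (\<tau> (Suc i)) \<omega> - W (\<tau> i) \<omega>)) \<partial>M)"
    by (simp add: simple_integral_def sum_distrib_left)
  also have "\<dots> = (\<Sum>i<n. \<integral>\<omega>. (H \<omega> *\<^sub>R \<xi> i \<omega>) \<bullet> (W (\<tau> (Suc i)) \<omega> - W (\<tau> i) \<omega>) \<partial>M)"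
    by (rule Bochner_Integration.integral_sum) (use * in auto)
  also have "\<dots> = 0" using * by simp
  finally show ?thesis .
qed

text \<open>Allowing two unrelated partitions avoids common refinements: each pair of intervals
  contributes the length of its overlap, which is also the time integral of the product of their
  indicators.\<close>

lemma simple_integral_isometry:
  assumes sd: "simple_data M F a b n \<tau> \<xi>" "0 \<le> a" and sd': "simple_data M F a' b' n' \<tau>' \<xi>'" "0 \<le> a'"
  shows "(\<integral>\<omega>. simple_integral W n \<tau> \<xi> \<omega> * simple_integral W n' \<tau>' \<xi>' \<omega> \<partial>M) =
    (\<integral>(t, \<omega>). simple_process n \<tau> \<xi> t \<omega> \<bullet> simple_process n' \<tau>' \<xi>' t \<omega> \<partial>TM)"
proof -
  note D = simple_dataD[OF sd(1)] and D' = simple_dataD[OF sd'(1)]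
  let ?X = "\<lambda>i \<omega>. \<xi> i \<omega> \<bullet> (W (\<tau> (Suc i)) \<omega> - W (\<tau> i) \<omega>)"
  let ?Y = "\<lambda>i \<omega>. \<xi>' i \<omega> \<bullet> (W (\<tau>' (Suc i)) \<omega> - W (\<tau>' i) \<omega>)"
  let ?A = "\<lambda>i. {\<tau> i<..\<tau> (Suc i)}" and ?B = "\<lambda>i. {\<tau>' i<..\<tau>' (Suc i)}"
  let ?N = TM
  have X: "L2_fun M (?X i)" if "i < n" for i
    by (rule L2_fun_inner_increment)
       (use D[OF that] sd(2) simple_data_L2_fun[OF sd(1) that] in auto)
  have Y: "L2_fun M (?Y i)" if "i < n'" for i
    by (rule L2_fun_inner_increment)
       (use D'[OF that] sd'(2) simple_data_L2_fun[OF sd'(1) that] in auto)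
  have fin: "emeasure lborel (?A i \<inter> ?B j) < \<infinity>" for i j
    by (rule emeasure_bounded_finite) (auto intro: bounded_subset[OF bounded_closed_interval[of "\<tau> i" "\<tau> (Suc i)"]])
  have R: "integrable ?N (\<lambda>(t, \<omega>). indicator (?A i \<inter> ?B j) t * (\<xi> i \<omega> \<bullet> \<xi>' j \<omega>))"
    "(\<integral>(t, \<omega>). indicator (?A i \<inter> ?B j) t * (\<xi> i \<omega> \<bullet> \<xi>' j \<omega>) \<partial>?N) =
      measure lborel (?A i \<inter> ?B j) * (\<integral>\<omega>. \<xi> i \<omega> \<bullet> \<xi>' j \<omega> \<partial>M)" if "i < n" "j < n'" for i j
    using that L2_fun_inner[OF simple_data_L2_fun[OF sd(1)] simple_data_L2_fun[OF sd'(1)]]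
      integral_lborel_rectangle[of "?A i \<inter> ?B j", OF _ fin]
    by auto
  have "(\<integral>\<omega>. simple_integral W n \<tau> \<xi> \<omega> * simple_integral W n' \<tau>' \<xi>' \<omega> \<partial>M) =
      (\<integral>\<omega>. (\<Sum>i<n. \<Sum>j<n'. ?X i \<omega> * ?Y j \<omega>) \<partial>M)"
    by (simp add: simple_integral_def sum_product)
  also have "\<dots> = (\<Sum>i<n. \<Sum>j<n'. \<integral>\<omega>. ?X i \<omega> * ?Y j \<omega> \<partial>M)"
    by (subst Bochner_Integration.integral_sum;
        intro Bochner_Integration.integrable_sum sum.cong refl Bochner_Integration.integral_sum
          L2_fun_mult X Y) auto
  also have "\<dots> = (\<Sum>i<n. \<Sum>j<n'. measure lborel (?A i \<inter> ?B j) * (\<integral>\<omega>. \<xi> i \<omega> \<bullet> \<xi>' j \<omega> \<partial>M))"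
  proof (intro sum.cong refl)
    fix i j assume "i \<in> {..<n}" "j \<in> {..<n'}"
    then have ij: "i < n" "j < n'" by auto
    obtain C C' where C: "\<And>\<omega>. \<omega> \<in> space M \<Longrightarrow> norm (\<xi> i \<omega>) \<le> C" "\<And>\<omega>. \<omega> \<in> space M \<Longrightarrow> norm (\<xi>' j \<omega>) \<le> C'"
      using D(5)[OF ij(1)] D'(5)[OF ij(2)] by blast
    have t0: "0 \<le> \<tau> i" "0 \<le> \<tau>' j" using D(1)[OF ij(1)] D'(1)[OF ij(2)] sd(2) sd'(2) by auto
    show "(\<integral>\<omega>. ?X i \<omega> * ?Y j \<omega> \<partial>M) = measure lborel (?A i \<inter> ?B j) * (\<integral>\<omega>. \<xi> i \<omega> \<bullet> \<xi>' j \<omega> \<partial>M)"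
      by (rule integral_inner_increments[OF t0(1) D(2)[OF ij(1)] t0(2) D'(2)[OF ij(2)]
          D(4)[OF ij(1)] C(1) D'(4)[OF ij(2)] C(2)])
  qed
  also have "\<dots> = (\<Sum>i<n. \<Sum>j<n'. \<integral>x. (case x of (t, \<omega>) \<Rightarrow> indicator (?A i \<inter> ?B j) t * (\<xi> i \<omega> \<bullet> \<xi>' j \<omega>)) \<partial>?N)"
    by (intro sum.cong refl R(2)[symmetric]) auto
  also have "\<dots> = (\<integral>x. (\<Sum>i<n. \<Sum>j<n'. (case x of (t, \<omega>) \<Rightarrow> indicator (?A i \<inter> ?B j) t * (\<xi> i \<omega> \<bullet> \<xi>' j \<omega>))) \<partial>?N)"
    by (rule sym, subst Bochner_Integration.integral_sum;
        intro Bochner_Integration.integrable_sum sum.cong refl Bochner_Integration.integral_sum R(1)) auto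
  also have "\<dots> = (\<integral>(t, \<omega>). simple_process n \<tau> \<xi> t \<omega> \<bullet> simple_process n' \<tau>' \<xi>' t \<omega> \<partial>?N)"
  proof (rule Bochner_Integration.integral_cong[OF refl], clarify)
    fix t \<omega>
    show "(\<Sum>i<n. \<Sum>j<n'. indicator (?A i \<inter> ?B j) t * (\<xi> i \<omega> \<bullet> \<xi>' j \<omega>)) =
      simple_process n \<tau> \<xi> t \<omega> \<bullet> simple_process n' \<tau>' \<xi>' t \<omega>"
      unfolding simple_process_def inner_sum_left inner_sum_right indicator_inter_arith
      by (subst sum.swap) (intro sum.cong refl, simp only: inner_scaleR_left inner_scaleR_right mult_ac)
  qed
  finally show ?thesis .
qed

text \<open>Expanding the square leaves three inner products, each covered by the isometry for a
  pair, so the difference is never rewritten as a simple process on a common partition.\<close>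

lemma simple_integral_isometry_diff:
  assumes sd: "simple_data M F a b n \<tau> \<xi>" "0 \<le> a" and sd': "simple_data M F a' b' n' \<tau>' \<xi>'" "0 \<le> a'"
  shows "(\<integral>\<omega>. (simple_integral W n \<tau> \<xi> \<omega> - simple_integral W n' \<tau>' \<xi>' \<omega>)\<^sup>2 \<partial>M) =
    (\<integral>(t, \<omega>). (norm (simple_process n \<tau> \<xi> t \<omega> - simple_process n' \<tau>' \<xi>' t \<omega>))\<^sup>2 \<partial>TM)"
proof -
  let ?S = "simple_integral W n \<tau> \<xi>" and ?S' = "simple_integral W n' \<tau>' \<xi>'"
  let ?f = "\<lambda>(t, \<omega>). simple_process n \<tau> \<xi> t \<omega>" and ?f' = "\<lambda>(t, \<omega>). simple_process n' \<tau>' \<xi>' t \<omega>"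
  have S: "L2_fun M ?S" "L2_fun M ?S'"
    using sd sd' L2_fun_simple_integral by auto
  have f: "L2_fun TM ?f" "L2_fun TM ?f'"
    by (rule L2_fun_simple_process[OF sd(1)], rule L2_fun_simple_process[OF sd'(1)])
  have "(\<integral>\<omega>. (?S \<omega> - ?S' \<omega>)\<^sup>2 \<partial>M) = (\<integral>\<omega>. ?S \<omega> * ?S \<omega> - 2 * (?S \<omega> * ?S' \<omega>) + ?S' \<omega> * ?S' \<omega> \<partial>M)"
    by (rule Bochner_Integration.integral_cong[OF refl]) (simp add: power2_eq_square algebra_simps)
  also have "\<dots> = (\<integral>\<omega>. ?S \<omega> * ?S \<omega> \<partial>M) - 2 * (\<integral>\<omega>. ?S \<omega> * ?S' \<omega> \<partial>M) + (\<integral>\<omega>. ?S' \<omega> * ?S' \<omega> \<partial>M)"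
    using L2_fun_mult[OF S(1) S(1)] L2_fun_mult[OF S(1) S(2)]
      L2_fun_mult[OF S(2) S(2)] by simp
  also have "\<dots> = (\<integral>x. ?f x \<bullet> ?f x \<partial>TM) - 2 * (\<integral>x. ?f x \<bullet> ?f' x \<partial>TM)
      + (\<integral>x. ?f' x \<bullet> ?f' x \<partial>TM)"
    using simple_integral_isometry[OF sd sd] simple_integral_isometry[OF sd sd']
      simple_integral_isometry[OF sd' sd'] by (simp add: case_prod_unfold)
  also have "\<dots> = (\<integral>x. ?f x \<bullet> ?f x - 2 * (?f x \<bullet> ?f' x) + ?f' x \<bullet> ?f' x \<partial>TM)"
    using L2_fun_inner[OF f(1) f(1)] L2_fun_inner[OF f(1) f(2)]
      L2_fun_inner[OF f(2) f(2)] by simp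
  also have "\<dots> = (\<integral>x. (norm (?f x - ?f' x))\<^sup>2 \<partial>TM)"
    by (rule Bochner_Integration.integral_cong[OF refl], unfold power2_norm_eq_inner)
       (simp add: case_prod_unfold inner_diff_left inner_diff_right inner_commute)
  finally show ?thesis by (simp add: case_prod_unfold)
qed

text \<open>Cutting at \<open>r\<close> amounts to clipping the partition points. On the left, a
  coefficient whose interval starts at or after \<open>r\<close> is replaced by 0: its clipped
  interval is empty, yet \<open>\<xi> i\<close> might not be measurable at the clipped time
  \<open>r\<close>. On the right the points only move to later times, which keeps each coefficient
  measurable.\<close>

lemma simple_data_split:
  assumes sd: "simple_data M F a b n \<tau> \<xi>" and r: "a \<le> r" "r \<le> b"
  defines "\<xi>' \<equiv> \<lambda>i \<omega>. if \<tau> i < r then \<xi> i \<omega> else 0"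
  shows "simple_data M F a r n (\<lambda>i. min (\<tau> i) r) \<xi>'"
    and "simple_data M F r b n (\<lambda>i. max (\<tau> i) r) \<xi>"
    and "simple_integral W n \<tau> \<xi> \<omega> =
      simple_integral W n (\<lambda>i. min (\<tau> i) r) \<xi>' \<omega> + simple_integral W n (\<lambda>i. max (\<tau> i) r) \<xi> \<omega>"
    and "simple_process n (\<lambda>i. min (\<tau> i) r) \<xi>' t \<omega> = indicator {..r} t *\<^sub>R simple_process n \<tau> \<xi> t \<omega>"
proof -
  note D = simple_dataD[OF sd]
  have ab: "a \<le> \<tau> 0" "\<tau> n \<le> b" using sd by (auto simp: simple_data_def)
  show "simple_data M F a r n (\<lambda>i. min (\<tau> i) r) \<xi>'"
    unfolding simple_data_def
  proof (intro conjI allI impI)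
    fix i assume i: "i < n"
    show "min (\<tau> i) r \<le> min (\<tau> (Suc i)) r" using D(2)[OF i] by auto
    show "\<xi>' i \<in> borel_measurable (F (min (\<tau> i) r))"
      using D(4)[OF i] by (cases "\<tau> i < r") (simp_all add: \<xi>'_def min_def)
    obtain C where "\<forall>\<omega>\<in>space M. norm (\<xi> i \<omega>) \<le> C" using D(5)[OF i] by blast
    then show "\<exists>C. \<forall>\<omega>\<in>space M. norm (\<xi>' i \<omega>) \<le> C"
      by (intro exI[of _ "max C 0"]) (auto simp: \<xi>'_def le_max_iff_disj)
  qed (use ab r in auto)
  show "simple_data M F r b n (\<lambda>i. max (\<tau> i) r) \<xi>"
    unfolding simple_data_def
  proof (intro conjI allI impI)
    fix i assume i: "i < n"
    show "max (\<tau> i) r \<le> max (\<tau> (Suc i)) r" using D(2)[OF i] by auto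
    show "\<xi> i \<in> borel_measurable (F (max (\<tau> i) r))"
      using measurable_F_mono[OF D(4)[OF i]] by simp
    show "\<exists>C. \<forall>\<omega>\<in>space M. norm (\<xi> i \<omega>) \<le> C" by (rule D(5)[OF i])
  qed (use ab r in auto)
  show "simple_integral W n \<tau> \<xi> \<omega> =
      simple_integral W n (\<lambda>i. min (\<tau> i) r) \<xi>' \<omega> + simple_integral W n (\<lambda>i. max (\<tau> i) r) \<xi> \<omega>"
    unfolding simple_integral_def sum.distrib[symmetric]
  proof (intro sum.cong refl)
    fix i assume "i \<in> {..<n}"
    then have le: "\<tau> i \<le> \<tau> (Suc i)" using D(2) by simp
    \<comment> \<open>By monotonicity this combination of cases is the degenerate interval at
      \<open>r\<close>, whose increment is 0.\<close>
    then have "\<tau> i = r \<and> \<tau> (Suc i) = r" if "\<not> \<tau> i < r" "\<tau> (Suc i) \<le> r" using that by auto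
    then have "W (\<tau> (Suc i)) \<omega> = W (\<tau> i) \<omega>" if "\<not> \<tau> i < r" "\<tau> (Suc i) \<le> r" using that by metis
    with le show "\<xi> i \<omega> \<bullet> (W (\<tau> (Suc i)) \<omega> - W (\<tau> i) \<omega>) =
      \<xi>' i \<omega> \<bullet> (W (min (\<tau> (Suc i)) r) \<omega> - W (min (\<tau> i) r) \<omega>) +
      \<xi> i \<omega> \<bullet> (W (max (\<tau> (Suc i)) r) \<omega> - W (max (\<tau> i) r) \<omega>)"
      by (cases "\<tau> i < r"; cases "\<tau> (Suc i) \<le> r")
         (auto simp: \<xi>'_def min_def max_def inner_diff_right)
  qed
  show "simple_process n (\<lambda>i. min (\<tau> i) r) \<xi>' t \<omega> = indicator {..r} t *\<^sub>R simple_process n \<tau> \<xi> t \<omega>"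
    unfolding simple_process_def scaleR_sum_right
  proof (intro sum.cong refl)
    fix i assume "i \<in> {..<n}"
    then have "\<tau> i \<le> \<tau> (Suc i)" using D(2) by simp
    then show "indicator {min (\<tau> i) r<..min (\<tau> (Suc i)) r} t *\<^sub>R \<xi>' i \<omega> =
      indicator {..r} t *\<^sub>R indicator {\<tau> i<..\<tau> (Suc i)} t *\<^sub>R \<xi> i \<omega>"
      by (auto simp: \<xi>'_def indicator_def)
  qed
qed

lemma simple_data_scale:
  assumes sd: "simple_data M F a b n \<tau> \<xi>"
    and H: "H \<in> borel_measurable (F a)" "\<And>\<omega>. \<omega> \<in> space M \<Longrightarrow> \<bar>H \<omega>\<bar> \<le> K"
  shows "simple_data M F a b n \<tau> (\<lambda>i \<omega>. H \<omega> *\<^sub>R \<xi> i \<omega>)"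
    and "simple_integral W n \<tau> (\<lambda>i \<omega>. H \<omega> *\<^sub>R \<xi> i \<omega>) \<omega> = H \<omega> * simple_integral W n \<tau> \<xi> \<omega>"
    and "simple_process n \<tau> (\<lambda>i \<omega>. H \<omega> *\<^sub>R \<xi> i \<omega>) t \<omega> = H \<omega> *\<^sub>R simple_process n \<tau> \<xi> t \<omega>"
proof -
  note D = simple_dataD[OF sd]
  show "simple_data M F a b n \<tau> (\<lambda>i \<omega>. H \<omega> *\<^sub>R \<xi> i \<omega>)"
    unfolding simple_data_def
  proof (intro conjI allI impI)
    fix i assume i: "i < n"
    show "\<tau> i \<le> \<tau> (Suc i)" by (rule D(2)[OF i])
    have [measurable]: "H \<in> borel_measurable (F (\<tau> i))" "\<xi> i \<in> borel_measurable (F (\<tau> i))"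
      using D[OF i] measurable_F_mono[OF H(1)] by auto
    show "(\<lambda>\<omega>. H \<omega> *\<^sub>R \<xi> i \<omega>) \<in> borel_measurable (F (\<tau> i))" by measurable
    obtain C where "\<forall>\<omega>\<in>space M. norm (\<xi> i \<omega>) \<le> C" using D(5)[OF i] by blast
    then show "\<exists>C. \<forall>\<omega>\<in>space M. norm (H \<omega> *\<^sub>R \<xi> i \<omega>) \<le> C"
      by (intro exI[of _ "K * C"])
         (auto intro!: mult_mono[OF H(2) _ order_trans[OF abs_ge_zero H(2)] norm_ge_zero])
  qed (use sd in \<open>auto simp: simple_data_def\<close>)
next
  show "simple_process n \<tau> (\<lambda>i \<omega>. H \<omega> *\<^sub>R \<xi> i \<omega>) t \<omega> = H \<omega> *\<^sub>R simple_process n \<tau> \<xi> t \<omega>"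
    unfolding simple_process_def scaleR_sum_right by (intro sum.cong refl scaleR_left_commute)
qed (simp add: simple_integral_def sum_distrib_left)

section \<open>Properties of the Ito integral\<close>

lemma simple_process_eq_0:
  assumes "simple_data M F a b n \<tau> \<xi>" "t \<notin> {a..b}"
  shows "simple_process n \<tau> \<xi> t \<omega> = 0"
  unfolding simple_process_def
  by (rule sum.neutral) (use assms simple_dataD[OF assms(1)] in \<open>force simp: indicator_def\<close>)

text \<open>Extension by 0 to the whole time axis, on the product space: all processes become
  functions on the single measure space \<open>TM\<close>, and passing to a smaller interval becomes
  multiplication by an indicator.\<close>

definition restricted :: "real \<Rightarrow> real \<Rightarrow> (real \<Rightarrow> 'w \<Rightarrow> 'b::euclidean_space) \<Rightarrow> real \<times> 'w \<Rightarrow> 'b" where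
  "restricted a b \<phi> = (\<lambda>(t, \<omega>). indicator {a..b} t *\<^sub>R \<phi> t \<omega>)"

lemma restricted_subset:
  assumes "{c..d} \<subseteq> {a..b}"
  shows "restricted c d \<phi> = (\<lambda>x. indicator {c..d} (fst x) *\<^sub>R restricted a b \<phi> x)"
  using assms by (force simp: restricted_def indicator_def)

lemma restricted_measurable_subset:
  assumes "{c..d} \<subseteq> {a..b}" and [measurable]: "restricted a b \<phi> \<in> borel_measurable TM"
  shows "restricted c d \<phi> \<in> borel_measurable TM"
  unfolding restricted_subset[OF assms(1)] by measurable

lemma L2_fun_restricted_subset:
  assumes sub: "{c..d} \<subseteq> {a..b}" and \<phi>: "L2_fun TM (restricted a b \<phi>)"
  shows "L2_fun TM (restricted c d \<phi>)"
  unfolding restricted_subset[OF sub]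
  by (rule L2_fun_scaleR[OF \<phi>, of _ 1]) (auto simp: indicator_def)

text \<open>The definition is restated as convergence in two spaces of square-integrable functions,
  over \<open>TM\<close> and over \<open>M\<close>, where inner products pass to the limit.\<close>

lemma has_ito_integralE:
  assumes ito: "has_ito_integral M F W a b \<phi> I" and a: "0 \<le> a"
    and \<phi>: "L2_fun TM (restricted a b \<phi>)"
  obtains n \<tau> \<xi> where "\<And>k. simple_data M F a b (n k) (\<tau> k) (\<xi> k)"
    and "L2_tendsto TM (\<lambda>k (t, \<omega>). simple_process (n k) (\<tau> k) (\<xi> k) t \<omega>) (restricted a b \<phi>)"
    and "L2_tendsto M (\<lambda>k. simple_integral W (n k) (\<tau> k) (\<xi> k)) I"
proof -
  from ito obtain n \<tau> \<xi> where sd: "\<And>k. simple_data M F a b (n k) (\<tau> k) (\<xi> k)"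
    and lim1: "(\<lambda>k. \<integral>\<^sup>+\<omega>. (\<integral>\<^sup>+t\<in>{a..b}.
        ennreal ((norm (\<phi> t \<omega> - simple_process (n k) (\<tau> k) (\<xi> k) t \<omega>))\<^sup>2) \<partial>lborel) \<partial>M) \<longlonglongrightarrow> 0"
    and lim2: "(\<lambda>k. \<integral>\<^sup>+\<omega>. ennreal ((I \<omega> - simple_integral W (n k) (\<tau> k) (\<xi> k) \<omega>)\<^sup>2) \<partial>M) \<longlonglongrightarrow> 0"
    and I: "I \<in> borel_measurable M"
    unfolding has_ito_integral_def by blast
  let ?S = "\<lambda>k. simple_integral W (n k) (\<tau> k) (\<xi> k)"
  let ?s = "\<lambda>k (t, \<omega>). simple_process (n k) (\<tau> k) (\<xi> k) t \<omega>"
  have S: "L2_fun M (?S k)" for k by (rule L2_fun_simple_integral[OF sd a])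
  have s: "L2_fun TM (?s k)" for k by (rule L2_fun_simple_process[OF sd])
  have "(\<integral>\<^sup>+\<omega>. (\<integral>\<^sup>+t\<in>{a..b}. ennreal ((norm (\<phi> t \<omega> - ?s k (t, \<omega>)))\<^sup>2) \<partial>lborel) \<partial>M) =
    (\<integral>\<^sup>+x. ennreal ((norm (restricted a b \<phi> x - ?s k x))\<^sup>2) \<partial>TM)" for k
  proof -
    have [measurable]: "restricted a b \<phi> \<in> borel_measurable TM"
      "?s k \<in> borel_measurable TM"
      by (rule L2_fun_measurable[OF \<phi>], rule L2_fun_measurable[OF s])
    \<comment> \<open>Outside \<open>{a..b}\<close> the simple process vanishes as well, so the
      integral over the interval is the full squared norm on the product space.\<close>
    have "ennreal ((norm (\<phi> t \<omega> - ?s k (t, \<omega>)))\<^sup>2) * indicator {a..b} t =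
      ennreal ((norm (restricted a b \<phi> (t, \<omega>) - ?s k (t, \<omega>)))\<^sup>2)" for t \<omega>
      using simple_process_eq_0[OF sd[of k], of t \<omega>] by (auto simp: restricted_def indicator_def)
    then show ?thesis
      by (simp only:) (rule L.nn_integral_snd, measurable)
  qed
  with lim1 have "L2_tendsto TM ?s (restricted a b \<phi>)"
    using L2_tendsto_iff_nn_integral[OF s \<phi>] by simp
  moreover have I2: "L2_fun M I"
  proof -
    \<comment> \<open>Square integrability of \<open>I\<close> follows from one simple integral at
      finite distance from it.\<close>
    have "eventually (\<lambda>k. (\<integral>\<^sup>+\<omega>. ennreal ((I \<omega> - ?S k \<omega>)\<^sup>2) \<partial>M) < 1) sequentially"
      by (rule order_tendstoD(2)[OF lim2]) simp
    then obtain k where "(\<integral>\<^sup>+\<omega>. ennreal ((I \<omega> - ?S k \<omega>)\<^sup>2) \<partial>M) < 1"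
      by (auto simp: eventually_sequentially)
    then have "(\<integral>\<^sup>+\<omega>. ennreal ((I \<omega> - ?S k \<omega>)\<^sup>2) \<partial>M) < \<infinity>"
      using order.strict_trans[OF _ ennreal_one_less_top] by auto
    then have "L2_fun M (\<lambda>\<omega>. I \<omega> - ?S k \<omega>)"
      using I L2_fun_measurable[OF S] by (simp add: L2_fun_iff_nn_integral)
    from L2_fun_add[OF this S[of k]] show ?thesis by simp
  qed
  moreover have "L2_tendsto M ?S I"
    using L2_tendsto_iff_nn_integral[OF S I2] lim2 by simp
  ultimately show ?thesis using sd that by blast
qed

lemma ito_integral_L2_fun:
  assumes "has_ito_integral M F W a b \<phi> I" "0 \<le> a" "L2_fun TM (restricted a b \<phi>)"
  shows "L2_fun M I"
  by (rule has_ito_integralE[OF assms]) (simp add: L2_tendsto_def)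

lemma ito_integral_mean_zero:
  assumes ito: "has_ito_integral M F W a b \<phi> I" and a: "0 \<le> a"
    and \<phi>: "L2_fun TM (restricted a b \<phi>)"
    and H: "H \<in> borel_measurable (F a)" "L2_fun M H"
  shows "(\<integral>\<omega>. H \<omega> * I \<omega> \<partial>M) = 0"
proof -
  obtain n \<tau> \<xi> where sd: "\<And>k. simple_data M F a b (n k) (\<tau> k) (\<xi> k)"
    and lim: "L2_tendsto M (\<lambda>k. simple_integral W (n k) (\<tau> k) (\<xi> k)) I"
    by (rule has_ito_integralE[OF ito a \<phi>]) blast
  have "(\<lambda>k. \<integral>\<omega>. H \<omega> * simple_integral W (n k) (\<tau> k) (\<xi> k) \<omega> \<partial>M) \<longlonglongrightarrow> (\<integral>\<omega>. H \<omega> * I \<omega> \<partial>M)"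
    using L2_tendsto_inner[OF L2_tendsto_const[OF H(2)] lim] by simp
  then have "(\<lambda>k. 0) \<longlonglongrightarrow> (\<integral>\<omega>. H \<omega> * I \<omega> \<partial>M)"
    using simple_integral_mean_zero[OF sd a H] by simp
  then show ?thesis by (simp add: LIMSEQ_const_iff)
qed

text \<open>\<open>I\<close> and \<open>J\<close> come with unrelated approximations. Those of
  \<open>I\<close> are cut at \<open>r\<close>: the right parts are orthogonal to
  \<open>F r\<close>, and the left parts approximate the same integrand as those of
  \<open>J\<close>, so by the isometry their integrals differ from the ones approximating
  \<open>J\<close> by a null sequence.\<close>

lemma ito_integral_martingale:
  assumes ito: "has_ito_integral M F W a b \<phi> I" and ito': "has_ito_integral M F W a r \<phi> J"
    and r: "0 \<le> a" "a \<le> r" "r \<le> b"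
    and \<phi>: "L2_fun TM (restricted a b \<phi>)"
    and H: "H \<in> borel_measurable (F r)" "L2_fun M H"
  shows "(\<integral>\<omega>. H \<omega> * (I \<omega> - J \<omega>) \<partial>M) = 0"
proof -
  let ?N = TM
  have ind: "restricted a r \<phi> x = indicator {..r} (fst x) *\<^sub>R restricted a b \<phi> x" for x
    using r by (auto simp: restricted_def indicator_def case_prod_unfold)
  have \<phi>': "L2_fun ?N (restricted a r \<phi>)"
    by (rule L2_fun_restricted_subset[OF _ \<phi>]) (use r in auto)
  obtain n \<tau> \<xi> where sd: "\<And>k. simple_data M F a b (n k) (\<tau> k) (\<xi> k)"
    and lim: "L2_tendsto ?N (\<lambda>k (t, \<omega>). simple_process (n k) (\<tau> k) (\<xi> k) t \<omega>) (restricted a b \<phi>)"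
      "L2_tendsto M (\<lambda>k. simple_integral W (n k) (\<tau> k) (\<xi> k)) I"
    by (rule has_ito_integralE[OF ito r(1) \<phi>]) blast
  obtain n' \<tau>' \<xi>' where sd': "\<And>k. simple_data M F a r (n' k) (\<tau>' k) (\<xi>' k)"
    and lim': "L2_tendsto ?N (\<lambda>k (t, \<omega>). simple_process (n' k) (\<tau>' k) (\<xi>' k) t \<omega>) (restricted a r \<phi>)"
      "L2_tendsto M (\<lambda>k. simple_integral W (n' k) (\<tau>' k) (\<xi>' k)) J"
    by (rule has_ito_integralE[OF ito' r(1) \<phi>']) blast
  define \<tau>l where "\<tau>l k = (\<lambda>i. min (\<tau> k i) r)" for k
  define \<xi>l where "\<xi>l k = (\<lambda>i \<omega>. if \<tau> k i < r then \<xi> k i \<omega> else 0)" for k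
  define \<tau>r where "\<tau>r k = (\<lambda>i. max (\<tau> k i) r)" for k
  note split = simple_data_split[OF sd r(2,3), folded \<tau>l_def \<xi>l_def \<tau>r_def]
  let ?S = "\<lambda>k. simple_integral W (n k) (\<tau> k) (\<xi> k)" and ?S' = "\<lambda>k. simple_integral W (n' k) (\<tau>' k) (\<xi>' k)"
  let ?L = "\<lambda>k. simple_integral W (n k) (\<tau>l k) (\<xi>l k)" and ?R = "\<lambda>k. simple_integral W (n k) (\<tau>r k) (\<xi> k)"
  have sq: "L2_fun M (?S k)" "L2_fun M (?S' k)" "L2_fun M (?L k)"
    "L2_fun M (?R k)" for k
    using L2_fun_simple_integral[OF sd r(1)] L2_fun_simple_integral[OF sd' r(1)]
      L2_fun_simple_integral[OF split(1) r(1)]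
      L2_fun_simple_integral[OF split(2) order_trans[OF r(1,2)]] by auto
  have limL: "L2_tendsto ?N (\<lambda>k (t, \<omega>). simple_process (n k) (\<tau>l k) (\<xi>l k) t \<omega>) (restricted a r \<phi>)"
  proof (rule L2_tendsto_dominated[OF lim(1)])
    show "L2_fun ?N (\<lambda>(t, \<omega>). simple_process (n k) (\<tau>l k) (\<xi>l k) t \<omega>)" for k
      by (rule L2_fun_simple_process[OF split(1)])
    show "norm ((case x of (t, \<omega>) \<Rightarrow> simple_process (n k) (\<tau>l k) (\<xi>l k) t \<omega>) - restricted a r \<phi> x) \<le>
      1 * norm ((case x of (t, \<omega>) \<Rightarrow> simple_process (n k) (\<tau> k) (\<xi> k) t \<omega>) - restricted a b \<phi> x)"
      for k x
      by (cases "fst x \<le> r") (auto simp: split(4) ind case_prod_unfold)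
  qed (rule \<phi>')
  \<comment> \<open>Both sequences of processes tend to the integrand restricted to
    \<open>{a..r}\<close>; the isometry turns this into merging integrals.\<close>
  have "(\<lambda>k. \<integral>\<omega>. (?L k \<omega> - ?S' k \<omega>)\<^sup>2 \<partial>M) \<longlonglongrightarrow> 0"
    using L2_tendsto_diff[OF limL lim'(1)] simple_integral_isometry_diff[OF split(1) r(1) sd' r(1)]
    by (simp add: L2_tendsto_def case_prod_unfold)
  then have "L2_tendsto M (\<lambda>k \<omega>. ?L k \<omega> - ?S' k \<omega>) (\<lambda>\<omega>. 0)"
    using sq by (simp add: L2_tendsto_def L2_fun_diff L2_fun_zero)
  from L2_tendsto_inner[OF L2_tendsto_const[OF H(2)] this]
  have 1: "(\<lambda>k. \<integral>\<omega>. H \<omega> * (?L k \<omega> - ?S' k \<omega>) \<partial>M) \<longlonglongrightarrow> 0" by simp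
  have 2: "(\<lambda>k. \<integral>\<omega>. H \<omega> * (?S k \<omega> - ?S' k \<omega>) \<partial>M) \<longlonglongrightarrow> (\<integral>\<omega>. H \<omega> * (I \<omega> - J \<omega>) \<partial>M)"
    using L2_tendsto_inner[OF L2_tendsto_const[OF H(2)] L2_tendsto_diff[OF lim(2) lim'(2)]] by simp
  have "(\<integral>\<omega>. H \<omega> * (?S k \<omega> - ?S' k \<omega>) \<partial>M) = (\<integral>\<omega>. H \<omega> * (?L k \<omega> - ?S' k \<omega>) \<partial>M)" for k
  proof -
    have "(\<integral>\<omega>. H \<omega> * (?S k \<omega> - ?S' k \<omega>) \<partial>M) = (\<integral>\<omega>. H \<omega> * (?L k \<omega> - ?S' k \<omega>) + H \<omega> * ?R k \<omega> \<partial>M)"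
      by (rule Bochner_Integration.integral_cong[OF refl]) (simp add: split(3) algebra_simps)
    also have "\<dots> = (\<integral>\<omega>. H \<omega> * (?L k \<omega> - ?S' k \<omega>) \<partial>M) + (\<integral>\<omega>. H \<omega> * ?R k \<omega> \<partial>M)"
      by (intro Bochner_Integration.integral_add L2_fun_mult L2_fun_diff H sq)
    finally show ?thesis
      using simple_integral_mean_zero[OF split(2) order_trans[OF r(1,2)] H] by simp
  qed
  with 1 2 show ?thesis using LIMSEQ_unique by auto
qed

text \<open>The bounded weight \<open>H\<close>, known at time \<open>a\<close>, is moved into one
  of the two simple integrands, which thereby stays simple. The identity for simple processes then
  passes to the limit.\<close>

lemma ito_integral_isometry:
  assumes ito: "has_ito_integral M F W a b \<phi> I" and ito': "has_ito_integral M F W a b \<psi> J"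
    and a: "0 \<le> a"
    and \<phi>: "L2_fun TM (restricted a b \<phi>)"
    and \<psi>: "L2_fun TM (restricted a b \<psi>)"
    and H: "H \<in> borel_measurable (F a)" "\<And>\<omega>. \<omega> \<in> space M \<Longrightarrow> \<bar>H \<omega>\<bar> \<le> K"
  shows "(\<integral>\<omega>. H \<omega> * (I \<omega> * J \<omega>) \<partial>M) =
    (\<integral>x. H (snd x) * (restricted a b \<phi> x \<bullet> restricted a b \<psi> x) \<partial>TM)"
proof -
  let ?N = TM
  have [measurable]: "H \<in> borel_measurable M" by (rule measurable_F_M[OF H(1)])
  have scale: "L2_fun M (\<lambda>x. H x *\<^sub>R f x)" if "L2_fun M f" for f :: "'w \<Rightarrow> real"
    by (rule L2_fun_scaleR[OF that, of _ K]) (use H in \<open>auto intro!: AE_I2\<close>)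
  have scaleN: "L2_fun ?N (\<lambda>x. H (snd x) *\<^sub>R f x)" if "L2_fun ?N f"
    for f :: "real \<times> 'w \<Rightarrow> real^'d"
    by (rule L2_fun_scaleR[OF that, of _ K])
       (use H in \<open>auto intro!: AE_I2 simp: space_pair_measure\<close>)
  obtain n \<tau> \<xi> where sd: "\<And>k. simple_data M F a b (n k) (\<tau> k) (\<xi> k)"
    and lim: "L2_tendsto ?N (\<lambda>k (t, \<omega>). simple_process (n k) (\<tau> k) (\<xi> k) t \<omega>) (restricted a b \<phi>)"
      "L2_tendsto M (\<lambda>k. simple_integral W (n k) (\<tau> k) (\<xi> k)) I"
    by (rule has_ito_integralE[OF ito a \<phi>]) blast
  obtain n' \<tau>' \<xi>' where sd': "\<And>k. simple_data M F a b (n' k) (\<tau>' k) (\<xi>' k)"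
    and lim': "L2_tendsto ?N (\<lambda>k (t, \<omega>). simple_process (n' k) (\<tau>' k) (\<xi>' k) t \<omega>) (restricted a b \<psi>)"
      "L2_tendsto M (\<lambda>k. simple_integral W (n' k) (\<tau>' k) (\<xi>' k)) J"
    by (rule has_ito_integralE[OF ito' a \<psi>]) blast
  let ?S = "\<lambda>k. simple_integral W (n k) (\<tau> k) (\<xi> k)" and ?S' = "\<lambda>k. simple_integral W (n' k) (\<tau>' k) (\<xi>' k)"
  let ?s = "\<lambda>k (t, \<omega>). simple_process (n k) (\<tau> k) (\<xi> k) t \<omega>"
  let ?s' = "\<lambda>k (t, \<omega>). simple_process (n' k) (\<tau>' k) (\<xi>' k) t \<omega>"
  have "L2_tendsto M (\<lambda>k \<omega>. H \<omega> *\<^sub>R ?S k \<omega>) (\<lambda>\<omega>. H \<omega> *\<^sub>R I \<omega>)"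
    by (rule L2_tendsto_dominated[OF lim(2), of _ _ K])
       (use lim(2) scale H(2) in \<open>auto simp: L2_tendsto_def right_diff_distrib[symmetric] abs_mult
          intro!: mult_right_mono\<close>)
  from L2_tendsto_inner[OF this lim'(2)]
  have 1: "(\<lambda>k. \<integral>\<omega>. H \<omega> * ?S k \<omega> * ?S' k \<omega> \<partial>M) \<longlonglongrightarrow> (\<integral>\<omega>. H \<omega> * I \<omega> * J \<omega> \<partial>M)" by simp
  have "L2_tendsto ?N (\<lambda>k x. H (snd x) *\<^sub>R ?s k x) (\<lambda>x. H (snd x) *\<^sub>R restricted a b \<phi> x)"
    by (rule L2_tendsto_dominated[OF lim(1), of _ _ K])
       (use lim(1) scaleN H(2) in \<open>auto simp: L2_tendsto_def scaleR_diff_right[symmetric] space_pair_measure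
          intro!: mult_right_mono\<close>)
  from L2_tendsto_inner[OF this lim'(1)]
  have 2: "(\<lambda>k. \<integral>x. (H (snd x) *\<^sub>R ?s k x) \<bullet> ?s' k x \<partial>?N) \<longlonglongrightarrow>
    (\<integral>x. (H (snd x) *\<^sub>R restricted a b \<phi> x) \<bullet> restricted a b \<psi> x \<partial>?N)" .
  have "(\<integral>\<omega>. H \<omega> * ?S k \<omega> * ?S' k \<omega> \<partial>M) = (\<integral>x. (H (snd x) *\<^sub>R ?s k x) \<bullet> ?s' k x \<partial>?N)" for k
    using simple_integral_isometry[OF simple_data_scale(1)[OF sd[of k] H] a sd'[of k] a]
    by (simp add: case_prod_unfold simple_data_scale(2,3)[OF sd H])
  with 1 2 have "(\<integral>\<omega>. H \<omega> * I \<omega> * J \<omega> \<partial>M) = (\<integral>x. (H (snd x) *\<^sub>R restricted a b \<phi> x) \<bullet> restricted a b \<psi> x \<partial>?N)"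
    using LIMSEQ_unique by auto
  then show ?thesis by (simp add: mult.assoc)
qed

section \<open>Expectation of a product of semimartingales\<close>

lemma AE_pair_snd:
  assumes "AE \<omega> in M. P \<omega>"
  shows "AE x in TM. P (snd x)"
proof -
  obtain S where S: "S \<in> null_sets M" "{\<omega> \<in> space M. \<not> P \<omega>} \<subseteq> S"
    using assms by (auto simp: eventually_ae_filter)
  have "(UNIV :: real set) \<times> S \<in> null_sets TM"
    using S(1) by (auto simp: null_sets_def emeasure_pair_measure_Times)
  moreover have "{x \<in> space TM. \<not> P (snd x)} \<subseteq> UNIV \<times> S"
    using S(2) by (auto simp: space_pair_measure)
  ultimately show ?thesis by (rule AE_I')
qed

lemma section_measurable:
  fixes f :: "real \<times> 'w \<Rightarrow> 'b::euclidean_space"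
  assumes "f \<in> borel_measurable TM"
  shows "(\<lambda>\<omega>. f (r, \<omega>)) \<in> borel_measurable M"
    and "\<omega> \<in> space M \<Longrightarrow> (\<lambda>r. f (r, \<omega>)) \<in> borel_measurable lborel"
  using assms by (auto intro: measurable_Pair2 measurable_Pair1)

lemma L2_fun_sections:
  fixes f :: "real \<times> 'w \<Rightarrow> 'b::euclidean_space"
  assumes f: "L2_fun TM f"
  shows "AE r in lborel. L2_fun M (\<lambda>\<omega>. f (r, \<omega>))"
    and "AE \<omega> in M. L2_fun lborel (\<lambda>r. f (r, \<omega>))"
proof -
  have m: "f \<in> borel_measurable TM" and i: "integrable TM (\<lambda>x. (norm (f x))\<^sup>2)"
    using f by (auto simp: L2_fun_def)
  show "AE r in lborel. L2_fun M (\<lambda>\<omega>. f (r, \<omega>))"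
    using L.AE_integrable_fst'[OF i] section_measurable[OF m] by (simp add: L2_fun_def)
  have "AE \<omega> in M. integrable lborel (\<lambda>r. (norm (f (r, \<omega>)))\<^sup>2)"
    using L.AE_integrable_snd[of "\<lambda>r \<omega>. (norm (f (r, \<omega>)))\<^sup>2"] i by (simp add: case_prod_unfold)
  then show "AE \<omega> in M. L2_fun lborel (\<lambda>r. f (r, \<omega>))"
    by (rule AE_mp) (use section_measurable(2)[OF m] in \<open>auto intro!: AE_I2 simp: L2_fun_def\<close>)
qed

text \<open>For functions supported in \<open>{t..T}\<close> this is the drift accumulated from
  \<open>r\<close> to \<open>T\<close>.\<close>

definition tail_integral :: "(real \<times> 'w \<Rightarrow> real) \<Rightarrow> real \<Rightarrow> 'w \<Rightarrow> real" where
  "tail_integral f r \<omega> = (\<integral>u. indicator {r..} u * f (u, \<omega>) \<partial>lborel)"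

lemma tail_integral_measurable:
  assumes [measurable]: "f \<in> borel_measurable TM"
  shows "(\<lambda>(r, \<omega>). tail_integral f r \<omega>) \<in> borel_measurable TM"
proof -
  have "(\<lambda>x. \<integral>u. (if fst x \<le> u then 1 else 0) * f (u, snd x) \<partial>lborel) \<in> borel_measurable TM"
    by measurable
  then show ?thesis
    by (simp add: tail_integral_def case_prod_unfold indicator_def of_bool_def cong: if_cong)
qed

text \<open>Cauchy-Schwarz against the indicator of an interval of length at most
  \<open>T - t\<close>. The bound is independent of \<open>r\<close> and so provides one
  square-integrable majorant for all \<open>r\<close>.\<close>

lemma tail_integral_bound:
  assumes tT: "t \<le> T" and f: "L2_fun lborel (\<lambda>u. f (u, \<omega>))"
    and supp: "\<And>u. u \<notin> {t..T} \<Longrightarrow> f (u, \<omega>) = 0"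
  shows "\<bar>tail_integral f r \<omega>\<bar> \<le> sqrt (T - t) * sqrt (\<integral>u. (f (u, \<omega>))\<^sup>2 \<partial>lborel)"
proof -
  let ?A = "{r..} \<inter> {t..T}"
  have fin: "emeasure lborel ?A < \<infinity>"
    by (rule emeasure_bounded_finite) auto
  have ind: "integrable lborel (indicator ?A :: real \<Rightarrow> real)"
    using fin by (intro integrable_real_indicator) auto
  have ind2: "(\<lambda>x. (norm (indicator ?A x :: real))\<^sup>2) = indicator ?A" by (auto simp: indicator_def)
  have "L2_fun lborel (indicator ?A :: real \<Rightarrow> real)"
    unfolding L2_fun_def ind2 using ind by auto
  from L2_fun_Cauchy_Schwarz[OF this f]
  have "\<bar>\<integral>u. indicator ?A u * f (u, \<omega>) \<partial>lborel\<bar> \<le>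
      sqrt (\<integral>u. indicator ?A u \<partial>lborel) * sqrt (\<integral>u. (f (u, \<omega>))\<^sup>2 \<partial>lborel)"
    unfolding ind2 by simp
  also have "(\<integral>u. indicator ?A u * f (u, \<omega>) \<partial>lborel) = tail_integral f r \<omega>"
    unfolding tail_integral_def
    by (rule Bochner_Integration.integral_cong[OF refl]) (use supp in \<open>auto simp: indicator_def\<close>)
  also have "(\<integral>u. indicator ?A u \<partial>lborel) \<le> T - t"
  proof -
    have "measure lborel ?A \<le> measure lborel {t..T}"
      by (rule measure_mono_fmeasurable[OF _ _ fmeasurable_compact]) auto
    then show ?thesis using tT by simp
  qed
  finally show ?thesis by (simp add: mult_right_mono)
qed

lemma L2_fun_path_norm:
  assumes f: "L2_fun TM (f :: real \<times> 'w \<Rightarrow> real)"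
  shows "L2_fun M (\<lambda>\<omega>. sqrt (\<integral>u. (f (u, \<omega>))\<^sup>2 \<partial>lborel))"
proof -
  have i: "integrable TM (\<lambda>(u, \<omega>). (f (u, \<omega>))\<^sup>2)"
    using f by (simp add: L2_fun_def case_prod_unfold)
  from L.integrable_snd[OF i]
  have *: "integrable M (\<lambda>\<omega>. \<integral>u. (f (u, \<omega>))\<^sup>2 \<partial>lborel)" .
  have nn: "0 \<le> (\<integral>u. (f (u, \<omega>))\<^sup>2 \<partial>lborel)" for \<omega> by (rule integral_nonneg_AE) simp
  show ?thesis
    unfolding L2_fun_def using * borel_measurable_integrable[OF *] by (simp add: nn)
qed

lemma L2_fun_tail_integral:
  assumes tT: "t \<le> T" and f: "L2_fun TM f"
    and supp: "\<And>u \<omega>. u \<notin> {t..T} \<Longrightarrow> f (u, \<omega>) = 0"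
  shows "L2_fun TM (restricted t T (tail_integral f))"
    and "L2_fun M (tail_integral f r)"
proof -
  let ?K = "\<lambda>\<omega>. sqrt (\<integral>u. (f (u, \<omega>))\<^sup>2 \<partial>lborel)"
  have f': "f \<in> borel_measurable TM" by (rule L2_fun_measurable[OF f])
  have bd: "AE \<omega> in M. \<forall>r. \<bar>tail_integral f r \<omega>\<bar> \<le> sqrt (T - t) * ?K \<omega>"
    using L2_fun_sections(2)[OF f] by eventually_elim (use tail_integral_bound tT supp in blast)
  have "L2_fun TM (\<lambda>(r::real, \<omega>). indicator {t..T} r *\<^sub>R ?K \<omega>)"
    by (rule L2_fun_lborel_rectangle[OF _ emeasure_compact_finite[OF compact_Icc]
          L2_fun_path_norm[OF f]]) simp
  then show "L2_fun TM (restricted t T (tail_integral f))"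
  proof (rule L2_fun_bound)
    have [measurable]: "(\<lambda>x. tail_integral f (fst x) (snd x)) \<in> borel_measurable TM"
      using tail_integral_measurable[OF f'] by (simp add: case_prod_unfold)
    have "(\<lambda>x. indicator {t..T} (fst x) *\<^sub>R tail_integral f (fst x) (snd x)) \<in> borel_measurable TM"
      by measurable
    then show "restricted t T (tail_integral f) \<in> borel_measurable TM"
      by (simp add: restricted_def case_prod_unfold)
    show "AE x in TM. norm (restricted t T (tail_integral f) x) \<le>
        sqrt (T - t) * norm (case x of (r, \<omega>) \<Rightarrow> indicator {t..T} r *\<^sub>R ?K \<omega>)"
      using AE_pair_snd[OF bd]
      by eventually_elim (auto simp: restricted_def indicator_def case_prod_unfold integral_nonneg_AE)
  qed
  show "L2_fun M (tail_integral f r)"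
  proof (rule L2_fun_bound[OF L2_fun_path_norm[OF f]])
    show "tail_integral f r \<in> borel_measurable M"
      using section_measurable(1)[OF tail_integral_measurable[OF f'], of r] by simp
    show "AE \<omega> in M. norm (tail_integral f r \<omega>) \<le> sqrt (T - t) * norm (?K \<omega>)"
      using bd by eventually_elim (auto simp: integral_nonneg_AE)
  qed
qed

lemma restricted_supp: "u \<notin> {t..T} \<Longrightarrow> restricted t T f (u, \<omega>) = 0"
  by (simp add: restricted_def)

lemma tail_integral_start:
  "tail_integral (restricted t T f) t \<omega> = (\<integral>u. restricted t T f (u, \<omega>) \<partial>lborel)"
  unfolding tail_integral_def
  by (rule Bochner_Integration.integral_cong[OF refl]) (simp add: restricted_def indicator_def)

text \<open>At fixed \<open>r\<close> the equation expresses \<open>Y r\<close> by the terminal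
  value, the later drift and the remainder \<open>I r\<close>, and the adapted factor
  \<open>a r\<close> annihilates the remainder in expectation. Time is integrated only afterwards,
  when the versions \<open>I r\<close> are gone.\<close>

lemma drift_tested_by_process:
  fixes a g Y I :: "real \<Rightarrow> 'w \<Rightarrow> real"
  assumes tT: "t \<le> T"
    and a: "L2_fun TM (restricted t T a)" "\<And>r. r \<in> {t..T} \<Longrightarrow> a r \<in> borel_measurable (F r)"
    and g: "L2_fun TM (restricted t T g)"
    and Y: "L2_fun TM (restricted t T Y)" "L2_fun M (Y T)"
    and eq: "\<And>r. r \<in> {t..T} \<Longrightarrow>
      AE \<omega> in M. Y T \<omega> = Y r \<omega> + tail_integral (restricted t T g) r \<omega> + I r \<omega>"
    and I: "\<And>r. r \<in> {t..T} \<Longrightarrow> L2_fun M (I r)"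
      "\<And>r H. r \<in> {t..T} \<Longrightarrow> H \<in> borel_measurable (F r) \<Longrightarrow> L2_fun M H \<Longrightarrow>
        (\<integral>\<omega>. H \<omega> * I r \<omega> \<partial>M) = 0"
  shows "(\<integral>x. restricted t T a x * restricted t T Y x \<partial>TM) =
    (\<integral>\<omega>. tail_integral (restricted t T a) t \<omega> * Y T \<omega> \<partial>M) -
    (\<integral>x. restricted t T a x * restricted t T (tail_integral (restricted t T g)) x \<partial>TM)"
proof -
  let ?a = "restricted t T a" and ?Y = "restricted t T Y"
  let ?G = "restricted t T (tail_integral (restricted t T g))"
  \<comment> \<open>The terminal value as a process constant in time; Fubini's theorem later
    collects the drift \<open>a\<close> in front of it.\<close>
  let ?YT = "\<lambda>(r::real, \<omega>). indicator {t..T} r *\<^sub>R Y T \<omega>"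
  have G: "L2_fun TM ?G"
    by (rule L2_fun_tail_integral(1)[OF tT g restricted_supp])
  have YT: "L2_fun TM ?YT"
    by (rule L2_fun_lborel_rectangle[OF _ emeasure_compact_finite[OF compact_Icc] Y(2)]) simp
  note int = L2_fun_mult[OF a(1) Y(1)] L2_fun_mult[OF a(1) G]
    L2_fun_mult[OF a(1) YT]
  have "AE r in lborel. (\<integral>\<omega>. ?a (r, \<omega>) * ?Y (r, \<omega>) \<partial>M) =
    (\<integral>\<omega>. ?a (r, \<omega>) * ?YT (r, \<omega>) \<partial>M) - (\<integral>\<omega>. ?a (r, \<omega>) * ?G (r, \<omega>) \<partial>M)"
    using L2_fun_sections(1)[OF a(1)] L2_fun_sections(1)[OF Y(1)]
      L2_fun_sections(1)[OF G]
  proof eventually_elim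
    case (elim r)
    show ?case
    proof (cases "r \<in> {t..T}")
      case True
      have ar: "L2_fun M (a r)" and Yr: "L2_fun M (Y r)"
        and Gr: "L2_fun M (tail_integral (restricted t T g) r)"
        using elim True by (auto simp: restricted_def)
      note [measurable] = ar[THEN L2_fun_measurable] Yr[THEN L2_fun_measurable]
        Gr[THEN L2_fun_measurable] I(1)[OF True, THEN L2_fun_measurable]
        Y(2)[THEN L2_fun_measurable]
      have "(\<integral>\<omega>. a r \<omega> * Y T \<omega> \<partial>M) =
          (\<integral>\<omega>. a r \<omega> * Y r \<omega> + a r \<omega> * tail_integral (restricted t T g) r \<omega> + a r \<omega> * I r \<omega> \<partial>M)"
        by (rule integral_cong_AE, measurable)
           (use eq[OF True] in \<open>eventually_elim, simp add: distrib_left\<close>)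
      also have "\<dots> = (\<integral>\<omega>. a r \<omega> * Y r \<omega> \<partial>M) + (\<integral>\<omega>. a r \<omega> * tail_integral (restricted t T g) r \<omega> \<partial>M)
          + (\<integral>\<omega>. a r \<omega> * I r \<omega> \<partial>M)"
        using L2_fun_mult[OF ar Yr] L2_fun_mult[OF ar Gr]
          L2_fun_mult[OF ar I(1)[OF True]] by simp
      also have "(\<integral>\<omega>. a r \<omega> * I r \<omega> \<partial>M) = 0"
        by (rule I(2)[OF True a(2)[OF True] ar])
      finally show ?thesis using True by (simp add: restricted_def)
    qed (simp add: restricted_def)
  qed
  then have "(\<integral>r. \<integral>\<omega>. ?a (r, \<omega>) * ?Y (r, \<omega>) \<partial>M \<partial>lborel) =
    (\<integral>r. (\<integral>\<omega>. ?a (r, \<omega>) * ?YT (r, \<omega>) \<partial>M) - (\<integral>\<omega>. ?a (r, \<omega>) * ?G (r, \<omega>) \<partial>M) \<partial>lborel)"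
    by (intro integral_cong_AE borel_measurable_diff borel_measurable_integrable[OF L.integrable_fst'[OF int(1)]]
        borel_measurable_integrable[OF L.integrable_fst'[OF int(2)]]
        borel_measurable_integrable[OF L.integrable_fst'[OF int(3)]])
  also have "\<dots> = (\<integral>r. (\<integral>\<omega>. ?a (r, \<omega>) * ?YT (r, \<omega>) \<partial>M) \<partial>lborel) -
      (\<integral>r. (\<integral>\<omega>. ?a (r, \<omega>) * ?G (r, \<omega>) \<partial>M) \<partial>lborel)"
    by (rule Bochner_Integration.integral_diff[OF L.integrable_fst'[OF int(3)] L.integrable_fst'[OF int(2)]])
  finally have "(\<integral>x. ?a x * ?Y x \<partial>TM) = (\<integral>x. ?a x * ?YT x \<partial>TM) - (\<integral>x. ?a x * ?G x \<partial>TM)"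
    unfolding L.integral_fst'[OF int(1)] L.integral_fst'[OF int(2)] L.integral_fst'[OF int(3)] .
  moreover have "(\<integral>x. ?a x * ?YT x \<partial>TM) = (\<integral>\<omega>. tail_integral ?a t \<omega> * Y T \<omega> \<partial>M)"
  proof -
    have 1: "(\<integral>x. ?a x * ?YT x \<partial>TM) = (\<integral>\<omega>. \<integral>r. ?a (r, \<omega>) * ?YT (r, \<omega>) \<partial>lborel \<partial>M)"
      using L.integral_snd[of "\<lambda>r \<omega>. ?a (r, \<omega>) * ?YT (r, \<omega>)"] int(3) by (simp add: case_prod_unfold)
    have 2: "(\<integral>r. ?a (r, \<omega>) * ?YT (r, \<omega>) \<partial>lborel) = tail_integral ?a t \<omega> * Y T \<omega>" for \<omega>
      unfolding tail_integral_start
      by (subst integral_mult_left_zero[symmetric])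
         (rule Bochner_Integration.integral_cong[OF refl], simp add: restricted_def indicator_def)
    show ?thesis unfolding 1 2 ..
  qed
  ultimately show ?thesis by simp
qed

lemma integrable_restricted_path:
  fixes h :: "real \<Rightarrow> 'w \<Rightarrow> real"
  assumes h: "L2_fun lborel (\<lambda>r. restricted t T h (r, \<omega>))"
  shows "integrable lborel (\<lambda>r. restricted t T h (r, \<omega>))"
proof -
  have ind: "(\<lambda>x. (norm (indicator {t..T} x :: real))\<^sup>2) = indicator {t..T}" by (auto simp: indicator_def)
  have "L2_fun lborel (indicator {t..T} :: real \<Rightarrow> real)"
    unfolding L2_fun_def ind
    by (auto intro!: integrable_real_indicator emeasure_compact_finite[unfolded infinity_ennreal_def])
  from L2_fun_mult[OF this h]
  have "integrable lborel (\<lambda>r. indicator {t..T} r * restricted t T h (r, \<omega>))" .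
  moreover have "indicator {t..T} r * restricted t T h (r, \<omega>) = restricted t T h (r, \<omega>)" for r
    by (simp add: restricted_def indicator_def)
  ultimately show ?thesis by (simp only:)
qed

text \<open>\<open>integral_triangle\<close> is applied along almost every path; square
  integrability on a bounded interval makes the paths integrable.\<close>

lemma tail_integral_product:
  assumes tT: "t \<le> T" and a: "L2_fun TM (restricted t T a)" and g: "L2_fun TM (restricted t T g)"
  shows "(\<integral>x. restricted t T a x * restricted t T (tail_integral (restricted t T g)) x \<partial>TM) +
    (\<integral>x. restricted t T g x * restricted t T (tail_integral (restricted t T a)) x \<partial>TM) =
    (\<integral>\<omega>. tail_integral (restricted t T a) t \<omega> * tail_integral (restricted t T g) t \<omega> \<partial>M)"
proof -
  let ?a = "restricted t T a" and ?g = "restricted t T g"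
  let ?A = "restricted t T (tail_integral ?a)" and ?G = "restricted t T (tail_integral ?g)"
  have A: "L2_fun TM ?A"
    by (rule L2_fun_tail_integral(1)[OF tT a restricted_supp])
  have G: "L2_fun TM ?G"
    by (rule L2_fun_tail_integral(1)[OF tT g restricted_supp])
  have i: "integrable TM (\<lambda>(r, \<omega>). ?a (r, \<omega>) * ?G (r, \<omega>))" "integrable TM (\<lambda>(r, \<omega>). ?g (r, \<omega>) * ?A (r, \<omega>))"
    using L2_fun_mult[OF a G] L2_fun_mult[OF g A] by (simp_all add: case_prod_unfold)
  have "AE \<omega> in M. (\<integral>r. ?a (r, \<omega>) * ?G (r, \<omega>) \<partial>lborel) + (\<integral>r. ?g (r, \<omega>) * ?A (r, \<omega>) \<partial>lborel) =
      tail_integral ?a t \<omega> * tail_integral ?g t \<omega>"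
    using L2_fun_sections(2)[OF a] L2_fun_sections(2)[OF g]
  proof eventually_elim
    case (elim \<omega>)
    have "(\<integral>r. ?a (r, \<omega>) * ?G (r, \<omega>) \<partial>lborel) = (\<integral>r. ?a (r, \<omega>) * tail_integral ?g r \<omega> \<partial>lborel)"
      "(\<integral>r. ?g (r, \<omega>) * ?A (r, \<omega>) \<partial>lborel) = (\<integral>r. ?g (r, \<omega>) * tail_integral ?a r \<omega> \<partial>lborel)"
      by (rule Bochner_Integration.integral_cong[OF refl]; simp add: restricted_def indicator_def)+
    then show ?case
      using integral_triangle[OF elim[THEN integrable_restricted_path]]
      unfolding tail_integral_start unfolding tail_integral_def by simp
  qed
  then have "(\<integral>\<omega>. (\<integral>r. ?a (r, \<omega>) * ?G (r, \<omega>) \<partial>lborel) + (\<integral>r. ?g (r, \<omega>) * ?A (r, \<omega>) \<partial>lborel) \<partial>M) =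
      (\<integral>\<omega>. tail_integral ?a t \<omega> * tail_integral ?g t \<omega> \<partial>M)"
    by (intro integral_cong_AE borel_measurable_add borel_measurable_times
        borel_measurable_integrable[OF L.integrable_snd[OF i(1)]]
        borel_measurable_integrable[OF L.integrable_snd[OF i(2)]]
        L2_fun_measurable[OF L2_fun_tail_integral(2)[OF tT a restricted_supp]]
        L2_fun_measurable[OF L2_fun_tail_integral(2)[OF tT g restricted_supp]])
  moreover have "(\<integral>\<omega>. (\<integral>r. ?a (r, \<omega>) * ?G (r, \<omega>) \<partial>lborel) + (\<integral>r. ?g (r, \<omega>) * ?A (r, \<omega>) \<partial>lborel) \<partial>M) =
      (\<integral>(r, \<omega>). ?a (r, \<omega>) * ?G (r, \<omega>) \<partial>TM) + (\<integral>(r, \<omega>). ?g (r, \<omega>) * ?A (r, \<omega>) \<partial>TM)"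
    unfolding Bochner_Integration.integral_add[OF L.integrable_snd[OF i(1)] L.integrable_snd[OF i(2)]]
      L.integral_snd[OF i(1)] L.integral_snd[OF i(2)] ..
  ultimately show ?thesis by (simp only: case_prod_unfold prod.collapse)
qed

text \<open>Integration by parts in expectation. The remainders are abstract and enter through
  orthogonality to the past, so that the indicator of an event may be built into \<open>X\<close>
  and \<open>J\<close> when the lemma is applied.\<close>

lemma expectation_product:
  fixes a g X Y I J :: "real \<Rightarrow> 'w \<Rightarrow> real"
  assumes tT: "t \<le> T"
    and a: "L2_fun TM (restricted t T a)" "\<And>r. r \<in> {t..T} \<Longrightarrow> a r \<in> borel_measurable (F r)"
    and g: "L2_fun TM (restricted t T g)" "\<And>r. r \<in> {t..T} \<Longrightarrow> g r \<in> borel_measurable (F r)"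
    and X: "L2_fun TM (restricted t T X)" "L2_fun M (X T)"
      "X t \<in> borel_measurable (F t)" "L2_fun M (X t)"
    and Y: "L2_fun TM (restricted t T Y)" "L2_fun M (Y T)"
      "Y t \<in> borel_measurable (F t)" "L2_fun M (Y t)"
    and eqX: "\<And>r. r \<in> {t..T} \<Longrightarrow>
      AE \<omega> in M. X T \<omega> = X r \<omega> + tail_integral (restricted t T a) r \<omega> + J r \<omega>"
    and eqY: "\<And>r. r \<in> {t..T} \<Longrightarrow>
      AE \<omega> in M. Y T \<omega> = Y r \<omega> + tail_integral (restricted t T g) r \<omega> + I r \<omega>"
    and J: "\<And>r. r \<in> {t..T} \<Longrightarrow> L2_fun M (J r)"
      "\<And>r H. r \<in> {t..T} \<Longrightarrow> H \<in> borel_measurable (F r) \<Longrightarrow> L2_fun M H \<Longrightarrow>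
        (\<integral>\<omega>. H \<omega> * J r \<omega> \<partial>M) = 0"
    and I: "\<And>r. r \<in> {t..T} \<Longrightarrow> L2_fun M (I r)"
      "\<And>r H. r \<in> {t..T} \<Longrightarrow> H \<in> borel_measurable (F r) \<Longrightarrow> L2_fun M H \<Longrightarrow>
        (\<integral>\<omega>. H \<omega> * I r \<omega> \<partial>M) = 0"
  shows "(\<integral>\<omega>. X T \<omega> * Y T \<omega> \<partial>M) - (\<integral>\<omega>. X t \<omega> * Y t \<omega> \<partial>M) =
    (\<integral>x. restricted t T a x * restricted t T Y x \<partial>TM) +
    (\<integral>x. restricted t T g x * restricted t T X x \<partial>TM) + (\<integral>\<omega>. J t \<omega> * I t \<omega> \<partial>M)"
proof -
  let ?A = "tail_integral (restricted t T a) t" and ?B = "tail_integral (restricted t T g) t"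
  have t: "t \<in> {t..T}" using tT by simp
  have A: "L2_fun M ?A"
    by (rule L2_fun_tail_integral(2)[OF tT a(1) restricted_supp])
  have B: "L2_fun M ?B"
    by (rule L2_fun_tail_integral(2)[OF tT g(1) restricted_supp])
  note Jt = J(1)[OF t] and It = I(1)[OF t]
  note [measurable] = A[THEN L2_fun_measurable] B[THEN L2_fun_measurable]
    X(2,4)[THEN L2_fun_measurable] Y(2,4)[THEN L2_fun_measurable]
    Jt[THEN L2_fun_measurable] It[THEN L2_fun_measurable]
  have "(\<integral>x. restricted t T a x * restricted t T Y x \<partial>TM) + (\<integral>x. restricted t T g x * restricted t T X x \<partial>TM) =
    (\<integral>\<omega>. ?A \<omega> * Y T \<omega> \<partial>M) + (\<integral>\<omega>. ?B \<omega> * X T \<omega> \<partial>M) - (\<integral>\<omega>. ?A \<omega> * ?B \<omega> \<partial>M)"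
    using drift_tested_by_process[of t T a g Y I] drift_tested_by_process[of t T g a X J]
      tail_integral_product[OF tT a(1) g(1)] assms by simp
  also have "\<dots> = (\<integral>\<omega>. ?A \<omega> * Y T \<omega> + ?B \<omega> * X T \<omega> - ?A \<omega> * ?B \<omega> \<partial>M)"
    using L2_fun_mult[OF A Y(2)] L2_fun_mult[OF B X(2)] L2_fun_mult[OF A B]
    by simp
  \<comment> \<open>With all values at \<open>T\<close>,
    \<open>A * Y + B * X - A * B = X * Y - (X - A) * (Y - B)\<close>, where \<open>X - A\<close> is
    \<open>X t + J t\<close> and \<open>Y - B\<close> is \<open>Y t + I t\<close>.\<close>
  also have "\<dots> = (\<integral>\<omega>. X T \<omega> * Y T \<omega> - X t \<omega> * Y t \<omega> - Y t \<omega> * J t \<omega> - X t \<omega> * I t \<omega> - J t \<omega> * I t \<omega> \<partial>M)"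
  proof (rule integral_cong_AE)
    show "AE \<omega> in M. ?A \<omega> * Y T \<omega> + ?B \<omega> * X T \<omega> - ?A \<omega> * ?B \<omega> =
        X T \<omega> * Y T \<omega> - X t \<omega> * Y t \<omega> - Y t \<omega> * J t \<omega> - X t \<omega> * I t \<omega> - J t \<omega> * I t \<omega>"
      using eqX[OF t] eqY[OF t]
    proof eventually_elim
      case (elim \<omega>)
      then have eqs: "?A \<omega> = X T \<omega> - X t \<omega> - J t \<omega>" "?B \<omega> = Y T \<omega> - Y t \<omega> - I t \<omega>" by linarith+
      show ?case unfolding eqs by (simp add: algebra_simps)
    qed
  qed measurable
  also have "\<dots> = (\<integral>\<omega>. X T \<omega> * Y T \<omega> \<partial>M) - (\<integral>\<omega>. X t \<omega> * Y t \<omega> \<partial>M) -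
      (\<integral>\<omega>. Y t \<omega> * J t \<omega> \<partial>M) - (\<integral>\<omega>. X t \<omega> * I t \<omega> \<partial>M) - (\<integral>\<omega>. J t \<omega> * I t \<omega> \<partial>M)"
    using L2_fun_mult[OF X(2) Y(2)] L2_fun_mult[OF X(4) Y(4)]
      L2_fun_mult[OF Y(4) Jt] L2_fun_mult[OF X(4) It] L2_fun_mult[OF Jt It]
    by simp
  finally show ?thesis unfolding J(2)[OF t Y(3,4)] I(2)[OF t X(3,4)] by linarith
qed

section \<open>Processes on a time interval\<close>

text \<open>Treats products, scalings and inner products at once. The indicator may be put on both
  factors because a bilinear map vanishes at 0.\<close>

lemma restricted_bilinear:
  assumes "bounded_bilinear f"
  shows "restricted a b (\<lambda>t \<omega>. f (\<phi> t \<omega>) (\<psi> t \<omega>)) x = f (restricted a b \<phi> x) (restricted a b \<psi> x)"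
  by (cases "fst x \<in> {a..b}")
     (simp_all add: restricted_def case_prod_unfold bounded_bilinear.zero_left[OF assms])

lemmas restricted_mult = restricted_bilinear[OF bounded_bilinear_mult]
lemmas restricted_inner = restricted_bilinear[OF bounded_bilinear_inner]

lemma restricted_add: "restricted a b (\<lambda>t \<omega>. \<phi> t \<omega> + \<psi> t \<omega>) x = restricted a b \<phi> x + restricted a b \<psi> x"
  by (simp add: restricted_def case_prod_unfold scaleR_add_right)

lemma restricted_uminus: "restricted a b (\<lambda>t \<omega>. - \<phi> t \<omega>) x = - restricted a b \<phi> x"
  by (simp add: restricted_def case_prod_unfold)

text \<open>This is where the uniform bounds on the coefficients act: a bounded factor keeps the
  product square integrable.\<close>

lemma L2_fun_restricted_bilinear:
  fixes f :: "'x::euclidean_space \<Rightarrow> 'y::euclidean_space \<Rightarrow> 'z::euclidean_space"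
  assumes f: "bounded_bilinear f" "\<And>x y. norm (f x y) \<le> norm x * norm y"
    and \<phi>: "restricted a b \<phi> \<in> borel_measurable TM"
      "\<And>t \<omega>. t \<in> {a..b} \<Longrightarrow> \<omega> \<in> space M \<Longrightarrow> norm (\<phi> t \<omega>) \<le> C"
    and \<psi>: "L2_fun TM (restricted a b \<psi>)"
  shows "L2_fun TM (restricted a b (\<lambda>t \<omega>. f (\<phi> t \<omega>) (\<psi> t \<omega>)))"
proof (rule L2_fun_bound[OF \<psi>, of _ C])
  have "continuous_on UNIV (\<lambda>p. f (fst p) (snd p))"
    by (intro bounded_bilinear.continuous_on[OF f(1)] continuous_intros)
  then have "(\<lambda>p. f (fst p) (snd p)) \<in> borel_measurable borel"
    by (rule borel_measurable_continuous_onI)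
  from measurable_compose[OF borel_measurable_Pair[OF \<phi>(1) L2_fun_measurable[OF \<psi>]] this]
  show "restricted a b (\<lambda>t \<omega>. f (\<phi> t \<omega>) (\<psi> t \<omega>)) \<in> borel_measurable TM"
    by (subst restricted_bilinear[OF f(1), abs_def]) simp
  show "AE x in TM. norm (restricted a b (\<lambda>t \<omega>. f (\<phi> t \<omega>) (\<psi> t \<omega>)) x) \<le> C * norm (restricted a b \<psi> x)"
  proof (rule AE_I2)
    fix x assume "x \<in> space TM"
    then obtain t \<omega> where x: "x = (t, \<omega>)" "\<omega> \<in> space M" by (auto simp: space_pair_measure)
    show "norm (restricted a b (\<lambda>t \<omega>. f (\<phi> t \<omega>) (\<psi> t \<omega>)) x) \<le> C * norm (restricted a b \<psi> x)"
    proof (cases "t \<in> {a..b}")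
      case True
      have "norm (f (\<phi> t \<omega>) (\<psi> t \<omega>)) \<le> C * norm (\<psi> t \<omega>)"
        using f(2) by (rule order_trans) (use \<phi>(2)[OF True x(2)] in \<open>simp add: mult_right_mono\<close>)
      then show ?thesis using True by (simp add: restricted_def x)
    qed (auto simp: restricted_def x)
  qed
qed

lemma L2_fun_restricted_mult:
  fixes \<phi> \<psi> :: "real \<Rightarrow> 'w \<Rightarrow> real"
  assumes "restricted a b \<phi> \<in> borel_measurable TM"
    and "\<And>t \<omega>. t \<in> {a..b} \<Longrightarrow> \<omega> \<in> space M \<Longrightarrow> norm (\<phi> t \<omega>) \<le> C"
    and "L2_fun TM (restricted a b \<psi>)"
  shows "L2_fun TM (restricted a b (\<lambda>t \<omega>. \<phi> t \<omega> * \<psi> t \<omega>))"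
  by (rule L2_fun_restricted_bilinear[OF bounded_bilinear_mult norm_mult_ineq assms])

lemma L2_fun_restricted_scaleR:
  fixes \<phi> :: "real \<Rightarrow> 'w \<Rightarrow> 'b::euclidean_space"
  assumes "restricted a b \<phi> \<in> borel_measurable TM"
    and "\<And>t \<omega>. t \<in> {a..b} \<Longrightarrow> \<omega> \<in> space M \<Longrightarrow> norm (\<phi> t \<omega>) \<le> C"
    and "L2_fun TM (restricted a b \<psi>)"
  shows "L2_fun TM (restricted a b (\<lambda>t \<omega>. \<psi> t \<omega> *\<^sub>R \<phi> t \<omega>))"
  by (rule L2_fun_restricted_bilinear[OF bounded_bilinear.flip[OF bounded_bilinear_scaleR] _ assms])
     (simp add: mult.commute)

lemma L2_fun_restricted_inner:
  fixes \<phi> :: "real \<Rightarrow> 'w \<Rightarrow> 'b::euclidean_space"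
  assumes "restricted a b \<phi> \<in> borel_measurable TM"
    and "\<And>t \<omega>. t \<in> {a..b} \<Longrightarrow> \<omega> \<in> space M \<Longrightarrow> norm (\<phi> t \<omega>) \<le> C"
    and "L2_fun TM (restricted a b \<psi>)"
  shows "L2_fun TM (restricted a b (\<lambda>t \<omega>. \<psi> t \<omega> \<bullet> \<phi> t \<omega>))"
  by (rule L2_fun_restricted_bilinear[OF bounded_bilinear.flip[OF bounded_bilinear_inner] _ assms])
     (simp, metis Cauchy_Schwarz_ineq2 mult.commute)

lemma L2_fun_restricted_add:
  assumes "L2_fun TM (restricted a b \<phi>)" "L2_fun TM (restricted a b \<psi>)"
  shows "L2_fun TM (restricted a b (\<lambda>t \<omega>. \<phi> t \<omega> + \<psi> t \<omega>))"
  using L2_fun_add[OF assms] by (subst restricted_add[abs_def])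

lemma L2_fun_restricted_uminus:
  assumes "L2_fun TM (restricted a b \<phi>)"
  shows "L2_fun TM (restricted a b (\<lambda>t \<omega>. - \<phi> t \<omega>))"
  using L2_fun_cmult[OF assms, of "- 1"] by (subst restricted_uminus[abs_def]) simp

lemma restricted_const_mult:
  fixes \<phi> :: "real \<Rightarrow> 'w \<Rightarrow> real"
  shows "restricted a b (\<lambda>t \<omega>. c \<omega> * \<phi> t \<omega>) = (\<lambda>x. c (snd x) * restricted a b \<phi> x)"
  by (simp add: restricted_def case_prod_unfold mult_ac)

lemma integrable_indicator_snd:
  fixes q :: "real \<times> 'w \<Rightarrow> real"
  assumes "integrable TM q" "G \<in> sets M"
  shows "integrable TM (\<lambda>x. indicator G (snd x) * q x)"
proof -
  have "integrable TM (\<lambda>x. indicator (UNIV \<times> G) x *\<^sub>R q x)"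
    by (rule integrable_mult_indicator) (use assms in auto)
  then show ?thesis by (simp add: indicator_times)
qed

lemma L2_fun_indicator_snd:
  fixes q :: "real \<times> 'w \<Rightarrow> real"
  assumes "L2_fun TM q" "G \<in> sets M"
  shows "L2_fun TM (\<lambda>x. indicator G (snd x) * q x)"
proof -
  have "L2_fun TM (\<lambda>x. indicator (UNIV \<times> G) x *\<^sub>R q x)"
    by (rule L2_fun_indicator) (use assms in auto)
  then show ?thesis by (simp add: indicator_times)
qed

lemma integral_set_integral:
  assumes k: "integrable TM (restricted a b (k :: real \<Rightarrow> 'w \<Rightarrow> real))" and G: "G \<in> sets M"
  shows "integrable M (\<lambda>\<omega>. LINT s:{a..b}|lborel. k s \<omega>)"
    and "(\<integral>\<omega>. indicator G \<omega> * (LINT s:{a..b}|lborel. k s \<omega>) \<partial>M) =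
      (\<integral>x. indicator G (snd x) * restricted a b k x \<partial>TM)"
proof -
  have eq: "(LINT s:{a..b}|lborel. k s \<omega>) = (\<integral>s. restricted a b k (s, \<omega>) \<partial>lborel)" for \<omega>
    by (simp add: set_lebesgue_integral_def restricted_def)
  have i: "integrable TM (\<lambda>(s, \<omega>). restricted a b k (s, \<omega>))"
    "integrable TM (\<lambda>(s, \<omega>). indicator G \<omega> * restricted a b k (s, \<omega>))"
    using k integrable_indicator_snd[OF k G] by (simp_all add: case_prod_unfold)
  show "integrable M (\<lambda>\<omega>. LINT s:{a..b}|lborel. k s \<omega>)"
    unfolding eq by (rule L.integrable_snd[OF i(1)])
  show "(\<integral>\<omega>. indicator G \<omega> * (LINT s:{a..b}|lborel. k s \<omega>) \<partial>M) =
      (\<integral>x. indicator G (snd x) * restricted a b k x \<partial>TM)"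
    using L.integral_snd[OF i(2)] unfolding eq by (simp add: case_prod_unfold)
qed

text \<open>\<open>adapted_on\<close> gives joint measurability on the strip over
  \<open>{a..b}\<close> only. The trace of the product space maps measurably into the product with
  the trace, and extension by 0 then reaches all of \<open>TM\<close>.\<close>

lemma adapted_on_restricted_measurable:
  assumes "adapted_on M F a b \<phi>"
  shows "restricted a b \<phi> \<in> borel_measurable TM"
proof -
  let ?R = "restrict_space TM ({a..b} \<times> space M)"
  have "fst \<in> measurable ?R (restrict_space borel {a..b})"
    by (rule measurable_restrict_space2) (auto simp: space_restrict_space intro: measurable_restrict_space1)
  moreover have "snd \<in> measurable ?R M"
    by (intro measurable_restrict_space1) simp
  ultimately have "(\<lambda>x. (fst x, snd x)) \<in> measurable ?R (restrict_space borel {a..b} \<Otimes>\<^sub>M M)"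
    by (rule measurable_Pair)
  then have "(\<lambda>x. x) \<in> measurable ?R (restrict_space borel {a..b} \<Otimes>\<^sub>M M)"
    by simp
  from measurable_compose[OF this] have "(\<lambda>(t, \<omega>). \<phi> t \<omega>) \<in> borel_measurable ?R"
    using assms by (auto simp: adapted_on_def)
  moreover have "{a..b} \<times> space M \<inter> space TM \<in> sets TM"
    by (rule sets.Int[OF _ sets.top]) auto
  ultimately have *: "(\<lambda>x. indicator ({a..b} \<times> space M) x *\<^sub>R (case x of (t, \<omega>) \<Rightarrow> \<phi> t \<omega>)) \<in> borel_measurable TM"
    by (subst (asm) borel_measurable_restrict_space_iff) auto
  show ?thesis
    by (rule measurable_cong[THEN iffD1, OF _ *])
       (auto simp: restricted_def indicator_def space_pair_measure)
qed

lemma L2_processD: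
  assumes "\<phi> \<in> L2_process M F a b"
  shows "L2_fun TM (restricted a b \<phi>)" and "\<And>t. t \<in> {a..b} \<Longrightarrow> \<phi> t \<in> borel_measurable (F t)"
    and "restricted a b \<phi> \<in> borel_measurable TM"
proof -
  have ad: "adapted_on M F a b \<phi>" using assms by (simp add: L2_process_def)
  show m[measurable]: "restricted a b \<phi> \<in> borel_measurable TM"
    by (rule adapted_on_restricted_measurable[OF ad])
  show "\<And>t. t \<in> {a..b} \<Longrightarrow> \<phi> t \<in> borel_measurable (F t)" using ad by (simp add: adapted_on_def)
  have eq: "ennreal ((norm (\<phi> t \<omega>))\<^sup>2) * indicator {a..b} t = ennreal ((norm (restricted a b \<phi> (t, \<omega>)))\<^sup>2)" for t \<omega>
    by (simp add: restricted_def indicator_def)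
  have "(\<integral>\<^sup>+x. ennreal ((norm (restricted a b \<phi> x))\<^sup>2) \<partial>TM) =
      (\<integral>\<^sup>+\<omega>. (\<integral>\<^sup>+t\<in>{a..b}. ennreal ((norm (\<phi> t \<omega>))\<^sup>2) \<partial>lborel) \<partial>M)"
    unfolding eq by (rule L.nn_integral_snd[symmetric]) measurable
  then show "L2_fun TM (restricted a b \<phi>)"
    using assms m by (simp add: L2_fun_iff_nn_integral L2_process_def)
qed

lemma S2_process_L2_fun:
  assumes "\<phi> \<in> S2_process M F a b" "t \<in> {a..b}"
  shows "L2_fun M (\<phi> t)"
  unfolding L2_fun_iff_nn_integral
proof
  have "\<phi> \<in> L2_process M F a b" using assms by (simp add: S2_process_def)
  then show "\<phi> t \<in> borel_measurable M"
    using L2_processD(2) assms(2) measurable_F_M by blast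
  have "(\<integral>\<^sup>+\<omega>. ennreal ((norm (\<phi> t \<omega>))\<^sup>2) \<partial>M) \<le> (\<integral>\<^sup>+\<omega>. (SUP t\<in>{a..b}. ennreal ((norm (\<phi> t \<omega>))\<^sup>2)) \<partial>M)"
    by (intro nn_integral_mono SUP_upper assms)
  also have "\<dots> < \<infinity>" using assms by (simp add: S2_process_def)
  finally show "(\<integral>\<^sup>+\<omega>. ennreal ((norm (\<phi> t \<omega>))\<^sup>2) \<partial>M) < \<infinity>" .
qed

section \<open>Translation in time\<close>

lemma TM_shift: "distr TM TM (\<lambda>(t, \<omega>). (t - \<theta>, \<omega>)) = TM"
proof -
  have 1: "distr lborel lborel ((+) (- \<theta>)) = (lborel :: real measure)"
    using lborel_distr_plus[of "- \<theta>"] by (metis distr_cong sets_lborel)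
  have 2: "distr M M (\<lambda>x. x) = M" by (simp add: distr_id)
  have "distr lborel lborel ((+) (- \<theta>)) \<Otimes>\<^sub>M distr M M (\<lambda>x. x) =
      distr TM (lborel \<Otimes>\<^sub>M M) (\<lambda>(x, y). (- \<theta> + x, y))"
    by (rule pair_measure_distr) (auto simp: 2 sigma_finite_measure_axioms)
  then show ?thesis unfolding 1 2 by simp
qed

lemma shift_measurable: "(\<lambda>(t, \<omega>). (t - \<theta>, \<omega>)) \<in> measurable TM TM"
  by measurable

lemma integral_TM_shift:
  fixes f :: "real \<times> 'w \<Rightarrow> real"
  assumes "f \<in> borel_measurable TM"
  shows "(\<integral>x. f (fst x - \<theta>, snd x) \<partial>TM) = (\<integral>x. f x \<partial>TM)"
proof -
  have "(\<integral>x. f x \<partial>TM) = (\<integral>x. f x \<partial>distr TM TM (\<lambda>(t, \<omega>). (t - \<theta>, \<omega>)))"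
    by (simp add: TM_shift)
  also have "\<dots> = (\<integral>x. f (case x of (t, \<omega>) \<Rightarrow> (t - \<theta>, \<omega>)) \<partial>TM)"
    by (rule integral_distr[OF shift_measurable assms])
  finally show ?thesis by (simp add: case_prod_unfold)
qed

lemma restricted_shift: "restricted a b (\<lambda>t. \<phi> (t - \<theta>)) x = restricted (a - \<theta>) (b - \<theta>) \<phi> (fst x - \<theta>, snd x)"
  by (auto simp: restricted_def indicator_def case_prod_unfold)

lemma restricted_shift_measurable:
  assumes "restricted (a - \<theta>) (b - \<theta>) \<phi> \<in> borel_measurable TM"
  shows "restricted a b (\<lambda>t. \<phi> (t - \<theta>)) \<in> borel_measurable TM"
  using measurable_compose[OF shift_measurable assms, of \<theta>]
  by (subst restricted_shift[abs_def]) (simp add: case_prod_unfold)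

lemma L2_fun_restricted_shift:
  assumes \<phi>: "L2_fun TM (restricted (a - \<theta>) (b - \<theta>) \<phi>)"
  shows "L2_fun TM (restricted a b (\<lambda>t. \<phi> (t - \<theta>)))"
  unfolding L2_fun_def
proof
  show "restricted a b (\<lambda>t. \<phi> (t - \<theta>)) \<in> borel_measurable TM"
    by (rule restricted_shift_measurable[OF L2_fun_measurable[OF \<phi>]])
  have "integrable (distr TM TM (\<lambda>(t, \<omega>). (t - \<theta>, \<omega>))) (\<lambda>x. (norm (restricted (a - \<theta>) (b - \<theta>) \<phi> x))\<^sup>2)"
    using \<phi> by (simp add: TM_shift L2_fun_def)
  from integrable_distr[OF shift_measurable this]
  show "integrable TM (\<lambda>x. (norm (restricted a b (\<lambda>t. \<phi> (t - \<theta>)) x))\<^sup>2)"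
    by (simp add: restricted_shift case_prod_unfold)
qed

lemma set_integral_restricted:
  assumes "r \<in> {t..T}"
  shows "(LINT s:{r..T}|lborel. f s \<omega>) = tail_integral (restricted t T f) r \<omega>"
  unfolding set_lebesgue_integral_def tail_integral_def
  by (rule Bochner_Integration.integral_cong[OF refl])
     (use assms in \<open>auto simp: restricted_def indicator_def\<close>)

text \<open>The prescribed values of \<open>X\<close>, \<open>Y\<close> and \<open>Z\<close> hold
  almost surely at single times, with exceptional events that vary with the time. Fubini's theorem
  lets them be used in this form, without one null set in the product space.\<close>

lemma integral_TM_eq_0:
  fixes q :: "real \<times> 'w \<Rightarrow> real"
  assumes q: "integrable TM q" and z: "AE r in lborel. AE \<omega> in M. q (r, \<omega>) = 0"
  shows "(\<integral>x. q x \<partial>TM) = 0"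
proof -
  have "AE r in lborel. (\<integral>\<omega>. q (r, \<omega>) \<partial>M) = 0"
    using z by eventually_elim (rule integral_eq_zero_AE)
  then have "(\<integral>r. (\<integral>\<omega>. q (r, \<omega>) \<partial>M) \<partial>lborel) = 0"
    by (rule integral_eq_zero_AE)
  then show ?thesis unfolding L.integral_fst'[OF q] .
qed

section \<open>Conditional expectations along a process\<close>

lemma cond_exp_square_le:
  fixes f :: "'w \<Rightarrow> real"
  assumes f: "L2_fun M f"
  shows "(\<integral>\<^sup>+\<omega>. ennreal ((real_cond_exp M (F t) f \<omega>)\<^sup>2) \<partial>M) \<le> (\<integral>\<^sup>+\<omega>. ennreal ((f \<omega>)\<^sup>2) \<partial>M)"
proof -
  interpret S: sigma_finite_subalgebra M "F t" by (rule sigma_finite_subalgebra_F)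
  have i: "integrable M f" and i2: "integrable M (\<lambda>\<omega>. (f \<omega>)\<^sup>2)"
    using f L2_fun_imp_integrable[OF f] by (auto simp: L2_fun_def)
  have "AE \<omega> in M. (real_cond_exp M (F t) f \<omega>)\<^sup>2 \<le> real_cond_exp M (F t) (\<lambda>\<omega>. (f \<omega>)\<^sup>2) \<omega>"
    by (rule S.real_cond_exp_jensens_inequality(2)[where I = UNIV and q = "\<lambda>x. x\<^sup>2"])
       (use i i2 convex_power2 in auto)
  moreover from this have pos: "AE \<omega> in M. 0 \<le> real_cond_exp M (F t) (\<lambda>\<omega>. (f \<omega>)\<^sup>2) \<omega>"
    by eventually_elim (rule order_trans[OF zero_le_power2])
  ultimately have "(\<integral>\<^sup>+\<omega>. ennreal ((real_cond_exp M (F t) f \<omega>)\<^sup>2) \<partial>M) \<le>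
      (\<integral>\<^sup>+\<omega>. ennreal (real_cond_exp M (F t) (\<lambda>\<omega>. (f \<omega>)\<^sup>2) \<omega>) \<partial>M)"
    by (intro nn_integral_mono_AE) (auto intro: ennreal_leI)
  also have "\<dots> = ennreal (\<integral>\<omega>. real_cond_exp M (F t) (\<lambda>\<omega>. (f \<omega>)\<^sup>2) \<omega> \<partial>M)"
    by (rule nn_integral_eq_integral[OF S.real_cond_exp_int(1)[OF i2] pos])
  also have "\<dots> = (\<integral>\<^sup>+\<omega>. ennreal ((f \<omega>)\<^sup>2) \<partial>M)"
    unfolding S.real_cond_exp_int(2)[OF i2] by (rule nn_integral_eq_integral[symmetric]) (auto intro: i2)
  finally show ?thesis .
qed

text \<open>Jensen's inequality at almost every time makes the measurable version \<open>U\<close>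
  square integrable. With all products integrable, the defining property of the conditional
  expectation can then be integrated over time against an adapted \<open>H\<close>.\<close>

lemma cond_exp_process_real:
  fixes \<phi> U :: "real \<Rightarrow> 'w \<Rightarrow> real"
  assumes U: "restricted a b U \<in> borel_measurable TM"
    and ce: "AE t in lborel. t \<in> {a..b} \<longrightarrow> (AE \<omega> in M. U t \<omega> = real_cond_exp M (F t) (\<phi> t) \<omega>)"
    and \<phi>: "L2_fun TM (restricted a b \<phi>)"
  shows "L2_fun TM (restricted a b U)"
    and "L2_fun TM (restricted a b H) \<Longrightarrow> (\<And>t. t \<in> {a..b} \<Longrightarrow> H t \<in> borel_measurable (F t)) \<Longrightarrow>
      (\<integral>x. restricted a b H x * restricted a b U x \<partial>TM) = (\<integral>x. restricted a b H x * restricted a b \<phi> x \<partial>TM)"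
proof -
  note [measurable] = U L2_fun_measurable[OF \<phi>]
  have Um: "U t \<in> borel_measurable M" if "t \<in> {a..b}" for t
    using section_measurable(1)[OF U, of t] that by (simp add: restricted_def)
  have "(\<integral>\<^sup>+x. ennreal ((norm (restricted a b U x))\<^sup>2) \<partial>TM) =
      (\<integral>\<^sup>+t. \<integral>\<^sup>+\<omega>. ennreal ((norm (restricted a b U (t, \<omega>)))\<^sup>2) \<partial>M \<partial>lborel)"
    by (rule nn_integral_fst[symmetric]) measurable
  also have "\<dots> \<le> (\<integral>\<^sup>+t. \<integral>\<^sup>+\<omega>. ennreal ((norm (restricted a b \<phi> (t, \<omega>)))\<^sup>2) \<partial>M \<partial>lborel)"
  proof (rule nn_integral_mono_AE)
    show "AE t in lborel. (\<integral>\<^sup>+\<omega>. ennreal ((norm (restricted a b U (t, \<omega>)))\<^sup>2) \<partial>M) \<le>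
        (\<integral>\<^sup>+\<omega>. ennreal ((norm (restricted a b \<phi> (t, \<omega>)))\<^sup>2) \<partial>M)"
      using ce L2_fun_sections(1)[OF \<phi>]
    proof eventually_elim
      case (elim t)
      show ?case
      proof (cases "t \<in> {a..b}")
        case True
        then have f: "L2_fun M (\<phi> t)" and ae: "AE \<omega> in M. U t \<omega> = real_cond_exp M (F t) (\<phi> t) \<omega>"
          using elim by (auto simp: restricted_def)
        have "(\<integral>\<^sup>+\<omega>. ennreal ((U t \<omega>)\<^sup>2) \<partial>M) = (\<integral>\<^sup>+\<omega>. ennreal ((real_cond_exp M (F t) (\<phi> t) \<omega>)\<^sup>2) \<partial>M)"
          by (rule nn_integral_cong_AE) (use ae in eventually_elim, simp)
        with cond_exp_square_le[OF f, of t] show ?thesis using True by (simp add: restricted_def)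
      qed (simp add: restricted_def)
    qed
  qed
  also have "\<dots> = (\<integral>\<^sup>+x. ennreal ((norm (restricted a b \<phi> x))\<^sup>2) \<partial>TM)"
    by (rule nn_integral_fst) measurable
  also have "\<dots> < \<infinity>" using \<phi> by (simp add: L2_fun_iff_nn_integral)
  finally show Usq: "L2_fun TM (restricted a b U)"
    by (simp add: L2_fun_iff_nn_integral)
  assume H: "L2_fun TM (restricted a b H)" "\<And>t. t \<in> {a..b} \<Longrightarrow> H t \<in> borel_measurable (F t)"
  note i = L2_fun_mult[OF H(1) Usq] L2_fun_mult[OF H(1) \<phi>]
  have "AE t in lborel. (\<integral>\<omega>. restricted a b H (t, \<omega>) * restricted a b U (t, \<omega>) \<partial>M) =
      (\<integral>\<omega>. restricted a b H (t, \<omega>) * restricted a b \<phi> (t, \<omega>) \<partial>M)"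
    using ce L2_fun_sections(1)[OF \<phi>] L2_fun_sections(1)[OF H(1)]
  proof eventually_elim
    case (elim t)
    show ?case
    proof (cases "t \<in> {a..b}")
      case True
      then have f: "L2_fun M (\<phi> t)" and h: "L2_fun M (H t)"
        and ae: "AE \<omega> in M. U t \<omega> = real_cond_exp M (F t) (\<phi> t) \<omega>"
        using elim by (auto simp: restricted_def)
      interpret S: sigma_finite_subalgebra M "F t" by (rule sigma_finite_subalgebra_F)
      have "(\<integral>\<omega>. H t \<omega> * U t \<omega> \<partial>M) = (\<integral>\<omega>. H t \<omega> * real_cond_exp M (F t) (\<phi> t) \<omega> \<partial>M)"
        by (rule integral_cong_AE)
           (use ae Um[OF True] L2_fun_measurable[OF h] in \<open>auto intro!: borel_measurable_times\<close>)
      also have "\<dots> = (\<integral>\<omega>. H t \<omega> * \<phi> t \<omega> \<partial>M)"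
        by (rule S.real_cond_exp_intg(2)[OF L2_fun_mult[OF h f] H(2)[OF True]
            L2_fun_measurable[OF f]])
      finally show ?thesis using True by (simp add: restricted_def)
    qed (simp add: restricted_def)
  qed
  then have "(\<integral>t. (\<integral>\<omega>. restricted a b H (t, \<omega>) * restricted a b U (t, \<omega>) \<partial>M) \<partial>lborel) =
      (\<integral>t. (\<integral>\<omega>. restricted a b H (t, \<omega>) * restricted a b \<phi> (t, \<omega>) \<partial>M) \<partial>lborel)"
    by (intro integral_cong_AE borel_measurable_integrable[OF L.integrable_fst'[OF i(1)]]
        borel_measurable_integrable[OF L.integrable_fst'[OF i(2)]])
  then show "(\<integral>x. restricted a b H x * restricted a b U x \<partial>TM) = (\<integral>x. restricted a b H x * restricted a b \<phi> x \<partial>TM)"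
    unfolding L.integral_fst'[OF i(1)] L.integral_fst'[OF i(2)] .
qed

text \<open>Reduction to the real case along the basis, in which the conditional expectation, the
  inner product and the process itself are all expanded.\<close>

lemma cond_exp_processD:
  fixes \<phi> U :: "real \<Rightarrow> 'w \<Rightarrow> 'b::euclidean_space"
  assumes ce: "cond_exp_process M F c d \<phi> U" and sub: "{a..b} \<subseteq> {c..d}"
    and \<phi>: "L2_fun TM (restricted a b \<phi>)"
  shows "L2_fun TM (restricted a b U)"
    and "\<And>t. t \<in> {a..b} \<Longrightarrow> U t \<in> borel_measurable (F t)"
    and "L2_fun TM (restricted a b H) \<Longrightarrow> (\<And>t. t \<in> {a..b} \<Longrightarrow> H t \<in> borel_measurable (F t)) \<Longrightarrow>
      (\<integral>x. restricted a b H x \<bullet> restricted a b U x \<partial>TM) = (\<integral>x. restricted a b H x \<bullet> restricted a b \<phi> x \<partial>TM)"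
proof -
  have ad: "adapted_on M F c d U" using ce by (simp add: cond_exp_process_def)
  note m = restricted_measurable_subset[OF sub adapted_on_restricted_measurable[OF ad]]
  show "\<And>t. t \<in> {a..b} \<Longrightarrow> U t \<in> borel_measurable (F t)" using ad sub unfolding adapted_on_def by blast
  have comp: "restricted a b (\<lambda>t \<omega>. \<psi> t \<omega> \<bullet> e) = (\<lambda>x. restricted a b \<psi> x \<bullet> e)" for \<psi> :: "real \<Rightarrow> 'w \<Rightarrow> 'b" and e
    by (auto simp: restricted_def)
  have sq: "L2_fun TM (restricted a b (\<lambda>t \<omega>. \<psi> t \<omega> \<bullet> e))"
    if "L2_fun TM (restricted a b \<psi>)" for \<psi> :: "real \<Rightarrow> 'w \<Rightarrow> 'b" and e
  proof (rule L2_fun_bound[OF that, of _ "norm e"])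
    show "restricted a b (\<lambda>t \<omega>. \<psi> t \<omega> \<bullet> e) \<in> borel_measurable TM"
      unfolding comp using L2_fun_measurable[OF that] by measurable
    show "AE x in TM. norm (restricted a b (\<lambda>t \<omega>. \<psi> t \<omega> \<bullet> e) x) \<le> norm e * norm (restricted a b \<psi> x)"
      unfolding comp by (intro AE_I2) (metis Cauchy_Schwarz_ineq2 mult.commute real_norm_def)
  qed
  have Um: "restricted a b (\<lambda>t \<omega>. U t \<omega> \<bullet> e) \<in> borel_measurable TM" for e
    unfolding comp using m by measurable
  have cee: "AE t in lborel. t \<in> {a..b} \<longrightarrow>
      (AE \<omega> in M. U t \<omega> \<bullet> e = real_cond_exp M (F t) (\<lambda>\<omega>. \<phi> t \<omega> \<bullet> e) \<omega>)" if "e \<in> Basis" for e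
  proof -
    have "AE t in lborel. t \<in> {c..d} \<longrightarrow> (AE \<omega> in M. \<forall>e\<in>Basis. U t \<omega> \<bullet> e = real_cond_exp M (F t) (\<lambda>\<omega>'. \<phi> t \<omega>' \<bullet> e) \<omega>)"
      using ce by (simp add: cond_exp_process_def)
    then show ?thesis
      by eventually_elim (use that sub in \<open>auto elim!: eventually_mono\<close>)
  qed
  note real = cond_exp_process_real[OF Um cee sq[OF \<phi>]]
  show Usq: "L2_fun TM (restricted a b U)"
  proof -
    have "L2_fun TM (\<lambda>x. \<Sum>e\<in>Basis. restricted a b (\<lambda>t \<omega>. U t \<omega> \<bullet> e) x *\<^sub>R e)"
    proof (rule L2_fun_sum)
      fix e :: 'b assume e: "e \<in> Basis"
      show "L2_fun TM (\<lambda>x. restricted a b (\<lambda>t \<omega>. U t \<omega> \<bullet> e) x *\<^sub>R e)"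
        by (rule L2_fun_bound[OF real(1)[OF e], of _ 1]) (use Um[of e] e in auto)
    qed
    then show ?thesis by (simp add: comp euclidean_representation)
  qed
  assume H: "L2_fun TM (restricted a b H)" "\<And>t. t \<in> {a..b} \<Longrightarrow> H t \<in> borel_measurable (F t)"
  have expand: "(\<integral>x. restricted a b H x \<bullet> restricted a b \<psi> x \<partial>TM) =
    (\<Sum>e\<in>Basis. \<integral>x. restricted a b (\<lambda>t \<omega>. H t \<omega> \<bullet> e) x * restricted a b (\<lambda>t \<omega>. \<psi> t \<omega> \<bullet> e) x \<partial>TM)"
    if "L2_fun TM (restricted a b \<psi>)" for \<psi>
    using L2_fun_mult[OF sq[OF H(1)] sq[OF that]]
    by (subst Bochner_Integration.integral_sum[symmetric]) (auto simp: comp euclidean_inner[symmetric])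
  show "(\<integral>x. restricted a b H x \<bullet> restricted a b U x \<partial>TM) = (\<integral>x. restricted a b H x \<bullet> restricted a b \<phi> x \<partial>TM)"
    unfolding expand[OF Usq] expand[OF \<phi>]
  proof (rule sum.cong[OF refl])
    fix e :: 'b assume e: "e \<in> Basis"
    show "(\<integral>x. restricted a b (\<lambda>t \<omega>. H t \<omega> \<bullet> e) x * restricted a b (\<lambda>t \<omega>. U t \<omega> \<bullet> e) x \<partial>TM) =
      (\<integral>x. restricted a b (\<lambda>t \<omega>. H t \<omega> \<bullet> e) x * restricted a b (\<lambda>t \<omega>. \<phi> t \<omega> \<bullet> e) x \<partial>TM)"
      by (rule real(2)[OF e sq[OF H(1)]]) (use H(2) in measurable)
  qed
qed

section \<open>The representation formula\<close>

text \<open>Two adjustments lead to \<open>expectation_product\<close>. The forward equation, taken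
  at \<open>T\<close> and at \<open>r\<close> and subtracted, becomes an equation with the terminal
  value. The indicator of \<open>G\<close> is attached to \<open>X\<close>; being known at time
  \<open>t\<close>, it respects adaptedness and orthogonality. The isometry then evaluates the
  product of the martingale parts.\<close>

lemma semimartingale_product:
  fixes a f X Y :: "real \<Rightarrow> 'w \<Rightarrow> real" and b Z :: "real \<Rightarrow> 'w \<Rightarrow> real^'d"
  assumes t: "0 \<le> t" "t \<le> T" and G: "G \<in> sets (F t)"
    and a: "L2_fun TM (restricted t T a)" "\<And>r. r \<in> {t..T} \<Longrightarrow> a r \<in> borel_measurable (F r)"
    and f: "L2_fun TM (restricted t T f)" "\<And>r. r \<in> {t..T} \<Longrightarrow> f r \<in> borel_measurable (F r)"
    and b: "L2_fun TM (restricted t T b)" and Z: "L2_fun TM (restricted t T Z)"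
    and X: "L2_fun TM (restricted t T X)" "L2_fun M (X T)"
      "X t \<in> borel_measurable (F t)" "L2_fun M (X t)"
    and Y: "L2_fun TM (restricted t T Y)" "L2_fun M (Y T)"
      "Y t \<in> borel_measurable (F t)" "L2_fun M (Y t)"
    and eqX: "\<And>r. r \<in> {t..T} \<Longrightarrow> \<exists>I. has_ito_integral M F W t r b I \<and>
      (AE \<omega> in M. X r \<omega> = X t \<omega> + (LINT s:{t..r}|lborel. a s \<omega>) + I \<omega>)"
    and eqY: "\<And>r. r \<in> {t..T} \<Longrightarrow> \<exists>I. has_ito_integral M F W r T Z I \<and>
      (AE \<omega> in M. Y r \<omega> = Y T \<omega> + (LINT s:{r..T}|lborel. f s \<omega>) - I \<omega>)"
  shows "(\<integral>\<omega>. indicator G \<omega> * (X T \<omega> * Y T \<omega>) \<partial>M) - (\<integral>\<omega>. indicator G \<omega> * (X t \<omega> * Y t \<omega>) \<partial>M) =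
    (\<integral>x. indicator G (snd x) * (restricted t T a x * restricted t T Y x - restricted t T f x * restricted t T X x
      + restricted t T b x \<bullet> restricted t T Z x) \<partial>TM)"
proof -
  have GM[measurable]: "G \<in> sets M" using G subalgebra_F[of t] by (auto simp: subalgebra_def)
  have Gm: "(indicator G :: 'w \<Rightarrow> real) \<in> borel_measurable (F r)" if "t \<le> r" for r
    using F_mono[OF that] G by (intro borel_measurable_indicator) auto
  obtain I where I: "\<And>r. r \<in> {t..T} \<Longrightarrow> has_ito_integral M F W r T Z (I r)"
    "\<And>r. r \<in> {t..T} \<Longrightarrow> AE \<omega> in M. Y r \<omega> = Y T \<omega> + (LINT s:{r..T}|lborel. f s \<omega>) - I r \<omega>"
    using eqY by metis
  obtain J0 where J0: "\<And>r. r \<in> {t..T} \<Longrightarrow> has_ito_integral M F W t r b (J0 r)"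
    "\<And>r. r \<in> {t..T} \<Longrightarrow> AE \<omega> in M. X r \<omega> = X t \<omega> + (LINT s:{t..r}|lborel. a s \<omega>) + J0 r \<omega>"
    using eqX by metis
  have tT: "t \<in> {t..T}" "T \<in> {t..T}" using t by auto
  have I2: "L2_fun M (I r)" if "r \<in> {t..T}" for r
    by (rule ito_integral_L2_fun[OF I(1)[OF that]])
       (use that t L2_fun_restricted_subset[OF _ Z, of r T] in auto)
  have I0: "(\<integral>\<omega>. H \<omega> * I r \<omega> \<partial>M) = 0"
    if "r \<in> {t..T}" "H \<in> borel_measurable (F r)" "L2_fun M H" for r H
    by (rule ito_integral_mean_zero[OF I(1)[OF that(1)] _ _ that(2,3)])
       (use that t L2_fun_restricted_subset[OF _ Z, of r T] in auto)
  have J02: "L2_fun M (J0 r)" if "r \<in> {t..T}" for r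
    by (rule ito_integral_L2_fun[OF J0(1)[OF that]])
       (use that t L2_fun_restricted_subset[OF _ b, of t r] in auto)
  \<comment> \<open>The integrals up to \<open>T\<close> and up to \<open>r\<close> come from
    separate existence claims; the martingale property is what relates them.\<close>
  have J00: "(\<integral>\<omega>. H \<omega> * (J0 T \<omega> - J0 r \<omega>) \<partial>M) = 0"
    if "r \<in> {t..T}" "H \<in> borel_measurable (F r)" "L2_fun M H" for r H
    by (rule ito_integral_martingale[OF J0(1)[OF tT(2)] J0(1)[OF that(1)] _ _ _ b that(2,3)])
       (use that t in auto)
  have indM: "L2_fun M (\<lambda>\<omega>. indicator G \<omega> * h \<omega>)" if "L2_fun M h" for h :: "'w \<Rightarrow> real"
    using L2_fun_indicator[OF that GM] by simp
  \<comment> \<open>Solved for the terminal value, the backward equation has its drift with the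
    opposite sign.\<close>
  define g where "g r \<omega> = - f r \<omega>" for r \<omega>
  define a' where "a' r \<omega> = indicator G \<omega> * a r \<omega>" for r \<omega>
  define X' where "X' r \<omega> = indicator G \<omega> * X r \<omega>" for r \<omega>
  define J where "J r \<omega> = indicator G \<omega> * (J0 T \<omega> - J0 r \<omega>)" for r \<omega>
  have ra': "restricted t T a' = (\<lambda>x. indicator G (snd x) * restricted t T a x)"
    unfolding a'_def[abs_def] by (rule restricted_const_mult)
  have rX': "restricted t T X' = (\<lambda>x. indicator G (snd x) * restricted t T X x)"
    unfolding X'_def[abs_def] by (rule restricted_const_mult)
  have rg: "restricted t T g = (\<lambda>x. - restricted t T f x)"
    unfolding g_def[abs_def] by (rule ext, rule restricted_uminus)
  have g: "L2_fun TM (restricted t T g)"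
    unfolding g_def[abs_def] by (rule L2_fun_restricted_uminus[OF f(1)])
  have a'sq: "L2_fun TM (restricted t T a')"
    unfolding ra' by (rule L2_fun_indicator_snd[OF a(1) GM])
  have X'sq: "L2_fun TM (restricted t T X')"
    unfolding rX' by (rule L2_fun_indicator_snd[OF X(1) GM])
  have eqX': "AE \<omega> in M. X' T \<omega> = X' r \<omega> + tail_integral (restricted t T a') r \<omega> + J r \<omega>"
    if r: "r \<in> {t..T}" for r
    using J0(2)[OF r] J0(2)[OF tT(2)] L2_fun_sections(2)[OF a(1)]
  proof eventually_elim
    case (elim \<omega>)
    let ?v = "\<lambda>s. restricted t T a (s, \<omega>)"
    have "(LINT s:{t..r}|lborel. a s \<omega>) = (\<integral>s. indicator {..r} s * ?v s \<partial>lborel)"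
      unfolding set_lebesgue_integral_def
      by (rule Bochner_Integration.integral_cong[OF refl]) (use r in \<open>auto simp: restricted_def indicator_def\<close>)
    moreover have "(LINT s:{t..T}|lborel. a s \<omega>) = (\<integral>s. ?v s \<partial>lborel)"
      by (simp add: set_lebesgue_integral_def restricted_def)
    moreover have "(\<integral>s. indicator {r..} s * ?v s \<partial>lborel) + (\<integral>s. indicator {..r} s * ?v s \<partial>lborel) = (\<integral>s. ?v s \<partial>lborel)"
      by (rule integral_split_at[OF integrable_restricted_path[OF elim(3)]])
    ultimately have "X T \<omega> = X r \<omega> + tail_integral (restricted t T a) r \<omega> + (J0 T \<omega> - J0 r \<omega>)"
      using elim(1,2) by (simp add: tail_integral_def)
    moreover have "tail_integral (restricted t T a') r \<omega> = indicator G \<omega> * tail_integral (restricted t T a) r \<omega>"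
      unfolding tail_integral_def ra'
      by (subst integral_mult_right_zero[symmetric]) (simp add: mult_ac)
    ultimately show ?case by (simp only: X'_def J_def distrib_left)
  qed
  have eqY': "AE \<omega> in M. Y T \<omega> = Y r \<omega> + tail_integral (restricted t T g) r \<omega> + I r \<omega>"
    if r: "r \<in> {t..T}" for r
    using I(2)[OF r]
  proof eventually_elim
    case (elim \<omega>)
    then show ?case
      unfolding set_integral_restricted[OF r] by (simp add: rg tail_integral_def)
  qed
  have "(\<integral>\<omega>. X' T \<omega> * Y T \<omega> \<partial>M) - (\<integral>\<omega>. X' t \<omega> * Y t \<omega> \<partial>M) =
    (\<integral>x. restricted t T a' x * restricted t T Y x \<partial>TM) +
    (\<integral>x. restricted t T g x * restricted t T X' x \<partial>TM) + (\<integral>\<omega>. J t \<omega> * I t \<omega> \<partial>M)"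
  proof (rule expectation_product[OF t(2) a'sq _ g _ X'sq _ _ _ Y eqX' eqY' _ _ I2 I0])
    fix r assume r: "r \<in> {t..T}"
    have [measurable]: "(indicator G :: 'w \<Rightarrow> real) \<in> borel_measurable (F r)" using Gm r by simp
    show "a' r \<in> borel_measurable (F r)"
      unfolding a'_def using a(2)[OF r] by measurable
    show "g r \<in> borel_measurable (F r)"
      unfolding g_def using f(2)[OF r] by measurable
    show "L2_fun M (J r)"
      unfolding J_def by (intro indM L2_fun_diff J02 r tT)
    fix H :: "'w \<Rightarrow> real" assume H: "H \<in> borel_measurable (F r)" "L2_fun M H"
    \<comment> \<open>The indicator moves from \<open>J\<close> to the test function, which stays
      measurable at time \<open>r\<close>.\<close>
    have "(\<lambda>\<omega>. indicator G \<omega> * H \<omega>) \<in> borel_measurable (F r)" using H(1) by measurable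
    from J00[OF r this indM[OF H(2)]]
    show "(\<integral>\<omega>. H \<omega> * J r \<omega> \<partial>M) = 0" by (simp add: J_def mult_ac)
  next
    show "L2_fun M (X' T)" "L2_fun M (X' t)"
      unfolding X'_def by (intro indM X)+
    show "X' t \<in> borel_measurable (F t)"
      unfolding X'_def using Gm[of t] X(3) by (intro borel_measurable_times) auto
  qed
  also have "(\<integral>\<omega>. J t \<omega> * I t \<omega> \<partial>M) = (\<integral>\<omega>. indicator G \<omega> * (J0 T \<omega> * I t \<omega>) \<partial>M)"
  proof (rule integral_cong_AE)
    \<comment> \<open>At \<open>r = t\<close> the time integral extends over a single point, so the
      equation itself forces this stochastic integral to vanish.\<close>
    have "AE \<omega> in M. J0 t \<omega> = 0"
      using J0(2)[OF tT(1)]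
    proof eventually_elim
      case (elim \<omega>)
      have "(LINT s:{t..t}|lborel. a s \<omega>) = 0"
        unfolding set_lebesgue_integral_def
        by (rule integral_eq_zero_AE) (use AE_lborel_singleton[of t] in \<open>eventually_elim, auto\<close>)
      with elim show ?case by simp
    qed
    then show "AE \<omega> in M. J t \<omega> * I t \<omega> = indicator G \<omega> * (J0 T \<omega> * I t \<omega>)"
      by eventually_elim (simp add: J_def)
    have [measurable]: "J0 T \<in> borel_measurable M" "J0 t \<in> borel_measurable M" "I t \<in> borel_measurable M"
      using J02[OF tT(2)] J02[OF tT(1)] I2[OF tT(1)] by (auto intro: L2_fun_measurable)
    show "(\<lambda>\<omega>. J t \<omega> * I t \<omega>) \<in> borel_measurable M" unfolding J_def by measurable
    show "(\<lambda>\<omega>. indicator G \<omega> * (J0 T \<omega> * I t \<omega>)) \<in> borel_measurable M" by measurable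
  qed
  also have "\<dots> = (\<integral>x. indicator G (snd x) * (restricted t T b x \<bullet> restricted t T Z x) \<partial>TM)"
    by (rule ito_integral_isometry[OF J0(1)[OF tT(2)] I(1)[OF tT(1)] t(1) b Z Gm[OF order_refl], of 1])
       (auto simp: indicator_def)
  finally have "(\<integral>\<omega>. indicator G \<omega> * (X T \<omega> * Y T \<omega>) \<partial>M) - (\<integral>\<omega>. indicator G \<omega> * (X t \<omega> * Y t \<omega>) \<partial>M) =
    (\<integral>x. indicator G (snd x) * (restricted t T a x * restricted t T Y x) \<partial>TM) +
    (\<integral>x. indicator G (snd x) * - (restricted t T f x * restricted t T X x) \<partial>TM) +
    (\<integral>x. indicator G (snd x) * (restricted t T b x \<bullet> restricted t T Z x) \<partial>TM)"
    unfolding ra' rX' rg unfolding X'_def by (simp add: mult_ac)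
  also have "\<dots> = (\<integral>x. indicator G (snd x) * (restricted t T a x * restricted t T Y x) +
      indicator G (snd x) * - (restricted t T f x * restricted t T X x) +
      indicator G (snd x) * (restricted t T b x \<bullet> restricted t T Z x) \<partial>TM)"
  proof -
    note i = integrable_indicator_snd[OF L2_fun_mult[OF a(1) Y(1)] GM]
      integrable_indicator_snd[OF integrable_minus[OF L2_fun_mult[OF f(1) X(1)]] GM]
      integrable_indicator_snd[OF L2_fun_inner[OF b Z] GM]
    show ?thesis
      unfolding Bochner_Integration.integral_add[OF Bochner_Integration.integrable_add[OF i(1,2)] i(3)]
        Bochner_Integration.integral_add[OF i(1,2)] ..
  qed
  finally show ?thesis by (simp add: algebra_simps)
qed

lemma uniformly_boundedE:
  assumes "uniformly_bounded M a b \<phi>"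
  obtains C where "\<And>t \<omega>. t \<in> {a..b} \<Longrightarrow> \<omega> \<in> space M \<Longrightarrow> norm (\<phi> t \<omega>) \<le> C"
  using assms unfolding uniformly_bounded_def by blast

lemma integral_cond_exp_shift:
  assumes ce: "cond_exp_process M F c d (\<lambda>r. \<phi> (r + \<theta>)) U" and sub: "{t..T} \<subseteq> {c..d}"
    and \<phi>: "L2_fun TM (restricted (t + \<theta>) (T + \<theta>) (\<phi> :: real \<Rightarrow> 'w \<Rightarrow> 'b::euclidean_space))"
    and H: "L2_fun TM (restricted t T H)" "\<And>r. r \<in> {t..T} \<Longrightarrow> H r \<in> borel_measurable (F r)"
    and G: "G \<in> sets (F t)"
  shows "(\<integral>x. indicator G (snd x) * (restricted t T H x \<bullet> restricted t T U x) \<partial>TM) =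
    (\<integral>x. indicator G (snd x) * restricted (t + \<theta>) (T + \<theta>) (\<lambda>r \<omega>. H (r - \<theta>) \<omega> \<bullet> \<phi> r \<omega>) x \<partial>TM)"
proof -
  have GM[measurable]: "G \<in> sets M" using G subalgebra_F[of t] by (auto simp: subalgebra_def)
  define H' where "H' r \<omega> = (indicator G \<omega> :: real) *\<^sub>R H r \<omega>" for r \<omega>
  have rH': "restricted t T H' x = indicator G (snd x) *\<^sub>R restricted t T H x" for x
    by (simp add: H'_def restricted_def case_prod_unfold mult.commute)
  have \<phi>': "L2_fun TM (restricted t T (\<lambda>r. \<phi> (r + \<theta>)))"
    using L2_fun_restricted_shift[of t "- \<theta>" T \<phi>] \<phi> by simp
  have "L2_fun TM (\<lambda>x. indicator G (snd x) *\<^sub>R restricted t T H x)"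
    by (rule L2_fun_scaleR[OF H(1), of _ 1]) (auto simp: indicator_def)
  then have H'sq: "L2_fun TM (restricted t T H')"
    by (simp only: rH'[abs_def])
  have H'm: "H' r \<in> borel_measurable (F r)" if "r \<in> {t..T}" for r
  proof -
    have [measurable]: "G \<in> sets (F r)" using F_mono[of t r] G that by auto
    show ?thesis unfolding H'_def using H(2)[OF that] by measurable
  qed
  let ?k = "\<lambda>r \<omega>. H (r - \<theta>) \<omega> \<bullet> \<phi> r \<omega>"
  have Hd: "L2_fun TM (restricted (t + \<theta>) (T + \<theta>) (\<lambda>r. H (r - \<theta>)))"
    by (rule L2_fun_restricted_shift) (simp add: H)
  have k: "restricted (t + \<theta>) (T + \<theta>) ?k \<in> borel_measurable TM"
    using L2_fun_inner[OF Hd \<phi>]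
    by (subst restricted_inner[abs_def]) (rule borel_measurable_integrable)
  have "(\<integral>x. indicator G (snd x) * (restricted t T H x \<bullet> restricted t T U x) \<partial>TM) =
      (\<integral>x. restricted t T H' x \<bullet> restricted t T U x \<partial>TM)"
    by (simp add: rH')
  also have "\<dots> = (\<integral>x. restricted t T H' x \<bullet> restricted t T (\<lambda>r. \<phi> (r + \<theta>)) x \<partial>TM)"
    by (rule cond_exp_processD(3)[OF ce sub \<phi>' H'sq H'm])
  also have "\<dots> = (\<integral>x. indicator G (snd x) * restricted (t + \<theta>) (T + \<theta>) ?k (fst x + \<theta>, snd x) \<partial>TM)"
    by (rule Bochner_Integration.integral_cong[OF refl])
       (auto simp: H'_def restricted_def case_prod_unfold indicator_def)
  \<comment> \<open>The translation lemma subtracts its parameter, hence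
    \<open>- \<theta>\<close>.\<close>
  also have "\<dots> = (\<integral>x. indicator G (snd x) * restricted (t + \<theta>) (T + \<theta>) ?k x \<partial>TM)"
    using integral_TM_shift[of "\<lambda>x. indicator G (snd x) * restricted (t + \<theta>) (T + \<theta>) ?k x" "- \<theta>"] k
    by simp
  finally show ?thesis .
qed

text \<open>The value \<open>X t = 1\<close> turns an identity for the product of \<open>X\<close>
  and \<open>Y\<close> into one for \<open>Y t\<close>. It is tested on all events of
  \<open>F t\<close>, which identifies the conditional expectation at each individual
  \<open>t\<close>.\<close>

lemma anticipated_bsde_representation:
  fixes \<mu> \<mu>' l Q Y X :: "real \<Rightarrow> 'w \<Rightarrow> real" and \<sigma> \<sigma>' P Z :: "real \<Rightarrow> 'w \<Rightarrow> real ^ 'd"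
  assumes times: "0 \<le> t0" "\<theta> > 0"
    and \<mu>: "\<mu> \<in> L2_process M F (t0 - \<theta>) (T + \<theta>)" and \<mu>': "\<mu>' \<in> L2_process M F (t0 - \<theta>) (T + \<theta>)"
    and l: "l \<in> L2_process M F t0 T"
    and \<sigma>: "\<sigma> \<in> L2_process M F (t0 - \<theta>) (T + \<theta>)" and \<sigma>': "\<sigma>' \<in> L2_process M F (t0 - \<theta>) (T + \<theta>)"
    and bounded: "uniformly_bounded M (t0 - \<theta>) (T + \<theta>) \<mu>" "uniformly_bounded M (t0 - \<theta>) (T + \<theta>) \<mu>'"
      "uniformly_bounded M (t0 - \<theta>) (T + \<theta>) \<sigma>" "uniformly_bounded M (t0 - \<theta>) (T + \<theta>) \<sigma>'"
    and Q: "Q \<in> S2_process M F T (T + \<theta>)" and P: "P \<in> L2_process M F T (T + \<theta>)"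
    and bsde: "solves_anticipated_bsde M F W t0 T \<theta> \<mu> \<mu>' \<sigma> \<sigma>' l Q P Y Z"
    and t: "t \<in> {t0..T}" and sde: "solves_delay_sde M F W T \<theta> \<mu> \<mu>' \<sigma> \<sigma>' t X"
  shows "AE \<omega> in M. Y t \<omega> = real_cond_exp M (F t)
        (\<lambda>\<omega>. X T \<omega> * Q T \<omega>
            + (LINT s:{t..T}|lborel. X s \<omega> * l s \<omega>)
            + (LINT s:{T..T + \<theta>}|lborel.
                 (Q s \<omega> * \<mu>' (s - \<theta>) \<omega> + P s \<omega> \<bullet> \<sigma>' (s - \<theta>) \<omega>) * X (s - \<theta>) \<omega>)) \<omega>"
proof -
  have tt: "0 \<le> t" "t0 \<le> t" "t \<le> T" using t times by auto
  have YS: "Y \<in> S2_process M F t0 (T + \<theta>)" and ZL: "Z \<in> L2_process M F t0 (T + \<theta>)"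
    and YQ: "\<forall>s\<in>{T..T + \<theta>}. AE \<omega> in M. Y s \<omega> = Q s \<omega>"
    and ZP: "AE s in lborel. s \<in> {T..T + \<theta>} \<longrightarrow> (AE \<omega> in M. Z s \<omega> = P s \<omega>)"
    using bsde by (auto simp: solves_anticipated_bsde_def)
  obtain U V where U: "cond_exp_process M F t0 T (\<lambda>r. Y (r + \<theta>)) U"
    and V: "cond_exp_process M F t0 T (\<lambda>r. Z (r + \<theta>)) V"
    and Yeq: "\<forall>r\<in>{t0..T}. \<exists>I. has_ito_integral M F W r T Z I \<and>
          (AE \<omega> in M. Y r \<omega> = Y T \<omega>
             + (LINT s:{r..T}|lborel. \<mu> s \<omega> * Y s \<omega> + \<mu>' s \<omega> * U s \<omega>
                  + Z s \<omega> \<bullet> \<sigma> s \<omega> + V s \<omega> \<bullet> \<sigma>' s \<omega> + l s \<omega>)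
             - I \<omega>)"
    using bsde unfolding solves_anticipated_bsde_def by blast
  have XL: "X \<in> L2_process M F (t - \<theta>) (T + \<theta>)" and XS: "X \<in> S2_process M F t (T + \<theta>)"
    and Xeq: "\<forall>s\<in>{t..T + \<theta>}. \<exists>I.
        has_ito_integral M F W t s
          (\<lambda>r \<omega>. X r \<omega> *\<^sub>R \<sigma> r \<omega> + X (r - \<theta>) \<omega> *\<^sub>R \<sigma>' (r - \<theta>) \<omega>) I \<and>
        (AE \<omega> in M. X s \<omega> = X t \<omega>
           + (LINT r:{t..s}|lborel. \<mu> r \<omega> * X r \<omega> + \<mu>' (r - \<theta>) \<omega> * X (r - \<theta>) \<omega>)
           + I \<omega>)"
    and X1: "AE \<omega> in M. X t \<omega> = 1" and X0: "\<forall>s\<in>{t - \<theta>..<t}. AE \<omega> in M. X s \<omega> = 0"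
    using sde unfolding solves_delay_sde_def by blast+
  have YL: "Y \<in> L2_process M F t0 (T + \<theta>)" and QL: "Q \<in> L2_process M F T (T + \<theta>)"
    using YS Q by (auto simp: S2_process_def)
  obtain C1 where C1: "\<And>r \<omega>. r \<in> {t0 - \<theta>..T + \<theta>} \<Longrightarrow> \<omega> \<in> space M \<Longrightarrow> norm (\<mu> r \<omega>) \<le> C1"
    using uniformly_boundedE[OF bounded(1)] by metis
  obtain C2 where C2: "\<And>r \<omega>. r \<in> {t0 - \<theta>..T + \<theta>} \<Longrightarrow> \<omega> \<in> space M \<Longrightarrow> norm (\<mu>' r \<omega>) \<le> C2"
    using uniformly_boundedE[OF bounded(2)] by metis
  obtain C3 where C3: "\<And>r \<omega>. r \<in> {t0 - \<theta>..T + \<theta>} \<Longrightarrow> \<omega> \<in> space M \<Longrightarrow> norm (\<sigma> r \<omega>) \<le> C3"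
    using uniformly_boundedE[OF bounded(3)] by metis
  obtain C4 where C4: "\<And>r \<omega>. r \<in> {t0 - \<theta>..T + \<theta>} \<Longrightarrow> \<omega> \<in> space M \<Longrightarrow> norm (\<sigma>' r \<omega>) \<le> C4"
    using uniformly_boundedE[OF bounded(4)] by metis

  note sub = L2_fun_restricted_subset and msub = restricted_measurable_subset
  have X_sq: "L2_fun TM (restricted t (T + \<theta>) X)"
    by (rule sub[OF _ L2_processD(1)[OF XL]]) (use times in auto)
  have Xd_sq: "L2_fun TM (restricted t (T + \<theta>) (\<lambda>r. X (r - \<theta>)))"
    by (rule L2_fun_restricted_shift, rule sub[OF _ L2_processD(1)[OF XL]]) (use times in auto)
  have XT_sq: "L2_fun TM (restricted t T X)"
    by (rule sub[OF _ X_sq]) (use times in auto)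
  have Y_sq: "L2_fun TM (restricted t (T + \<theta>) Y)"
    by (rule sub[OF _ L2_processD(1)[OF YL]]) (use tt in auto)
  have YT_sq: "L2_fun TM (restricted t T Y)"
    by (rule sub[OF _ Y_sq]) (use times in auto)
  have Yd_sq: "L2_fun TM (restricted (t + \<theta>) (T + \<theta>) Y)"
    by (rule sub[OF _ Y_sq]) (use times in auto)
  have Z_sq: "L2_fun TM (restricted t (T + \<theta>) Z)"
    by (rule sub[OF _ L2_processD(1)[OF ZL]]) (use tt in auto)
  have ZT_sq: "L2_fun TM (restricted t T Z)"
    by (rule sub[OF _ Z_sq]) (use times in auto)
  have Zd_sq: "L2_fun TM (restricted (t + \<theta>) (T + \<theta>) Z)"
    by (rule sub[OF _ Z_sq]) (use times in auto)
  have U_sq: "L2_fun TM (restricted t T U)"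
    by (rule cond_exp_processD(1)[OF U])
       (use tt L2_fun_restricted_shift[of t "- \<theta>" T Y] Yd_sq in auto)
  have V_sq: "L2_fun TM (restricted t T V)"
    by (rule cond_exp_processD(1)[OF V])
       (use tt L2_fun_restricted_shift[of t "- \<theta>" T Z] Zd_sq in auto)
  have l_sq: "L2_fun TM (restricted t T l)"
    by (rule sub[OF _ L2_processD(1)[OF l]]) (use tt in auto)
  have \<mu>X: "L2_fun TM (restricted t T (\<lambda>r \<omega>. \<mu> r \<omega> * X r \<omega>))"
    by (rule L2_fun_restricted_mult[OF msub[OF _ L2_processD(3)[OF \<mu>]] C1 XT_sq]) (use tt times in auto)
  have \<mu>'X: "L2_fun TM (restricted t T (\<lambda>r \<omega>. \<mu>' r \<omega> * X r \<omega>))"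
    by (rule L2_fun_restricted_mult[OF msub[OF _ L2_processD(3)[OF \<mu>']] C2 XT_sq]) (use tt times in auto)
  have \<mu>Y: "L2_fun TM (restricted t T (\<lambda>r \<omega>. \<mu> r \<omega> * Y r \<omega>))"
    by (rule L2_fun_restricted_mult[OF msub[OF _ L2_processD(3)[OF \<mu>]] C1 YT_sq]) (use tt times in auto)
  have \<mu>'U: "L2_fun TM (restricted t T (\<lambda>r \<omega>. \<mu>' r \<omega> * U r \<omega>))"
    by (rule L2_fun_restricted_mult[OF msub[OF _ L2_processD(3)[OF \<mu>']] C2 U_sq]) (use tt times in auto)
  have Z\<sigma>: "L2_fun TM (restricted t T (\<lambda>r \<omega>. Z r \<omega> \<bullet> \<sigma> r \<omega>))"
    by (rule L2_fun_restricted_inner[OF msub[OF _ L2_processD(3)[OF \<sigma>]] C3 ZT_sq]) (use tt times in auto)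
  have V\<sigma>': "L2_fun TM (restricted t T (\<lambda>r \<omega>. V r \<omega> \<bullet> \<sigma>' r \<omega>))"
    by (rule L2_fun_restricted_inner[OF msub[OF _ L2_processD(3)[OF \<sigma>']] C4 V_sq]) (use tt times in auto)
  have X\<sigma>: "L2_fun TM (restricted t T (\<lambda>r \<omega>. X r \<omega> *\<^sub>R \<sigma> r \<omega>))"
    by (rule L2_fun_restricted_scaleR[OF msub[OF _ L2_processD(3)[OF \<sigma>]] C3 XT_sq]) (use tt times in auto)
  have X\<sigma>': "L2_fun TM (restricted t T (\<lambda>r \<omega>. X r \<omega> *\<^sub>R \<sigma>' r \<omega>))"
    by (rule L2_fun_restricted_scaleR[OF msub[OF _ L2_processD(3)[OF \<sigma>']] C4 XT_sq]) (use tt times in auto)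
  have \<mu>d: "restricted t (T + \<theta>) (\<lambda>r. \<mu>' (r - \<theta>)) \<in> borel_measurable TM"
    by (rule restricted_shift_measurable, rule msub[OF _ L2_processD(3)[OF \<mu>']]) (use tt times in auto)
  have \<sigma>d: "restricted t (T + \<theta>) (\<lambda>r. \<sigma>' (r - \<theta>)) \<in> borel_measurable TM"
    by (rule restricted_shift_measurable, rule msub[OF _ L2_processD(3)[OF \<sigma>']]) (use tt times in auto)
  \<comment> \<open>The delayed parts of the drift and of the diffusion of \<open>X\<close>. The
    time shift of the anticipated terms of \<open>Y\<close> reproduces the same two expressions, so
    naming them makes the cancellation visible.\<close>
  define \<alpha> where "\<alpha> r \<omega> = \<mu>' (r - \<theta>) \<omega> * X (r - \<theta>) \<omega>" for r \<omega>
  define \<beta> where "\<beta> r \<omega> = X (r - \<theta>) \<omega> *\<^sub>R \<sigma>' (r - \<theta>) \<omega>" for r \<omega>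
  have \<mu>Xd: "L2_fun TM (restricted t (T + \<theta>) \<alpha>)"
    unfolding \<alpha>_def[abs_def]
    by (rule L2_fun_restricted_mult[OF \<mu>d C2 Xd_sq]) (use tt times in auto)
  have \<sigma>Xd: "L2_fun TM (restricted t (T + \<theta>) \<beta>)"
    unfolding \<beta>_def[abs_def]
    by (rule L2_fun_restricted_scaleR[OF \<sigma>d C4 Xd_sq]) (use tt times in auto)

  define a where "a r \<omega> = \<mu> r \<omega> * X r \<omega> + \<alpha> r \<omega>" for r \<omega>
  define b where "b r \<omega> = X r \<omega> *\<^sub>R \<sigma> r \<omega> + \<beta> r \<omega>" for r \<omega>
  define f where "f r \<omega> = \<mu> r \<omega> * Y r \<omega> + \<mu>' r \<omega> * U r \<omega> + Z r \<omega> \<bullet> \<sigma> r \<omega> + V r \<omega> \<bullet> \<sigma>' r \<omega> + l r \<omega>" for r \<omega>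
  \<comment> \<open>\<open>h\<close> is the contribution of the delay to the drift of the product;
    \<open>k\<close> is what it becomes on \<open>[T, T + \<theta>]\<close>, where \<open>Y\<close>
    and \<open>Z\<close> are prescribed by \<open>Q\<close> and \<open>P\<close>.\<close>
  define h where "h r \<omega> = \<alpha> r \<omega> \<bullet> Y r \<omega> + \<beta> r \<omega> \<bullet> Z r \<omega>" for r \<omega>
  define k where "k r \<omega> = (Q r \<omega> * \<mu>' (r - \<theta>) \<omega> + P r \<omega> \<bullet> \<sigma>' (r - \<theta>) \<omega>) * X (r - \<theta>) \<omega>" for r \<omega>

  have a: "L2_fun TM (restricted t T a)"
    unfolding a_def[abs_def]
    by (intro L2_fun_restricted_add \<mu>X sub[OF _ \<mu>Xd]) (use times in auto)
  have b: "L2_fun TM (restricted t T b)"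
    unfolding b_def[abs_def]
    by (intro L2_fun_restricted_add X\<sigma> sub[OF _ \<sigma>Xd]) (use times in auto)
  have f: "L2_fun TM (restricted t T f)"
    unfolding f_def[abs_def] by (intro L2_fun_restricted_add \<mu>Y \<mu>'U Z\<sigma> V\<sigma>' l_sq)
  have h_int: "integrable TM (restricted t (T + \<theta>) h)"
  proof -
    have "integrable TM (\<lambda>x. restricted t (T + \<theta>) \<alpha> x \<bullet> restricted t (T + \<theta>) Y x
        + restricted t (T + \<theta>) \<beta> x \<bullet> restricted t (T + \<theta>) Z x)"
      by (intro Bochner_Integration.integrable_add L2_fun_inner \<mu>Xd \<sigma>Xd Y_sq Z_sq)
    then show ?thesis
      unfolding h_def[abs_def] restricted_add[abs_def] restricted_inner[abs_def] .
  qed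
  \<comment> \<open>\<open>h\<close> is built from products of square-integrable functions, so mere
    integrability is what has to be passed to smaller intervals.\<close>
  have sub_int: "integrable TM (restricted c d \<phi>)" if "{c..d} \<subseteq> {a..b}" "integrable TM (restricted a b \<phi>)"
    for a b c d and \<phi> :: "real \<Rightarrow> 'w \<Rightarrow> real"
  proof -
    have "integrable TM (\<lambda>x. indicator ({c..d} \<times> space M) x *\<^sub>R restricted a b \<phi> x)"
      by (rule integrable_mult_indicator[OF _ that(2)]) auto
    then show ?thesis
      unfolding restricted_subset[OF that(1)]
      by (rule Bochner_Integration.integrable_cong[THEN iffD1, OF refl, rotated])
         (auto simp: indicator_def space_pair_measure)
  qed
  have h1: "integrable TM (restricted t T h)" and h2: "integrable TM (restricted (t + \<theta>) (T + \<theta>) h)"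
    by (rule sub_int[OF _ h_int]; use times in simp)+
  have k_int: "integrable TM (restricted T (T + \<theta>) k)"
  proof -
    have 1: "L2_fun TM (restricted T (T + \<theta>) \<alpha>)"
      and 2: "L2_fun TM (restricted T (T + \<theta>) \<beta>)"
      by (rule sub[OF _ \<mu>Xd], use tt in simp, rule sub[OF _ \<sigma>Xd], use tt in simp)
    have k: "k = (\<lambda>r \<omega>. \<alpha> r \<omega> \<bullet> Q r \<omega> + \<beta> r \<omega> \<bullet> P r \<omega>)"
      by (simp add: k_def[abs_def] \<alpha>_def \<beta>_def algebra_simps inner_commute)
    have "integrable TM (\<lambda>x. restricted T (T + \<theta>) \<alpha> x \<bullet> restricted T (T + \<theta>) Q x
        + restricted T (T + \<theta>) \<beta> x \<bullet> restricted T (T + \<theta>) P x)"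
      by (intro Bochner_Integration.integrable_add L2_fun_inner 1 2 L2_processD(1) QL P)
    then show ?thesis
      unfolding k restricted_add[abs_def] restricted_inner[abs_def] .
  qed
  have kl: "integrable TM (restricted t T (\<lambda>r \<omega>. X r \<omega> * l r \<omega>))"
    unfolding restricted_mult[abs_def] by (rule L2_fun_mult[OF XT_sq l_sq])
  have kU: "integrable TM (\<lambda>x. restricted t T (\<lambda>r \<omega>. \<mu>' r \<omega> * X r \<omega>) x \<bullet> restricted t T U x)"
    by (rule L2_fun_inner[OF \<mu>'X U_sq])
  have kV: "integrable TM (\<lambda>x. restricted t T (\<lambda>r \<omega>. X r \<omega> *\<^sub>R \<sigma>' r \<omega>) x \<bullet> restricted t T V x)"
    by (rule L2_fun_inner[OF X\<sigma>' V_sq])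

  have Fm: "X r \<in> borel_measurable (F r)" "\<mu> r \<in> borel_measurable (F r)" "\<mu>' r \<in> borel_measurable (F r)"
      "\<sigma> r \<in> borel_measurable (F r)" "\<sigma>' r \<in> borel_measurable (F r)" "X (r - \<theta>) \<in> borel_measurable (F r)"
      "\<mu>' (r - \<theta>) \<in> borel_measurable (F r)" "\<sigma>' (r - \<theta>) \<in> borel_measurable (F r)"
      "Y r \<in> borel_measurable (F r)" "Z r \<in> borel_measurable (F r)" "l r \<in> borel_measurable (F r)"
      "U r \<in> borel_measurable (F r)" "V r \<in> borel_measurable (F r)"
    if r: "r \<in> {t..T}" for r
  proof -
    show "X r \<in> borel_measurable (F r)" "\<mu> r \<in> borel_measurable (F r)" "\<mu>' r \<in> borel_measurable (F r)"
      "\<sigma> r \<in> borel_measurable (F r)" "\<sigma>' r \<in> borel_measurable (F r)"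
      "Y r \<in> borel_measurable (F r)" "Z r \<in> borel_measurable (F r)" "l r \<in> borel_measurable (F r)"
      by (rule L2_processD(2)[OF XL] L2_processD(2)[OF \<mu>] L2_processD(2)[OF \<mu>'] L2_processD(2)[OF \<sigma>]
          L2_processD(2)[OF \<sigma>'] L2_processD(2)[OF YL] L2_processD(2)[OF ZL] L2_processD(2)[OF l];
          use r tt times in simp)+
    \<comment> \<open>The delayed time may be negative; the monotonicity of \<open>F\<close> covers
      this as well.\<close>
    show "X (r - \<theta>) \<in> borel_measurable (F r)"
      by (rule measurable_F_mono[OF L2_processD(2)[OF XL]]) (use r tt times in auto)
    show "\<mu>' (r - \<theta>) \<in> borel_measurable (F r)"
      by (rule measurable_F_mono[OF L2_processD(2)[OF \<mu>']]) (use r tt times in auto)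
    show "\<sigma>' (r - \<theta>) \<in> borel_measurable (F r)"
      by (rule measurable_F_mono[OF L2_processD(2)[OF \<sigma>']]) (use r tt times in auto)
    show "U r \<in> borel_measurable (F r)" "V r \<in> borel_measurable (F r)"
      using U V r tt by (auto simp: cond_exp_process_def adapted_on_def)
  qed

  \<comment> \<open>The representation formula integrated over \<open>G\<close>, with
    \<open>Y T\<close> still in the place of \<open>Q T\<close> and \<open>X t\<close> still in the
    place of 1.\<close>
  have main: "(\<integral>\<omega>. indicator G \<omega> * (X T \<omega> * Y T \<omega>) \<partial>M) - (\<integral>\<omega>. indicator G \<omega> * (X t \<omega> * Y t \<omega>) \<partial>M) =
      - (\<integral>x. indicator G (snd x) * restricted T (T + \<theta>) k x \<partial>TM)
      - (\<integral>x. indicator G (snd x) * restricted t T (\<lambda>r \<omega>. X r \<omega> * l r \<omega>) x \<partial>TM)"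
    if G: "G \<in> sets (F t)" for G
  proof -
    have GM: "G \<in> sets M" using G subalgebra_F[of t] by (auto simp: subalgebra_def)
    note ind = integrable_indicator_snd[OF _ GM]
    let ?i = "\<lambda>x::real \<times> 'w. indicator G (snd x) :: real"
    let ?HU = "\<lambda>r \<omega>. \<mu>' r \<omega> * X r \<omega>" and ?HV = "\<lambda>r \<omega>. X r \<omega> *\<^sub>R \<sigma>' r \<omega>"
    have "(\<integral>\<omega>. indicator G \<omega> * (X T \<omega> * Y T \<omega>) \<partial>M) - (\<integral>\<omega>. indicator G \<omega> * (X t \<omega> * Y t \<omega>) \<partial>M) =
      (\<integral>x. ?i x * (restricted t T a x * restricted t T Y x - restricted t T f x * restricted t T X x
        + restricted t T b x \<bullet> restricted t T Z x) \<partial>TM)"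
    proof (rule semimartingale_product[OF tt(1,3) G a _ f _ b ZT_sq XT_sq _ _ _ YT_sq])
      fix r assume r: "r \<in> {t..T}"
      note [measurable] = Fm[OF r]
      show "a r \<in> borel_measurable (F r)" unfolding a_def \<alpha>_def by measurable
      show "f r \<in> borel_measurable (F r)" unfolding f_def by measurable
      show "\<exists>I. has_ito_integral M F W t r b I \<and>
          (AE \<omega> in M. X r \<omega> = X t \<omega> + (LINT s:{t..r}|lborel. a s \<omega>) + I \<omega>)"
        using Xeq r times unfolding a_def b_def[abs_def] \<alpha>_def \<beta>_def by simp
      show "\<exists>I. has_ito_integral M F W r T Z I \<and>
          (AE \<omega> in M. Y r \<omega> = Y T \<omega> + (LINT s:{r..T}|lborel. f s \<omega>) - I \<omega>)"
        using Yeq r tt unfolding f_def by simp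
    next
      show "L2_fun M (X T)" "L2_fun M (X t)"
        by (rule S2_process_L2_fun[OF XS]; use tt times in simp)+
      show "L2_fun M (Y T)" "L2_fun M (Y t)"
        by (rule S2_process_L2_fun[OF YS]; use tt times in simp)+
      show "X t \<in> borel_measurable (F t)" "Y t \<in> borel_measurable (F t)"
        using Fm(1,9)[of t] tt by auto
    qed
    \<comment> \<open>In \<open>a * Y - f * X + b \<bullet> Z\<close> the terms with
      \<open>\<mu>\<close> cancel, and so do those with \<open>\<sigma>\<close>. The delay terms,
      the anticipated terms and \<open>l\<close> remain.\<close>
    also have "\<dots> = (\<integral>x. ?i x * restricted t T h x - ?i x * (restricted t T ?HU x \<bullet> restricted t T U x)
        - ?i x * (restricted t T ?HV x \<bullet> restricted t T V x) - ?i x * restricted t T (\<lambda>r \<omega>. X r \<omega> * l r \<omega>) x \<partial>TM)"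
    proof (rule Bochner_Integration.integral_cong[OF refl], clarify)
      fix r \<omega>
      show "?i (r, \<omega>) * (restricted t T a (r, \<omega>) * restricted t T Y (r, \<omega>) -
          restricted t T f (r, \<omega>) * restricted t T X (r, \<omega>) + restricted t T b (r, \<omega>) \<bullet> restricted t T Z (r, \<omega>)) =
        ?i (r, \<omega>) * restricted t T h (r, \<omega>) - ?i (r, \<omega>) * (restricted t T ?HU (r, \<omega>) \<bullet> restricted t T U (r, \<omega>))
        - ?i (r, \<omega>) * (restricted t T ?HV (r, \<omega>) \<bullet> restricted t T V (r, \<omega>))
        - ?i (r, \<omega>) * restricted t T (\<lambda>r \<omega>. X r \<omega> * l r \<omega>) (r, \<omega>)"
        by (cases "r \<in> {t..T}")
           (simp_all add: restricted_def a_def b_def f_def h_def inner_add_left inner_commute algebra_simps)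
    qed
    also have "\<dots> = (\<integral>x. ?i x * restricted t T h x \<partial>TM) - (\<integral>x. ?i x * (restricted t T ?HU x \<bullet> restricted t T U x) \<partial>TM)
        - (\<integral>x. ?i x * (restricted t T ?HV x \<bullet> restricted t T V x) \<partial>TM)
        - (\<integral>x. ?i x * restricted t T (\<lambda>r \<omega>. X r \<omega> * l r \<omega>) x \<partial>TM)"
    proof -
      note i = ind[OF h1] ind[OF kU] ind[OF kV] ind[OF kl]
      show ?thesis
        unfolding Bochner_Integration.integral_diff[OF Bochner_Integration.integrable_diff[OF
              Bochner_Integration.integrable_diff[OF i(1,2)] i(3)] i(4)]
          Bochner_Integration.integral_diff[OF Bochner_Integration.integrable_diff[OF i(1,2)] i(3)]
          Bochner_Integration.integral_diff[OF i(1,2)] ..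
    qed
    \<comment> \<open>Without conditional expectation and shifted by \<open>\<theta>\<close>, the
      anticipated terms are the two halves of \<open>h\<close> on
      \<open>[t + \<theta>, T + \<theta>]\<close>.\<close>
    also have "(\<integral>x. ?i x * (restricted t T ?HU x \<bullet> restricted t T U x) \<partial>TM) =
        (\<integral>x. ?i x * restricted (t + \<theta>) (T + \<theta>) (\<lambda>r \<omega>. \<alpha> r \<omega> \<bullet> Y r \<omega>) x \<partial>TM)"
      unfolding \<alpha>_def
    proof (rule integral_cond_exp_shift[OF U _ Yd_sq \<mu>'X _ G])
      show "?HU r \<in> borel_measurable (F r)" if "r \<in> {t..T}" for r
        using Fm[OF that] by measurable
    qed (use tt in simp)
    also have "(\<integral>x. ?i x * (restricted t T ?HV x \<bullet> restricted t T V x) \<partial>TM) =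
        (\<integral>x. ?i x * restricted (t + \<theta>) (T + \<theta>) (\<lambda>r \<omega>. \<beta> r \<omega> \<bullet> Z r \<omega>) x \<partial>TM)"
      unfolding \<beta>_def
    proof (rule integral_cond_exp_shift[OF V _ Zd_sq X\<sigma>' _ G])
      show "?HV r \<in> borel_measurable (F r)" if "r \<in> {t..T}" for r
        using Fm[OF that] by measurable
    qed (use tt in simp)
    finally have A: "(\<integral>\<omega>. indicator G \<omega> * (X T \<omega> * Y T \<omega>) \<partial>M) - (\<integral>\<omega>. indicator G \<omega> * (X t \<omega> * Y t \<omega>) \<partial>M) =
      (\<integral>x. ?i x * restricted t T h x \<partial>TM)
      - (\<integral>x. ?i x * restricted (t + \<theta>) (T + \<theta>) (\<lambda>r \<omega>. \<alpha> r \<omega> \<bullet> Y r \<omega>) x \<partial>TM)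
      - (\<integral>x. ?i x * restricted (t + \<theta>) (T + \<theta>) (\<lambda>r \<omega>. \<beta> r \<omega> \<bullet> Z r \<omega>) x \<partial>TM)
      - (\<integral>x. ?i x * restricted t T (\<lambda>r \<omega>. X r \<omega> * l r \<omega>) x \<partial>TM)" .
    have B: "(\<integral>x. ?i x * restricted (t + \<theta>) (T + \<theta>) h x \<partial>TM) =
      (\<integral>x. ?i x * restricted (t + \<theta>) (T + \<theta>) (\<lambda>r \<omega>. \<alpha> r \<omega> \<bullet> Y r \<omega>) x \<partial>TM)
      + (\<integral>x. ?i x * restricted (t + \<theta>) (T + \<theta>) (\<lambda>r \<omega>. \<beta> r \<omega> \<bullet> Z r \<omega>) x \<partial>TM)"
    proof -
      have "L2_fun TM (restricted (t + \<theta>) (T + \<theta>) \<alpha>)"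
        by (rule sub[OF _ \<mu>Xd]) (use times in simp)
      from ind[OF L2_fun_inner[OF this Yd_sq]]
      have 1: "integrable TM (\<lambda>x. ?i x * restricted (t + \<theta>) (T + \<theta>) (\<lambda>r \<omega>. \<alpha> r \<omega> \<bullet> Y r \<omega>) x)"
        by (simp only: restricted_inner)
      have "L2_fun TM (restricted (t + \<theta>) (T + \<theta>) \<beta>)"
        by (rule sub[OF _ \<sigma>Xd]) (use times in simp)
      from ind[OF L2_fun_inner[OF this Zd_sq]]
      have 2: "integrable TM (\<lambda>x. ?i x * restricted (t + \<theta>) (T + \<theta>) (\<lambda>r \<omega>. \<beta> r \<omega> \<bullet> Z r \<omega>) x)"
        by (simp only: restricted_inner)
      show ?thesis
        unfolding h_def[abs_def] restricted_add distrib_left by (rule Bochner_Integration.integral_add[OF 1 2])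
    qed
    text \<open>On \<open>[t, t + \<theta>)\<close> the delayed state vanishes, so the two integrals of \<open>h\<close> telescope.\<close>
    have "(\<integral>x. ?i x * restricted t T h x - ?i x * restricted (t + \<theta>) (T + \<theta>) h x + ?i x * restricted T (T + \<theta>) k x \<partial>TM) = 0"
    proof (rule integral_TM_eq_0)
      show "integrable TM (\<lambda>x. ?i x * restricted t T h x - ?i x * restricted (t + \<theta>) (T + \<theta>) h x + ?i x * restricted T (T + \<theta>) k x)"
        by (intro Bochner_Integration.integrable_add Bochner_Integration.integrable_diff ind h1 h2 k_int)
      show "AE r in lborel. AE \<omega> in M. ?i (r, \<omega>) * restricted t T h (r, \<omega>) -
          ?i (r, \<omega>) * restricted (t + \<theta>) (T + \<theta>) h (r, \<omega>) + ?i (r, \<omega>) * restricted T (T + \<theta>) k (r, \<omega>) = 0"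
        \<comment> \<open>The time \<open>T\<close> lies in both \<open>{t..T}\<close> and
          \<open>{T..T + \<theta>}\<close> and would be counted twice; it is discarded as a null
          set.\<close>
        using ZP AE_lborel_singleton[of T]
      proof eventually_elim
        case (elim r)
        have 1: "AE \<omega> in M. r \<in> {t..<t + \<theta>} \<longrightarrow> X (r - \<theta>) \<omega> = 0"
          using X0 by (cases "r \<in> {t..<t + \<theta>}") auto
        have 2: "AE \<omega> in M. r \<in> {T..T + \<theta>} \<longrightarrow> Y r \<omega> = Q r \<omega>"
          using YQ by (cases "r \<in> {T..T + \<theta>}") auto
        have 3: "AE \<omega> in M. r \<in> {T..T + \<theta>} \<longrightarrow> Z r \<omega> = P r \<omega>"
          using elim(1) by (cases "r \<in> {T..T + \<theta>}") auto
        show ?case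
          using 1 2 3
        proof eventually_elim
          case (elim \<omega>)
          \<comment> \<open>\<open>k\<close> vanishes here together with \<open>h\<close>, which is
            essential if \<open>T < t + \<theta>\<close>.\<close>
          have z: "h r \<omega> = 0" "k r \<omega> = 0" if "r \<in> {t..<t + \<theta>}"
            using elim(1) that by (auto simp: h_def k_def \<alpha>_def \<beta>_def)
          have hk: "h r \<omega> = k r \<omega>" if "r \<in> {T..T + \<theta>}"
            using elim(2,3) that by (auto simp: h_def k_def \<alpha>_def \<beta>_def algebra_simps inner_commute)
          \<comment> \<open>From \<open>t\<close> up to \<open>t + \<theta>\<close> every term is 0.
            Later, the two copies of \<open>h\<close> cancel before \<open>T\<close>, and after
            \<open>T\<close> the shifted copy of \<open>h\<close> cancels against
            \<open>k\<close>.\<close>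
          show ?case
            using z hk \<open>r \<noteq> T\<close> tt times
            by (cases "r < t + \<theta>"; cases "r < T") (auto simp: restricted_def indicator_def)
        qed
      qed
    qed
    moreover have "(\<integral>x. ?i x * restricted t T h x - ?i x * restricted (t + \<theta>) (T + \<theta>) h x + ?i x * restricted T (T + \<theta>) k x \<partial>TM) =
      (\<integral>x. ?i x * restricted t T h x \<partial>TM) - (\<integral>x. ?i x * restricted (t + \<theta>) (T + \<theta>) h x \<partial>TM)
      + (\<integral>x. ?i x * restricted T (T + \<theta>) k x \<partial>TM)"
      unfolding Bochner_Integration.integral_add[OF Bochner_Integration.integrable_diff[OF ind[OF h1] ind[OF h2]] ind[OF k_int]]
        Bochner_Integration.integral_diff[OF ind[OF h1] ind[OF h2]] ..
    ultimately show ?thesis using A B by linarith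
  qed

  interpret S: sigma_finite_subalgebra M "F t" by (rule sigma_finite_subalgebra_F)
  let ?kl = "\<lambda>\<omega>. LINT s:{t..T}|lborel. X s \<omega> * l s \<omega>" and ?k = "\<lambda>\<omega>. LINT s:{T..T + \<theta>}|lborel. k s \<omega>"
  have QT: "L2_fun M (Q T)" and XT: "L2_fun M (X T)"
    and Yt: "L2_fun M (Y t)" and YT: "L2_fun M (Y T)" and Xt: "L2_fun M (X t)"
    using S2_process_L2_fun[OF Q, of T] S2_process_L2_fun[OF XS, of T]
      S2_process_L2_fun[OF XS, of t] S2_process_L2_fun[OF YS, of t]
      S2_process_L2_fun[OF YS, of T] tt times by auto
  have XQ: "integrable M (\<lambda>\<omega>. X T \<omega> * Q T \<omega>)" by (rule L2_fun_mult[OF XT QT])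
  have ikl: "integrable M ?kl" and ik: "integrable M ?k"
    by (rule integral_set_integral(1)[OF kl sets.top], rule integral_set_integral(1)[OF k_int sets.top])
  have "AE \<omega> in M. real_cond_exp M (F t) (\<lambda>\<omega>. X T \<omega> * Q T \<omega> + ?kl \<omega> + ?k \<omega>) \<omega> = Y t \<omega>"
  proof (rule S.real_cond_exp_charact)
    fix G assume G: "G \<in> sets (F t)"
    have GM[measurable]: "G \<in> sets M" using G subalgebra_F[of t] by (auto simp: subalgebra_def)
    note [measurable] = QT[THEN L2_fun_measurable] XT[THEN L2_fun_measurable]
      Yt[THEN L2_fun_measurable] YT[THEN L2_fun_measurable]
      Xt[THEN L2_fun_measurable]
    have gi: "integrable M (\<lambda>\<omega>. indicator G \<omega> * q \<omega>)" if "integrable M q" for q :: "'w \<Rightarrow> real"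
      using integrable_mult_indicator[OF GM that] by simp
    have "(\<integral>\<omega>\<in>G. X T \<omega> * Q T \<omega> + ?kl \<omega> + ?k \<omega> \<partial>M) =
        (\<integral>\<omega>. indicator G \<omega> * (X T \<omega> * Q T \<omega>) + indicator G \<omega> * ?kl \<omega> + indicator G \<omega> * ?k \<omega> \<partial>M)"
      by (simp add: set_lebesgue_integral_def distrib_left)
    also have "\<dots> = (\<integral>\<omega>. indicator G \<omega> * (X T \<omega> * Q T \<omega>) \<partial>M) + (\<integral>\<omega>. indicator G \<omega> * ?kl \<omega> \<partial>M)
        + (\<integral>\<omega>. indicator G \<omega> * ?k \<omega> \<partial>M)"
      unfolding Bochner_Integration.integral_add[OF Bochner_Integration.integrable_add[OF gi[OF XQ] gi[OF ikl]] gi[OF ik]]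
        Bochner_Integration.integral_add[OF gi[OF XQ] gi[OF ikl]] ..
    also have "(\<integral>\<omega>. indicator G \<omega> * (X T \<omega> * Q T \<omega>) \<partial>M) = (\<integral>\<omega>. indicator G \<omega> * (X T \<omega> * Y T \<omega>) \<partial>M)"
    proof (rule integral_cong_AE)
      have "AE \<omega> in M. Y T \<omega> = Q T \<omega>" using YQ times by simp
      then show "AE \<omega> in M. indicator G \<omega> * (X T \<omega> * Q T \<omega>) = indicator G \<omega> * (X T \<omega> * Y T \<omega>)"
        by eventually_elim simp
    qed measurable
    also have "\<dots> + (\<integral>\<omega>. indicator G \<omega> * ?kl \<omega> \<partial>M) + (\<integral>\<omega>. indicator G \<omega> * ?k \<omega> \<partial>M) =
        (\<integral>\<omega>. indicator G \<omega> * (X t \<omega> * Y t \<omega>) \<partial>M)"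
      using main[OF G] unfolding integral_set_integral(2)[OF kl GM] integral_set_integral(2)[OF k_int GM]
      by linarith
    also have "\<dots> = (\<integral>\<omega>\<in>G. Y t \<omega> \<partial>M)"
      unfolding set_lebesgue_integral_def
    proof (rule integral_cong_AE)
      show "AE \<omega> in M. indicator G \<omega> * (X t \<omega> * Y t \<omega>) = indicator G \<omega> *\<^sub>R Y t \<omega>"
        using X1 by eventually_elim simp
    qed measurable
    finally show "(\<integral>\<omega>\<in>G. X T \<omega> * Q T \<omega> + ?kl \<omega> + ?k \<omega> \<partial>M) = (\<integral>\<omega>\<in>G. Y t \<omega> \<partial>M)" .
  next
    show "integrable M (\<lambda>\<omega>. X T \<omega> * Q T \<omega> + ?kl \<omega> + ?k \<omega>)"
      by (intro Bochner_Integration.integrable_add XQ ikl ik)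
    show "integrable M (Y t)" by (rule L2_fun_imp_integrable[OF Yt])
    show "Y t \<in> borel_measurable (F t)" using Fm(9)[of t] tt by simp
  qed
  then show ?thesis
    unfolding k_def by eventually_elim (rule sym)
qed

end

theorem theorem2p1:
  fixes M :: "'w measure" and F :: "real \<Rightarrow> 'w measure" and W :: "real \<Rightarrow> 'w \<Rightarrow> real ^ 'd"
    and T t0 \<theta> :: real
    and \<mu> \<mu>' l Q Y :: "real \<Rightarrow> 'w \<Rightarrow> real"
    and \<sigma> \<sigma>' P Z :: "real \<Rightarrow> 'w \<Rightarrow> real ^ 'd"
  assumes "brownian_basis M W F"
    and "T > 0" and "0 \<le> t0" and "t0 \<le> T" and "\<theta> > 0"
    and "\<mu> \<in> L2_process M F (t0 - \<theta>) (T + \<theta>)" and "\<mu>' \<in> L2_process M F (t0 - \<theta>) (T + \<theta>)"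
    and "l \<in> L2_process M F t0 T"
    and "\<sigma> \<in> L2_process M F (t0 - \<theta>) (T + \<theta>)" and "\<sigma>' \<in> L2_process M F (t0 - \<theta>) (T + \<theta>)"
    and "uniformly_bounded M (t0 - \<theta>) (T + \<theta>) \<mu>" and "uniformly_bounded M (t0 - \<theta>) (T + \<theta>) \<mu>'"
    and "uniformly_bounded M (t0 - \<theta>) (T + \<theta>) \<sigma>" and "uniformly_bounded M (t0 - \<theta>) (T + \<theta>) \<sigma>'"
    and "Q \<in> S2_process M F T (T + \<theta>)" and "P \<in> L2_process M F T (T + \<theta>)"
    and "solves_anticipated_bsde M F W t0 T \<theta> \<mu> \<mu>' \<sigma> \<sigma>' l Q P Y Z"
  shows "AE t in lborel. t \<in> {t0..T} \<longrightarrow>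
    (\<forall>X. solves_delay_sde M F W T \<theta> \<mu> \<mu>' \<sigma> \<sigma>' t X \<longrightarrow>
      (AE \<omega> in M. Y t \<omega> = real_cond_exp M (F t)
        (\<lambda>\<omega>. X T \<omega> * Q T \<omega>
            + (LINT s:{t..T}|lborel. X s \<omega> * l s \<omega>)
            + (LINT s:{T..T + \<theta>}|lborel.
                 (Q s \<omega> * \<mu>' (s - \<theta>) \<omega> + P s \<omega> \<bullet> \<sigma>' (s - \<theta>) \<omega>) * X (s - \<theta>) \<omega>)) \<omega>))"
proof -
  interpret brownian_basis M W F by fact
  show ?thesis
    \<comment> \<open>The representation holds at every \<open>t\<close> in the interval and
      therefore at almost every one.\<close>
    by (intro AE_I2 impI allI anticipated_bsde_representation[OF \<open>0 \<le> t0\<close> \<open>\<theta> > 0\<close>]) (use assms in auto)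
qed

end
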